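(* $\sim_l\ \subseteq\ \sim_s$.
   Context: Notation. $\mathcal D(S)$: finitely supported probability distributions on $S$; $\overline{s}$: point distribution; $\sum_ip_i\bullet\Delta_i$: convex combination; $\Delta_1\oplus_p\Delta_2=p\bullet\Delta_1+(1-p)\bullet\Delta_2$. Qubit names from a denumerable set $\mathcal Q$; $\mathcal H_\Sigma=(\mathbb C^2)^{\otimes|\Sigma|}$; superoperators $\rho\mapsto\sum_iE_i\rho E_i^\dagger$ (trace non-increasing if $\sum E_i^\dagger E_i\sqsubseteq\mathbb I$, trace-preserving if $=\mathbb I$); measurements $\mathbb M=\{M_m\}$ with $\sum M_m^\dagger M_m=\mathbb I$, $\mathcal M_m(\sigma)=M_m\sigma M_m^\dagger$; $\mathcal E^{\tilde q}$ applies $\mathcal E$ to qubits $\tilde q$ and the identity elsewhere; $\mathrm{tr}_{\Sigma'}$ is the partial trace over qubits in $\Sigma'$. Syntax (tagged lqCCS): tags $t\in\mathit{Tag}$; channels typed $\widehat{\mathbb N},\widehat{\mathbb B},\widehat{\mathcal Q}$; $P::=t:\tau.P\mid (t,t'):\tau.P\mid t:\mathcal E(\tilde e).P\mid t:\mathbb M(\tilde e\rhd x).P\mid t:c?x.P\mid \mathbf 0_{\tilde e}\mid t:c!e.P\mid \mathrm{if}\ e\ \mathrm{then}\ P\ \mathrm{else}\ P\mid P+P\mid P\parallel P\mid P\setminus c$ ($\mathcal E$ trace-preserving); expressions $e::=x\mid b\mid n\mid q\mid\neg e\mid e\lor e\mid e\le e\mid e=e$, evaluated by $e\Downarrow v$.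 Typing: $\Sigma\vdash\mathbf 0_{\tilde e}$ if $\tilde e$ enumerates $\Sigma$; prefixes $\tau$, classical send/receive, superoperator and measurement on $\tilde e$ (enumerating a subset of $\Sigma$ of the right size), restriction keep $\Sigma$; sum and if-then-else need both branches typed by $\Sigma$; quantum receive $\Sigma\vdash t:c?x.P$ if $\Sigma\cup\{x\}\vdash P$; quantum send $\Sigma\vdash t:c!e.P$ if $e\in\Sigma$, $\Sigma\setminus\{e\}\vdash P$; $\Sigma_1\cup\Sigma_2\vdash P_1\parallel P_2$ if $\Sigma_1\cap\Sigma_2=\emptyset$, $\Sigma_i\vdash P_i$. Unique typing $\Sigma_P$. Configurations $\langle\rho,P\rangle$ ($\rho$ density operator on $\mathcal H_{\Sigma_\rho}$, $P$ closed), typed $(\Sigma_\rho,\Sigma_P)$ when $\Sigma_P\subseteq\Sigma_\rho$; $\mathit{Conf}_\bot=\mathit{Conf}\cup\{\bot\}$, $\bot$ typed by every pair; distributions typed if all support elements are. Only well-typed distributions are considered. Mass $|\Delta|=1-\Delta(\bot)$. Semantics: schedulers $s::=h\mid t\mid(t,t')$; actions $\tau,c!v,c?v$; transitions $\langle\rho,P\rangle\xrightarrow{\mu}_s\Delta$: least relation with $\langle\rho,t:\tau.P\rangle\xrightarrow{\tau}_t\overline{\langle\rho,P\rangle}$; $\langle\rho,(t,t'):\tau.P\rangle\xrightarrow{\tau}_{(t,t')}\overline{\langle\rho,P\rangle}$; $\langle\rho,t:c!e.P\rangle\xrightarrow{c!v}_t\overline{\langle\rho,P\rangle}$ if $e\Downarrow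 v$; $\langle\rho,t:c?x.P\rangle\xrightarrow{c?v}_t\overline{\langle\rho,P[v/x]\rangle}$ ($v\in\Sigma_\rho$ if quantum); $\langle\rho,t:\mathcal E(\tilde q).P\rangle\xrightarrow{\tau}_t\overline{\langle\mathcal E^{\tilde q}(\rho),P\rangle}$; $\langle\rho,t:\mathbb M(\tilde q\rhd y).P\rangle\xrightarrow{\tau}_t\sum_mp_m\bullet\overline{\langle\mathcal M^{\tilde q}_m(\rho)/p_m,P[m/y]\rangle}$, $p_m=\mathrm{tr}(\mathcal M^{\tilde q}_m(\rho))$; if-then-else follows the branch selected by $e$; $P+Q$ has the transitions of both; restriction passes actions other than $c!v,c?v$; $\langle\rho,P\parallel Q\rangle\xrightarrow{\mu}_s\Delta\parallel Q$ if $\langle\rho,P\rangle\xrightarrow{\mu}_s\Delta$ and $\mu$ is not $c?v$ with $v\in\Sigma_Q$ (and symmetrically); if $\langle\rho,P\rangle\xrightarrow{c!v}_t\overline{\langle\rho,P'\rangle}$, $\langle\rho,Q\rangle\xrightarrow{c?v}_{t'}\overline{\langle\rho,Q'\rangle}$ then $\langle\rho,P\parallel Q\rangle\xrightarrow{\tau}_{(t,t')}\overline{\langle\rho,P'\parallel Q'\rangle}$ and $\langle\rho,Q\parallel P\rangle\xrightarrow{\tau}_{(t,t')}\overline{\langle\rho,Q'\parallel P'\rangle}$. Lifting: on $\mathit{Conf}_\bot$, $\mathcal C\xrightarrow{\mu}_s\overline\bot$ is added whenever $\mathcal C$ (including $\bot$) has no $\xrightarrow{\mu}_s$ transition. For $\delta=\sum_jr_j\bullet\overline{s_j}$,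 $\mathcal C\xrightarrow{\mu}_\delta\sum_jr_j\bullet\Theta_j$ whenever $\mathcal C\xrightarrow{\mu}_{s_j}\Theta_j$ for all $j$; for $\Delta=\sum_ip_i\bullet\overline{\mathcal C_i}$, $\Delta\xrightarrow{\mu}_\delta\sum_ip_i\bullet\Delta_i$ whenever $\mathcal C_i\xrightarrow{\mu}_\delta\Delta_i$ for all $i$. Standing assumption: deterministic tagging, i.e. $\Delta\xrightarrow{\mu}_\delta\Delta'$ and $\Delta\xrightarrow{\mu}_\delta\Delta''$ imply $\Delta'=\Delta''$. Contexts: $B[\cdot]_\Sigma=[\cdot]_\Sigma\parallel Q$, typed $\Sigma'\vdash B[\cdot]_\Sigma$ if $\Sigma\subseteq\Sigma'$ and $\Sigma'\setminus\Sigma\vdash Q$; $B[\langle\rho,P\rangle]=\langle\rho,P\parallel Q\rangle$, defined when $\Sigma_P=\Sigma$ and $\Sigma'\subseteq\Sigma_\rho$; $B[\bot]=\bot$; extended pointwise. Saturated bisimilarity $\sim_s$: largest relation $\mathcal R$ on $\mathcal D(\mathit{Conf}_\bot)$ such that $\Delta\mathcal R\Theta$ implies: both typed by the same $(\Sigma,\Sigma')$; $|\Delta|=|\Theta|$; for every context $B[\cdot]_{\Sigma'}$ and distribution of schedulers $\delta$, if $B[\Delta]\xrightarrow{\tau}_\delta\Delta'$ then $B[\Theta]\xrightarrow{\tau}_\delta\Theta'$ with $\Delta'\mathcal R\Theta'$, and symmetrically. Labelled bisimilarity. $qs(\Delta)=\sum_{\langle\rho,P\rangle\in\mathrm{supp}(\Delta)}\Delta(\langle\rho,P\rangle)\rho$.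 For a trace non-increasing superoperator $\mathcal E$ and $\Delta=\sum_ip_i\bullet\overline{\langle\rho_i,P_i\rangle}\in\mathcal D(\mathit{Conf})$, $\dot{\mathcal E}(\Delta)=\sum_i\frac{p_i\mathrm{tr}(\mathcal E(\rho_i))}{p_{\mathcal E}}\bullet\overline{\langle\mathcal E(\rho_i)/\mathrm{tr}(\mathcal E(\rho_i)),P_i\rangle}$ with $p_{\mathcal E}=\sum_ip_i\mathrm{tr}(\mathcal E(\rho_i))$, and $\dot{\mathcal E}(\Delta\oplus_p\overline\bot)=\dot{\mathcal E}(\Delta)\oplus_p\overline\bot$ when $|\Delta|=1$; if $\mathcal E$ acts on a subtuple $\tilde q$ of the qubits, $\mathcal E^{\tilde q}$ is meant. A relation $\mathcal R$ is a labelled bisimulation if $\Delta\mathcal R\Theta$ implies: $(\Sigma,\Sigma')\vdash\Delta,\Theta$ for some $\Sigma,\Sigma'$; $\mathrm{tr}_{\Sigma'}(qs(\Delta))=\mathrm{tr}_{\Sigma'}(qs(\Theta))$; $\dot{\mathcal E}(\Delta)\mathcal R\dot{\mathcal E}(\Theta)$ for every trace non-increasing superoperator $\mathcal E$ on $\mathcal H_{\Sigma\setminus\Sigma'}$; for every action $\mu$ and distribution of schedulers $\delta$, if $\Delta\xrightarrow{\mu}_\delta\Delta'$ then $\Theta\xrightarrow{\mu}_\delta\Theta'$ with $\Delta'\mathcal R\Theta'$, and symmetrically. $\sim_l$ is the largest labelled bisimulation.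
   Formalization: Deterministic tagging is required of all derivatives, for all quantum states, and of distributions in contexts; moreover no configuration may have two different outputs under one scheduler, since otherwise the inclusion fails. *)

theory Defs
  imports "HOL-Probability.Probability"
begin

section \<open>Linear operators on registers of named qubits\<close>

text \<open>
  The Hilbert space of a finite set \<open>S\<close> of qubit names has one computational basis vector
  for each subset \<open>A \<subseteq> S\<close>, namely the one in which exactly the qubits of \<open>A\<close> are in state 1.
  This is the tensor product of \<open>card S\<close> copies of \<open>\<complex>\<^sup>2\<close> with named factors. An operator is its
  matrix in that basis, extended by 0 outside \<open>Pow S \<times> Pow S\<close>. The space of \<open>n\<close> anonymous qubits,
  on which the operations that occur in processes are given, is that of \<open>S = {..<n}\<close>.
\<close>

type_synonym qubit = nat
type_synonym operator = "nat set \<Rightarrow> nat set \<Rightarrow> complex"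

definition operator_on :: "nat set \<Rightarrow> operator \<Rightarrow> bool" where
  "operator_on S X \<longleftrightarrow> (\<forall>A B. X A B \<noteq> 0 \<longrightarrow> A \<subseteq> S \<and> B \<subseteq> S)"

definition op_id :: "nat set \<Rightarrow> operator" where
  "op_id S = (\<lambda>A B. if A = B \<and> A \<subseteq> S then 1 else 0)"

definition op_mult :: "nat set \<Rightarrow> operator \<Rightarrow> operator \<Rightarrow> operator" where
  "op_mult S X Y = (\<lambda>A C. \<Sum>B\<in>Pow S. X A B * Y B C)"

definition op_adj :: "operator \<Rightarrow> operator" where
  "op_adj X = (\<lambda>A B. cnj (X B A))"

definition op_trace :: "nat set \<Rightarrow> operator \<Rightarrow> complex" where
  "op_trace S X = (\<Sum>A\<in>Pow S. X A A)"

definition op_pos :: "nat set \<Rightarrow> operator \<Rightarrow> bool" where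
  "op_pos S X \<longleftrightarrow> operator_on S X \<and>
     (\<forall>v. (\<Sum>A\<in>Pow S. \<Sum>B\<in>Pow S. cnj (v A) * X A B * v B) \<in> \<real>\<^sub>\<ge>\<^sub>0)"

definition loewner_le :: "nat set \<Rightarrow> operator \<Rightarrow> operator \<Rightarrow> bool" where
  "loewner_le S X Y \<longleftrightarrow> op_pos S (\<lambda>A B. Y A B - X A B)"

definition density_operator :: "nat set \<Rightarrow> operator \<Rightarrow> bool" where
  "density_operator S \<rho> \<longleftrightarrow> finite S \<and> op_pos S \<rho> \<and> op_trace S \<rho> = 1"

definition partial_trace :: "nat set \<Rightarrow> operator \<Rightarrow> operator" where
  "partial_trace T X = (\<lambda>A B. if A \<inter> T = {} \<and> B \<inter> T = {}
     then \<Sum>C\<in>Pow T. X (A \<union> C) (B \<union> C) else 0)"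


subsection \<open>Superoperators and measurements\<close>

type_synonym superop = "operator \<Rightarrow> operator"

definition conjugation :: "nat set \<Rightarrow> operator \<Rightarrow> superop" where
  "conjugation S K \<rho> = op_mult S (op_mult S K \<rho>) (op_adj K)"

definition kraus :: "nat set \<Rightarrow> operator list \<Rightarrow> superop" where
  "kraus S Ks \<rho> = (\<lambda>A B. \<Sum>K\<leftarrow>Ks. conjugation S K \<rho> A B)"

definition kraus_gram :: "nat set \<Rightarrow> operator list \<Rightarrow> operator" where
  "kraus_gram S Ks = (\<lambda>A B. \<Sum>K\<leftarrow>Ks. op_mult S (op_adj K) K A B)"

definition trace_nonincreasing :: "nat set \<Rightarrow> superop \<Rightarrow> bool" where
  "trace_nonincreasing S E \<longleftrightarrow>
     (\<exists>Ks. (\<forall>K\<in>set Ks. operator_on S K) \<and> loewner_le S (kraus_gram S Ks) (op_id S) \<and> E = kraus S Ks)"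

definition trace_preserving :: "nat set \<Rightarrow> superop \<Rightarrow> bool" where
  "trace_preserving S E \<longleftrightarrow>
     (\<exists>Ks. (\<forall>K\<in>set Ks. operator_on S K) \<and> kraus_gram S Ks = op_id S \<and> E = kraus S Ks)"

type_synonym measurement = "nat \<rightharpoonup> operator"

definition is_measurement :: "nat set \<Rightarrow> measurement \<Rightarrow> bool" where
  "is_measurement S M \<longleftrightarrow> finite (dom M) \<and> (\<forall>m\<in>dom M. operator_on S (the (M m))) \<and>
     (\<lambda>A B. \<Sum>m\<in>dom M. op_mult S (op_adj (the (M m))) (the (M m)) A B) = op_id S"

text \<open>
  Let \<open>E\<close> be a superoperator on the register \<open>J\<close> and \<open>f\<close> an injection of \<open>J\<close> into \<open>S\<close>. The following
  is \<open>E\<close> acting on the qubits \<open>f ` J\<close> of \<open>S\<close>, with the identity on the other ones: for fixed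
  components of the two indices outside \<open>f ` J\<close>, it applies \<open>E\<close> to the remaining block of \<open>\<rho>\<close>.
\<close>

definition superop_on :: "qubit set \<Rightarrow> nat set \<Rightarrow> (nat \<Rightarrow> qubit) \<Rightarrow> superop \<Rightarrow> superop" where
  "superop_on S J f E \<rho> = (\<lambda>A B. if A \<subseteq> S \<and> B \<subseteq> S
     then E (\<lambda>a b. \<rho> (f ` a \<union> (A - f ` J)) (f ` b \<union> (B - f ` J))) {j\<in>J. f j \<in> A} {j\<in>J. f j \<in> B}
     else 0)"

definition superop_tuple :: "qubit set \<Rightarrow> qubit list \<Rightarrow> superop \<Rightarrow> superop" where
  "superop_tuple S qs E = superop_on S {..<length qs} (\<lambda>i. qs ! i) E"

definition superop_sub :: "qubit set \<Rightarrow> qubit set \<Rightarrow> superop \<Rightarrow> superop" where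
  "superop_sub S T E = superop_on S T (\<lambda>q. q) E"

definition prob_of :: "qubit set \<Rightarrow> operator \<Rightarrow> real" where
  "prob_of S X = Re (op_trace S X)"

definition normalised :: "qubit set \<Rightarrow> operator \<Rightarrow> operator" where
  "normalised S X = (\<lambda>A B. X A B / of_real (prob_of S X))"


section \<open>Syntax\<close>

datatype ty = TNat | TBool | TQubit

text \<open>Channels and variables carry the type of the values they communicate and range over.\<close>

datatype chan = Chan (chan_ty: ty) nat
datatype var = Var (var_ty: ty) nat
datatype val = NatV nat | BoolV bool | QubitV qubit

datatype exp =
    EVar var
  | EVal val
  | ENot exp
  | EOr exp exp
  | ELe exp exp
  | EEq exp exp

type_synonym tag = nat

datatype proc =
    Tau tag proc
  | TauPair tag tag proc
  | Apply tag superop "exp list" proc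
  | Measure tag measurement "exp list" var proc
  | Recv tag chan var proc
  | Discard "exp list"
  | Send tag chan exp proc
  | Cond exp proc proc
  | Choice proc proc
  | Par proc proc
  | Restrict proc chan

fun val_ty :: "val \<Rightarrow> ty" where
  "val_ty (NatV n) = TNat"
| "val_ty (BoolV b) = TBool"
| "val_ty (QubitV q) = TQubit"

inductive exp_typed :: "exp \<Rightarrow> ty \<Rightarrow> bool" where
  "exp_typed (EVar x) (var_ty x)"
| "exp_typed (EVal v) (val_ty v)"
| "exp_typed e TBool \<Longrightarrow> exp_typed (ENot e) TBool"
| "exp_typed e TBool \<Longrightarrow> exp_typed e' TBool \<Longrightarrow> exp_typed (EOr e e') TBool"
| "exp_typed e TNat \<Longrightarrow> exp_typed e' TNat \<Longrightarrow> exp_typed (ELe e e') TBool"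
| "exp_typed e T \<Longrightarrow> exp_typed e' T \<Longrightarrow> exp_typed (EEq e e') TBool"

inductive evaluates :: "exp \<Rightarrow> val \<Rightarrow> bool" where
  "evaluates (EVal v) v"
| "evaluates e (BoolV b) \<Longrightarrow> evaluates (ENot e) (BoolV (\<not> b))"
| "evaluates e (BoolV b) \<Longrightarrow> evaluates e' (BoolV b') \<Longrightarrow> evaluates (EOr e e') (BoolV (b \<or> b'))"
| "evaluates e (NatV n) \<Longrightarrow> evaluates e' (NatV n') \<Longrightarrow> evaluates (ELe e e') (BoolV (n \<le> n'))"
| "evaluates e v \<Longrightarrow> evaluates e' v' \<Longrightarrow> evaluates (EEq e e') (BoolV (v = v'))"

fun exp_fv :: "exp \<Rightarrow> var set" where
  "exp_fv (EVar x) = {x}"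
| "exp_fv (EVal v) = {}"
| "exp_fv (ENot e) = exp_fv e"
| "exp_fv (EOr e e') = exp_fv e \<union> exp_fv e'"
| "exp_fv (ELe e e') = exp_fv e \<union> exp_fv e'"
| "exp_fv (EEq e e') = exp_fv e \<union> exp_fv e'"

fun fv :: "proc \<Rightarrow> var set" where
  "fv (Tau t P) = fv P"
| "fv (TauPair t t' P) = fv P"
| "fv (Apply t E es P) = (\<Union>e\<in>set es. exp_fv e) \<union> fv P"
| "fv (Measure t M es x P) = (\<Union>e\<in>set es. exp_fv e) \<union> (fv P - {x})"
| "fv (Recv t c x P) = fv P - {x}"
| "fv (Discard es) = (\<Union>e\<in>set es. exp_fv e)"
| "fv (Send t c e P) = exp_fv e \<union> fv P"
| "fv (Cond e P Q) = exp_fv e \<union> fv P \<union> fv Q"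
| "fv (Choice P Q) = fv P \<union> fv Q"
| "fv (Par P Q) = fv P \<union> fv Q"
| "fv (Restrict P c) = fv P"

definition closed_proc :: "proc \<Rightarrow> bool" where
  "closed_proc P \<longleftrightarrow> fv P = {}"

fun exp_subst :: "var \<Rightarrow> val \<Rightarrow> exp \<Rightarrow> exp" where
  "exp_subst x v (EVar y) = (if x = y then EVal v else EVar y)"
| "exp_subst x v (EVal w) = EVal w"
| "exp_subst x v (ENot e) = ENot (exp_subst x v e)"
| "exp_subst x v (EOr e e') = EOr (exp_subst x v e) (exp_subst x v e')"
| "exp_subst x v (ELe e e') = ELe (exp_subst x v e) (exp_subst x v e')"
| "exp_subst x v (EEq e e') = EEq (exp_subst x v e) (exp_subst x v e')"

text \<open>\<open>subst x v P\<close> is \<open>P[v/x]\<close>; values contain no variables, so no capture can occur.\<close>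

fun subst :: "var \<Rightarrow> val \<Rightarrow> proc \<Rightarrow> proc" where
  "subst x v (Tau t P) = Tau t (subst x v P)"
| "subst x v (TauPair t t' P) = TauPair t t' (subst x v P)"
| "subst x v (Apply t E es P) = Apply t E (map (exp_subst x v) es) (subst x v P)"
| "subst x v (Measure t M es y P) =
     Measure t M (map (exp_subst x v) es) y (if x = y then P else subst x v P)"
| "subst x v (Recv t c y P) = Recv t c y (if x = y then P else subst x v P)"
| "subst x v (Discard es) = Discard (map (exp_subst x v) es)"
| "subst x v (Send t c e P) = Send t c (exp_subst x v e) (subst x v P)"
| "subst x v (Cond e P Q) = Cond (exp_subst x v e) (subst x v P) (subst x v Q)"
| "subst x v (Choice P Q) = Choice (subst x v P) (subst x v Q)"
| "subst x v (Par P Q) = Par (subst x v P) (subst x v Q)"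
| "subst x v (Restrict P c) = Restrict (subst x v P) c"


section \<open>Typing\<close>

text \<open>
  Typing contexts are sets of qubit names and quantum variables, written as expressions. The premise
  \<open>EVar x \<notin> \<Sigma>\<close> for quantum reception is the usual convention on bound variables; types would not be
  unique without it. The typing of \<open>Apply\<close> and \<open>Measure\<close> also checks that the operation is a
  trace-preserving superoperator or a measurement on as many qubits as are given.
\<close>

inductive proc_typed :: "exp set \<Rightarrow> proc \<Rightarrow> bool" where
  typed_discard: "distinct es \<Longrightarrow> (\<forall>e\<in>set es. exp_typed e TQubit) \<Longrightarrow> proc_typed (set es) (Discard es)"
| typed_tau: "proc_typed \<Sigma> P \<Longrightarrow> proc_typed \<Sigma> (Tau t P)"
| typed_tau_pair: "proc_typed \<Sigma> P \<Longrightarrow> proc_typed \<Sigma> (TauPair t t' P)"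
| typed_apply: "distinct es \<Longrightarrow> set es \<subseteq> \<Sigma> \<Longrightarrow> trace_preserving {..<length es} E \<Longrightarrow>
    proc_typed \<Sigma> P \<Longrightarrow> proc_typed \<Sigma> (Apply t E es P)"
| typed_measure: "distinct es \<Longrightarrow> set es \<subseteq> \<Sigma> \<Longrightarrow> is_measurement {..<length es} M \<Longrightarrow>
    var_ty x = TNat \<Longrightarrow> proc_typed \<Sigma> P \<Longrightarrow> proc_typed \<Sigma> (Measure t M es x P)"
| typed_recv: "chan_ty c \<noteq> TQubit \<Longrightarrow> var_ty x = chan_ty c \<Longrightarrow>
    proc_typed \<Sigma> P \<Longrightarrow> proc_typed \<Sigma> (Recv t c x P)"
| typed_qrecv: "chan_ty c = TQubit \<Longrightarrow> var_ty x = TQubit \<Longrightarrow> EVar x \<notin> \<Sigma> \<Longrightarrow>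
    proc_typed (\<Sigma> \<union> {EVar x}) P \<Longrightarrow> proc_typed \<Sigma> (Recv t c x P)"
| typed_send: "chan_ty c \<noteq> TQubit \<Longrightarrow> exp_typed e (chan_ty c) \<Longrightarrow>
    proc_typed \<Sigma> P \<Longrightarrow> proc_typed \<Sigma> (Send t c e P)"
| typed_qsend: "chan_ty c = TQubit \<Longrightarrow> exp_typed e TQubit \<Longrightarrow> e \<in> \<Sigma> \<Longrightarrow>
    proc_typed (\<Sigma> - {e}) P \<Longrightarrow> proc_typed \<Sigma> (Send t c e P)"
| typed_cond: "exp_typed e TBool \<Longrightarrow> proc_typed \<Sigma> P \<Longrightarrow> proc_typed \<Sigma> Q \<Longrightarrow> proc_typed \<Sigma> (Cond e P Q)"
| typed_choice: "proc_typed \<Sigma> P \<Longrightarrow> proc_typed \<Sigma> Q \<Longrightarrow> proc_typed \<Sigma> (Choice P Q)"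
| typed_par: "\<Sigma>1 \<inter> \<Sigma>2 = {} \<Longrightarrow> proc_typed \<Sigma>1 P \<Longrightarrow> proc_typed \<Sigma>2 Q \<Longrightarrow> proc_typed (\<Sigma>1 \<union> \<Sigma>2) (Par P Q)"
| typed_restrict: "proc_typed \<Sigma> P \<Longrightarrow> proc_typed \<Sigma> (Restrict P c)"

definition qexp :: "qubit \<Rightarrow> exp" where
  "qexp q = EVal (QubitV q)"

text \<open>The type of a closed process, as a set of qubit names.\<close>

definition has_qubits :: "qubit set \<Rightarrow> proc \<Rightarrow> bool" where
  "has_qubits \<Sigma> P \<longleftrightarrow> proc_typed (qexp ` \<Sigma>) P"


section \<open>Configurations and distributions\<close>

text \<open>
  A configuration \<open>(S, \<rho>, P)\<close> consists of an operator \<open>\<rho>\<close> on the register \<open>S\<close>, and a process \<open>P\<close>.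
  \<open>None\<close> stands for the additional configuration \<open>\<bottom>\<close>.
\<close>

type_synonym conf = "qubit set \<times> operator \<times> proc"
type_synonym dist = "conf option pmf"

fun conf_typed :: "qubit set \<Rightarrow> qubit set \<Rightarrow> conf \<Rightarrow> bool" where
  "conf_typed \<Sigma> \<Sigma>' (S, \<rho>, P) \<longleftrightarrow>
     S = \<Sigma> \<and> density_operator S \<rho> \<and> closed_proc P \<and> has_qubits \<Sigma>' P \<and> \<Sigma>' \<subseteq> \<Sigma>"

definition dist_typed :: "qubit set \<Rightarrow> qubit set \<Rightarrow> dist \<Rightarrow> bool" where
  "dist_typed \<Sigma> \<Sigma>' \<Delta> \<longleftrightarrow>
     finite (set_pmf \<Delta>) \<and> (\<forall>C. Some C \<in> set_pmf \<Delta> \<longrightarrow> conf_typed \<Sigma> \<Sigma>' C)"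

definition well_typed :: "dist \<Rightarrow> bool" where
  "well_typed \<Delta> \<longleftrightarrow> (\<exists>\<Sigma> \<Sigma>'. dist_typed \<Sigma> \<Sigma>' \<Delta>)"

definition mass :: "dist \<Rightarrow> real" where
  "mass \<Delta> = 1 - pmf \<Delta> None"

definition mix :: "real \<Rightarrow> 'a pmf \<Rightarrow> 'a pmf \<Rightarrow> 'a pmf" where
  "mix p \<Delta>1 \<Delta>2 = bind_pmf (bernoulli_pmf p) (\<lambda>b. if b then \<Delta>1 else \<Delta>2)"


section \<open>Semantics\<close>

datatype sched = Halt | Tag tag | TagPair tag tag
datatype act = Silent | Output chan val | Input chan val

fun on_chan :: "chan \<Rightarrow> act \<Rightarrow> bool" where
  "on_chan c Silent \<longleftrightarrow> False"
| "on_chan c (Output d v) \<longleftrightarrow> d = c"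
| "on_chan c (Input d v) \<longleftrightarrow> d = c"

definition map_proc :: "(proc \<Rightarrow> proc) \<Rightarrow> conf \<Rightarrow> conf" where
  "map_proc f = (\<lambda>(S, \<rho>, P). (S, \<rho>, f P))"

definition outcome_state :: "qubit set \<Rightarrow> qubit list \<Rightarrow> measurement \<Rightarrow> nat \<Rightarrow> operator \<Rightarrow> operator" where
  "outcome_state S qs M m \<rho> = (case M m of
       None \<Rightarrow> (\<lambda>A B. 0)
     | Some K \<Rightarrow> superop_tuple S qs (conjugation {..<length qs} K) \<rho>)"

definition outcomes :: "qubit set \<Rightarrow> qubit list \<Rightarrow> measurement \<Rightarrow> operator \<Rightarrow> nat pmf" where
  "outcomes S qs M \<rho> = embed_pmf (\<lambda>m. prob_of S (outcome_state S qs M m \<rho>))"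

text \<open>\<open>takes_from Q \<mu>\<close>: \<open>\<mu>\<close> is the reception of a qubit in the type \<open>\<Sigma>\<^sub>Q\<close> of \<open>Q\<close>.\<close>

definition takes_from :: "proc \<Rightarrow> act \<Rightarrow> bool" where
  "takes_from Q \<mu> \<longleftrightarrow> (\<exists>c q \<Sigma>. \<mu> = Input c (QubitV q) \<and> has_qubits \<Sigma> Q \<and> q \<in> \<Sigma>)"

inductive step :: "conf \<Rightarrow> act \<Rightarrow> sched \<Rightarrow> conf pmf \<Rightarrow> bool" where
  step_tau: "step (S, \<rho>, Tau t P) Silent (Tag t) (return_pmf (S, \<rho>, P))"
| step_tau_pair: "step (S, \<rho>, TauPair t t' P) Silent (TagPair t t') (return_pmf (S, \<rho>, P))"
| step_send: "evaluates e v \<Longrightarrow>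
    step (S, \<rho>, Send t c e P) (Output c v) (Tag t) (return_pmf (S, \<rho>, P))"
| step_recv: "val_ty v = chan_ty c \<Longrightarrow> (\<forall>q. v = QubitV q \<longrightarrow> q \<in> S) \<Longrightarrow>
    step (S, \<rho>, Recv t c x P) (Input c v) (Tag t) (return_pmf (S, \<rho>, subst x v P))"
| step_apply:
    "step (S, \<rho>, Apply t E (map qexp qs) P) Silent (Tag t) (return_pmf (S, superop_tuple S qs E \<rho>, P))"
| step_measure:
    "step (S, \<rho>, Measure t M (map qexp qs) y P) Silent (Tag t)
       (map_pmf (\<lambda>m. (S, normalised S (outcome_state S qs M m \<rho>), subst y (NatV m) P))
         (outcomes S qs M \<rho>))"
| step_cond_true: "evaluates e (BoolV True) \<Longrightarrow> step (S, \<rho>, P) \<mu> s \<Delta> \<Longrightarrow> step (S, \<rho>, Cond e P Q) \<mu> s \<Delta>"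
| step_cond_false: "evaluates e (BoolV False) \<Longrightarrow> step (S, \<rho>, Q) \<mu> s \<Delta> \<Longrightarrow> step (S, \<rho>, Cond e P Q) \<mu> s \<Delta>"
| step_choice_left: "step (S, \<rho>, P) \<mu> s \<Delta> \<Longrightarrow> step (S, \<rho>, Choice P Q) \<mu> s \<Delta>"
| step_choice_right: "step (S, \<rho>, Q) \<mu> s \<Delta> \<Longrightarrow> step (S, \<rho>, Choice P Q) \<mu> s \<Delta>"
| step_restrict: "step (S, \<rho>, P) \<mu> s \<Delta> \<Longrightarrow> \<not> on_chan c \<mu> \<Longrightarrow>
    step (S, \<rho>, Restrict P c) \<mu> s (map_pmf (map_proc (\<lambda>P'. Restrict P' c)) \<Delta>)"
| step_par_left: "step (S, \<rho>, P) \<mu> s \<Delta> \<Longrightarrow> \<not> takes_from Q \<mu> \<Longrightarrow>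
    step (S, \<rho>, Par P Q) \<mu> s (map_pmf (map_proc (\<lambda>P'. Par P' Q)) \<Delta>)"
| step_par_right: "step (S, \<rho>, Q) \<mu> s \<Delta> \<Longrightarrow> \<not> takes_from P \<mu> \<Longrightarrow>
    step (S, \<rho>, Par P Q) \<mu> s (map_pmf (map_proc (\<lambda>Q'. Par P Q')) \<Delta>)"
| step_sync_left:
    "step (S, \<rho>, P) (Output c v) (Tag t) (return_pmf (S, \<rho>, P')) \<Longrightarrow>
     step (S, \<rho>, Q) (Input c v) (Tag t') (return_pmf (S, \<rho>, Q')) \<Longrightarrow>
     step (S, \<rho>, Par P Q) Silent (TagPair t t') (return_pmf (S, \<rho>, Par P' Q'))"
| step_sync_right:
    "step (S, \<rho>, P) (Output c v) (Tag t) (return_pmf (S, \<rho>, P')) \<Longrightarrow>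
     step (S, \<rho>, Q) (Input c v) (Tag t') (return_pmf (S, \<rho>, Q')) \<Longrightarrow>
     step (S, \<rho>, Par Q P) Silent (TagPair t t') (return_pmf (S, \<rho>, Par Q' P'))"

text \<open>
  Only well-typed configurations and distributions are considered. For the target of a transition this
  matters in one case: a process that already owns the qubit \<open>q\<close> cannot receive \<open>q\<close> again.
\<close>

definition typed_step :: "conf \<Rightarrow> act \<Rightarrow> sched \<Rightarrow> conf pmf \<Rightarrow> bool" where
  "typed_step C \<mu> s \<Delta> \<longleftrightarrow>
     step C \<mu> s \<Delta> \<and> well_typed (return_pmf (Some C)) \<and> well_typed (map_pmf Some \<Delta>)"

inductive total_step :: "conf option \<Rightarrow> act \<Rightarrow> sched \<Rightarrow> dist \<Rightarrow> bool" where
  total_step_move: "typed_step C \<mu> s \<Delta> \<Longrightarrow> total_step (Some C) \<mu> s (map_pmf Some \<Delta>)"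
| total_step_stuck: "(\<nexists>C' \<Delta>. C = Some C' \<and> typed_step C' \<mu> s \<Delta>) \<Longrightarrow> total_step C \<mu> s (return_pmf None)"

text \<open>
  \<open>lift_dist R \<Delta> \<Theta>\<close>: for some convex combinations, \<open>\<Delta> = \<Sum>i. p\<^sub>i \<bullet> x\<^sub>i\<close> and \<open>\<Theta> = \<Sum>i. p\<^sub>i \<bullet> \<Theta>\<^sub>i\<close> with
  \<open>R x\<^sub>i \<Theta>\<^sub>i\<close> for all \<open>i\<close>. The same point \<open>x\<^sub>i\<close> may occur for several indices; the weights are \<open>w\<close>.
\<close>

definition lift_dist :: "('a \<Rightarrow> 'b pmf \<Rightarrow> bool) \<Rightarrow> 'a pmf \<Rightarrow> 'b pmf \<Rightarrow> bool" where
  "lift_dist R \<Delta> \<Theta> \<longleftrightarrow> (\<exists>(w :: nat pmf) x F. finite (set_pmf w) \<and>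
     \<Delta> = map_pmf x w \<and> (\<forall>i\<in>set_pmf w. R (x i) (F i)) \<and> \<Theta> = bind_pmf w F)"

definition conf_trans :: "conf option \<Rightarrow> act \<Rightarrow> sched pmf \<Rightarrow> dist \<Rightarrow> bool" where
  "conf_trans C \<mu> = lift_dist (total_step C \<mu>)"

definition dist_trans :: "dist \<Rightarrow> act \<Rightarrow> sched pmf \<Rightarrow> dist \<Rightarrow> bool" where
  "dist_trans \<Delta> \<mu> \<delta> \<Delta>' \<longleftrightarrow> lift_dist (\<lambda>C. conf_trans C \<mu> \<delta>) \<Delta> \<Delta>'"


section \<open>Deterministic tagging\<close>

definition deterministic :: "dist \<Rightarrow> bool" where
  "deterministic \<Delta> \<longleftrightarrow> (\<forall>\<mu> \<delta> \<Delta>' \<Delta>''. dist_trans \<Delta> \<mu> \<delta> \<Delta>' \<longrightarrow> dist_trans \<Delta> \<mu> \<delta> \<Delta>'' \<longrightarrow> \<Delta>' = \<Delta>'')"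

text \<open>
  The same assumption for distributions placed in contexts. Next to a receiver \<open>Recv t' c x Q\<close>, all
  outputs on \<open>c\<close> with tag \<open>t\<close> become silent transitions for the one scheduler \<open>TagPair t t'\<close>,
  so distinct outputs with the same tag make some contexts non-deterministic. They are excluded.
\<close>

definition output_deterministic :: "dist \<Rightarrow> bool" where
  "output_deterministic \<Delta> \<longleftrightarrow> (\<forall>C s c v c' v' D D'. Some C \<in> set_pmf \<Delta> \<longrightarrow>
     typed_step C (Output c v) s D \<longrightarrow> typed_step C (Output c' v') s D' \<longrightarrow> c = c' \<and> v = v')"

definition procs :: "dist \<Rightarrow> proc set" where
  "procs \<Delta> = {P. \<exists>S \<rho>. Some (S, \<rho>, P) \<in> set_pmf \<Delta>}"

definition proc_next :: "proc \<Rightarrow> proc \<Rightarrow> bool" where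
  "proc_next P P' \<longleftrightarrow> (\<exists>S \<rho> \<mu> s D S' \<rho>'.
     typed_step (S, \<rho>, P) \<mu> s D \<and> (S', \<rho>', P') \<in> set_pmf D)"

text \<open>
  Determinism is a property of the tags in the processes: it is required after any number of steps,
  and for all quantum states.
\<close>

definition deterministically_tagged :: "dist \<Rightarrow> bool" where
  "deterministically_tagged \<Delta> \<longleftrightarrow>
     (\<forall>\<Theta>. well_typed \<Theta> \<and> (\<forall>P'\<in>procs \<Theta>. \<exists>P\<in>procs \<Delta>. proc_next\<^sup>*\<^sup>* P P') \<longrightarrow>
       deterministic \<Theta> \<and> output_deterministic \<Theta>)"


section \<open>Saturated bisimilarity\<close>

text \<open>The context \<open>[\<cdot>] \<parallel> Q\<close> is given by \<open>Q\<close>; \<open>context_typed \<Sigma>' Q \<Sigma>\<close> is \<open>\<Sigma>' \<turnstile> ([\<cdot>] \<parallel> Q)\<close> for a hole of type \<open>\<Sigma>\<close>.\<close>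

definition context_typed :: "qubit set \<Rightarrow> proc \<Rightarrow> qubit set \<Rightarrow> bool" where
  "context_typed \<Sigma>' Q \<Sigma> \<longleftrightarrow> \<Sigma> \<subseteq> \<Sigma>' \<and> closed_proc Q \<and> has_qubits (\<Sigma>' - \<Sigma>) Q"

definition in_context :: "proc \<Rightarrow> dist \<Rightarrow> dist" where
  "in_context Q = map_pmf (map_option (map_proc (\<lambda>P. Par P Q)))"

definition saturated_bisimulation :: "dist rel \<Rightarrow> bool" where
  "saturated_bisimulation R \<longleftrightarrow> (\<forall>(\<Delta>, \<Theta>)\<in>R.
     deterministically_tagged \<Delta> \<and> deterministically_tagged \<Theta> \<and>
     (\<exists>\<Sigma> \<Sigma>'. dist_typed \<Sigma> \<Sigma>' \<Delta> \<and> dist_typed \<Sigma> \<Sigma>' \<Theta> \<and>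
       mass \<Delta> = mass \<Theta> \<and>
       (\<forall>Q \<Sigma>'' \<delta>. context_typed \<Sigma>'' Q \<Sigma>' \<and> \<Sigma>'' \<subseteq> \<Sigma> \<and>
          deterministically_tagged (in_context Q \<Delta>) \<and> deterministically_tagged (in_context Q \<Theta>) \<longrightarrow>
          (\<forall>\<Delta>'. dist_trans (in_context Q \<Delta>) Silent \<delta> \<Delta>' \<longrightarrow>
             (\<exists>\<Theta>'. dist_trans (in_context Q \<Theta>) Silent \<delta> \<Theta>' \<and> (\<Delta>', \<Theta>') \<in> R)) \<and>
          (\<forall>\<Theta>'. dist_trans (in_context Q \<Theta>) Silent \<delta> \<Theta>' \<longrightarrow>
             (\<exists>\<Delta>'. dist_trans (in_context Q \<Delta>) Silent \<delta> \<Delta>' \<and> (\<Delta>', \<Theta>') \<in> R)))))"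

definition saturated_bisimilarity :: "dist rel" where
  "saturated_bisimilarity = \<Union>{R. saturated_bisimulation R}"


section \<open>Labelled bisimilarity\<close>

definition quantum_state :: "dist \<Rightarrow> operator" where
  "quantum_state \<Delta> = (\<lambda>A B. \<Sum>C\<in>set_pmf \<Delta>. case C of
     None \<Rightarrow> 0 | Some (S, \<rho>, P) \<Rightarrow> of_real (pmf \<Delta> C) * \<rho> A B)"

text \<open>In the following, \<open>E\<close> is a superoperator on the qubits in \<open>T\<close>.\<close>

definition conf_prob :: "qubit set \<Rightarrow> superop \<Rightarrow> conf \<Rightarrow> real" where
  "conf_prob T E = (\<lambda>(S, \<rho>, P). prob_of S (superop_sub S T E \<rho>))"

definition conf_post :: "qubit set \<Rightarrow> superop \<Rightarrow> conf \<Rightarrow> conf" where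
  "conf_post T E = (\<lambda>(S, \<rho>, P). (S, normalised S (superop_sub S T E \<rho>), P))"

definition total_prob :: "qubit set \<Rightarrow> superop \<Rightarrow> conf pmf \<Rightarrow> real" where
  "total_prob T E D = (\<Sum>C\<in>set_pmf D. pmf D C * conf_prob T E C)"

definition apply_proper :: "qubit set \<Rightarrow> superop \<Rightarrow> conf pmf \<Rightarrow> conf pmf" where
  "apply_proper T E D =
     map_pmf (conf_post T E) (embed_pmf (\<lambda>C. pmf D C * conf_prob T E C / total_prob T E D))"

text \<open>The result of applying \<open>E\<close> to a distribution is undefined when its probability is 0.\<close>

inductive apply_dist :: "qubit set \<Rightarrow> superop \<Rightarrow> dist \<Rightarrow> dist \<Rightarrow> bool" where
  "0 \<le> p \<Longrightarrow> p \<le> 1 \<Longrightarrow> well_typed (map_pmf Some D) \<Longrightarrow> total_prob T E D \<noteq> 0 \<Longrightarrow>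
   apply_dist T E (mix p (map_pmf Some D) (return_pmf None))
     (mix p (map_pmf Some (apply_proper T E D)) (return_pmf None))"

definition labelled_bisimulation :: "dist rel \<Rightarrow> bool" where
  "labelled_bisimulation R \<longleftrightarrow> (\<forall>(\<Delta>, \<Theta>)\<in>R.
     deterministically_tagged \<Delta> \<and> deterministically_tagged \<Theta> \<and>
     (\<exists>\<Sigma> \<Sigma>'. dist_typed \<Sigma> \<Sigma>' \<Delta> \<and> dist_typed \<Sigma> \<Sigma>' \<Theta> \<and>
       partial_trace \<Sigma>' (quantum_state \<Delta>) = partial_trace \<Sigma>' (quantum_state \<Theta>) \<and>
       (\<forall>E \<Delta>' \<Theta>'. trace_nonincreasing (\<Sigma> - \<Sigma>') E \<and>
          apply_dist (\<Sigma> - \<Sigma>') E \<Delta> \<Delta>' \<and> apply_dist (\<Sigma> - \<Sigma>') E \<Theta> \<Theta>' \<longrightarrow> (\<Delta>', \<Theta>') \<in> R)) \<and>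
     (\<forall>\<mu> \<delta>.
       (\<forall>\<Delta>'. dist_trans \<Delta> \<mu> \<delta> \<Delta>' \<longrightarrow> (\<exists>\<Theta>'. dist_trans \<Theta> \<mu> \<delta> \<Theta>' \<and> (\<Delta>', \<Theta>') \<in> R)) \<and>
       (\<forall>\<Theta>'. dist_trans \<Theta> \<mu> \<delta> \<Theta>' \<longrightarrow> (\<exists>\<Delta>'. dist_trans \<Delta> \<mu> \<delta> \<Delta>' \<and> (\<Delta>', \<Theta>') \<in> R))))"

definition labelled_bisimilarity :: "dist rel" where
  "labelled_bisimilarity = \<Union>{R. labelled_bisimulation R}"

end

theory Submission
  imports Defs
begin

text \<open>
  Labelled bisimilarity is shown to be preserved by contexts \<open>[\<cdot>] \<parallel> Q\<close>; the silent moves of distributions in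
  contexts are then matched by the transfer property of labelled bisimilarity itself. A distribution
  over \<open>Conf\<^sub>\<bottom>\<close> is viewed as the linear functional taking a test function on proper configurations to
  its expectation. Deterministic tagging makes the transition relation a total function for each
  action and scheduler, which acts linearly on these functionals. The candidate relation contains
  the typed and deterministically tagged pairs whose functionals lie in the span of the pairs
  \<open>(B[\<Delta>], B[\<Theta>])\<close> with \<open>\<Delta> \<sim>\<^sub>l \<Theta>\<close>. When \<open>B\<close> moves alone, it applies Kraus operators to the qubits
  that \<open>\<Delta>\<close> and \<open>\<Theta>\<close> do not own; bisimilarity is closed under them, and the weights of the outcomes agree
  because they only depend on the partial traces. In all other cases the move of \<open>B[\<Delta>]\<close> splits into
  finitely many labelled moves of \<open>\<Delta>\<close> (a move of its own, and synchronisations with \<open>B\<close>).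
  Deterministic tagging ensures that a configuration takes part in at most one of them.
\<close>

section \<open>Operators on registers\<close>

text \<open>A target of a move mixes several contexts: if \<open>Q\<close> measures, each outcome
  leaves its own residual next to a post-measurement distribution, and the scheduler distribution
  mixes further moves. Pairs (B[\<Delta>], B[\<Theta>]) alone are therefore not closed under moves.
  Moreover, one move of B[\<Delta>] need not come from one label of \<Delta>: under the same pair of
  tags one configuration may output 0 and another 1, and \<open>Q\<close> synchronises with both.
  Labelled bisimilarity answers one label at a time and sends the configurations lacking it to
  \<bottom>; since \<bottom> counts 0 in a functional, the moves for the different labels simply add
  up. Forgetting \<bottom> loses nothing, because the mass is the trace of the observed state. The
  case split rests on the fact that whether \<open>Q\<close> can move alone does not depend on the
  quantum state: if it moves next to one configuration, it moves next to all; otherwise every move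
  involves the process in the hole.\<close>

definition op_lift :: "nat set \<Rightarrow> nat set \<Rightarrow> (nat \<Rightarrow> nat) \<Rightarrow> operator \<Rightarrow> operator" where
  "op_lift S J f X = (\<lambda>A B. if A \<subseteq> S \<and> B \<subseteq> S \<and> A - f ` J = B - f ` J
     then X {j\<in>J. f j \<in> A} {j\<in>J. f j \<in> B} else 0)"

text \<open>\<open>op_lift\<close> is \<open>X\<close> on the image of \<open>J\<close> tensored
  with the identity elsewhere; the identity factor is the condition that the two indices agree
  outside the image. Hence row \<open>A\<close> is supported on the \<open>C\<close> that differ
  from \<open>A\<close> only inside the image, and these correspond to the subsets of
  \<open>J\<close>.\<close>

lemma sum_op_lift:
  assumes "finite S" "inj_on f J" "f ` J \<subseteq> S" "A \<subseteq> S"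
  shows "(\<Sum>C\<in>Pow S. op_lift S J f X A C * g C) =
    (\<Sum>c\<in>Pow J. X {j\<in>J. f j \<in> A} c * g (f ` c \<union> (A - f ` J)))"
proof -
  have "(\<Sum>C\<in>Pow S. op_lift S J f X A C * g C) =
    (\<Sum>C\<in>{C. C \<subseteq> S \<and> A - f ` J = C - f ` J}. op_lift S J f X A C * g C)"
    using assms by (intro sum.mono_neutral_right) (auto simp: op_lift_def)
  also have "\<dots> = (\<Sum>c\<in>Pow J. X {j\<in>J. f j \<in> A} c * g (f ` c \<union> (A - f ` J)))"
  proof (rule sum.reindex_bij_witness[where i = "\<lambda>c. f ` c \<union> (A - f ` J)" and j = "\<lambda>C. {j\<in>J. f j \<in> C}"])
    fix C assume C: "C \<in> {C. C \<subseteq> S \<and> A - f ` J = C - f ` J}"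
    show *: "f ` {j \<in> J. f j \<in> C} \<union> (A - f ` J) = C" using C by auto
    show "X {j \<in> J. f j \<in> A} {j \<in> J. f j \<in> C} * g (f ` {j \<in> J. f j \<in> C} \<union> (A - f ` J)) =
         op_lift S J f X A C * g C" unfolding * using C assms by (auto simp: op_lift_def)
  next
    fix c assume "c \<in> Pow J"
    then show "{j \<in> J. f j \<in> f ` c \<union> (A - f ` J)} = c"
      using assms(2) by (auto simp: inj_on_def)
  qed (use assms in auto)
  finally show ?thesis .
qed

lemma op_adj_lift: "op_adj (op_lift S J f X) = op_lift S J f (op_adj X)"
  by (auto simp: op_adj_def op_lift_def fun_eq_iff)

lemma operator_on_lift: "operator_on S (op_lift S J f X)"
  by (auto simp: op_lift_def operator_on_def)

lemma op_mult_lift: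
  assumes "finite S" "inj_on f J" "f ` J \<subseteq> S"
  shows "op_mult S (op_lift S J f X) (op_lift S J f Y) = op_lift S J f (op_mult J X Y)"
proof (intro ext)
  fix A C
  show "op_mult S (op_lift S J f X) (op_lift S J f Y) A C = op_lift S J f (op_mult J X Y) A C"
  proof (cases "A \<subseteq> S \<and> C \<subseteq> S")
    case False
    then show ?thesis by (cases "A \<subseteq> S") (simp_all add: op_mult_def op_lift_def)
  next
    case True
    have "op_lift S J f Y (f ` c \<union> (A - f ` J)) C =
        (if A - f ` J = C - f ` J then Y c {j\<in>J. f j \<in> C} else 0)" if "c \<in> Pow J" for c
    proof -
      have "{j\<in>J. f j \<in> f ` c \<union> (A - f ` J)} = c"
        using assms(2) that by (auto simp: inj_on_def)
      moreover have "(f ` c \<union> (A - f ` J)) - f ` J = A - f ` J" "f ` c \<union> (A - f ` J) \<subseteq> S"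
        using that assms True by auto
      ultimately show ?thesis using True unfolding op_lift_def by (simp only: simp_thms)
    qed
    then show ?thesis
      using True assms by (simp add: op_mult_def sum_op_lift) (simp add: op_lift_def op_mult_def)
  qed
qed

lemma op_lift_id:
  assumes "inj_on f J" "f ` J \<subseteq> S"
  shows "op_lift S J f (op_id J) = op_id S"
proof (intro ext)
  fix A B
  have "A = B" if "A - f ` J = B - f ` J" "{j\<in>J. f j \<in> A} = {j\<in>J. f j \<in> B}"
  proof -
    have "A \<inter> f ` J = f ` {j\<in>J. f j \<in> A}" "B \<inter> f ` J = f ` {j\<in>J. f j \<in> B}" by auto
    then show ?thesis using that using Int_Diff_Un[of A "f ` J"] Int_Diff_Un[of B "f ` J"] by simp
  qed
  then show "op_lift S J f (op_id J) A B = op_id S A B"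
    by (auto simp: op_lift_def op_id_def)
qed

text \<open>Tensoring with the identity may be done in two stages. An operation on a few qubits of
  the context can thus be read as one on all qubits outside the hole, the kind under which labelled
  bisimilarity is closed.\<close>

lemma op_lift_lift:
  assumes "f ` J \<subseteq> T" "T \<subseteq> S"
  shows "op_lift S T (\<lambda>q. q) (op_lift T J f X) = op_lift S J f X"
proof (intro ext)
  fix A B
  \<comment> \<open>The indices agree off the image of \<open>f\<close> iff they agree off
    \<open>T\<close> and, inside \<open>T\<close>, off the image: the two identity factors multiply
    to one.\<close>
  have "A - f ` J = B - f ` J \<longleftrightarrow> A - T = B - T \<and> A \<inter> T - f ` J = B \<inter> T - f ` J"
  proof
    assume *: "A - f ` J = B - f ` J"
    have "A - T = (A - f ` J) - T" "B - T = (B - f ` J) - T"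
      "A \<inter> T - f ` J = (A - f ` J) \<inter> T" "B \<inter> T - f ` J = (B - f ` J) \<inter> T" using assms by auto
    then show "A - T = B - T \<and> A \<inter> T - f ` J = B \<inter> T - f ` J" using * by simp
  next
    assume *: "A - T = B - T \<and> A \<inter> T - f ` J = B \<inter> T - f ` J"
    have "A - f ` J = (A - T) \<union> (A \<inter> T - f ` J)" "B - f ` J = (B - T) \<union> (B \<inter> T - f ` J)"
      using assms by auto
    then show "A - f ` J = B - f ` J" using * by simp
  qed
  moreover have "{j \<in> J. f j \<in> A \<inter> T} = {j \<in> J. f j \<in> A}" for A using assms by auto
  moreover have "{j\<in>T. j \<in> A} = A \<inter> T" for A by auto
  ultimately show "op_lift S T (\<lambda>q. q) (op_lift T J f X) A B = op_lift S J f X A B"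
    by (simp add: op_lift_def)
qed

section \<open>Partial application of superoperators in Kraus form\<close>

lemma superop_on_conjugation:
  assumes "finite S" "inj_on f J" "f ` J \<subseteq> S"
  shows "superop_on S J f (conjugation J K) \<rho> = conjugation S (op_lift S J f K) \<rho>"
proof (intro ext)
  fix A B
  show "superop_on S J f (conjugation J K) \<rho> A B = conjugation S (op_lift S J f K) \<rho> A B"
  proof (cases "A \<subseteq> S \<and> B \<subseteq> S")
    case False
    then show ?thesis
      by (cases "A \<subseteq> S") (simp_all add: superop_on_def conjugation_def op_mult_def op_adj_def op_lift_def)
  next
    case True
    have "conjugation S (op_lift S J f K) \<rho> A B =
      (\<Sum>D\<in>Pow S. cnj (op_lift S J f K B D) * (\<Sum>C\<in>Pow S. op_lift S J f K A C * \<rho> C D))"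
      by (simp add: conjugation_def op_mult_def op_adj_def mult.commute)
    also have "\<dots> = (\<Sum>D\<in>Pow S. op_lift S J f (\<lambda>A B. cnj (K A B)) B D *
        (\<Sum>c\<in>Pow J. K {j\<in>J. f j \<in> A} c * \<rho> (f ` c \<union> (A - f ` J)) D))"
    proof (intro sum.cong refl)
      fix D
      have "cnj (op_lift S J f K B D) = op_lift S J f (\<lambda>A B. cnj (K A B)) B D"
        by (simp add: op_lift_def)
      moreover have "(\<Sum>C\<in>Pow S. op_lift S J f K A C * \<rho> C D) =
          (\<Sum>c\<in>Pow J. K {j\<in>J. f j \<in> A} c * \<rho> (f ` c \<union> (A - f ` J)) D)"
        using True assms by (intro sum_op_lift) auto
      ultimately show "cnj (op_lift S J f K B D) * (\<Sum>C\<in>Pow S. op_lift S J f K A C * \<rho> C D) =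
        op_lift S J f (\<lambda>A B. cnj (K A B)) B D *
          (\<Sum>c\<in>Pow J. K {j\<in>J. f j \<in> A} c * \<rho> (f ` c \<union> (A - f ` J)) D)" by simp
    qed
    also have "\<dots> = superop_on S J f (conjugation J K) \<rho> A B"
      using True assms
      by (simp add: sum_op_lift superop_on_def conjugation_def op_mult_def op_adj_def mult.commute)
    finally show ?thesis by simp
  qed
qed

text \<open>\<open>superop_on\<close> is defined block by block. Rewriting it with Kraus operators
  tensored with the identity reduces positivity and trace computations for partial applications to
  ordinary Kraus sums on the whole register.\<close>

lemma superop_on_kraus:
  assumes "finite S" "inj_on f J" "f ` J \<subseteq> S"
  shows "superop_on S J f (kraus J Ks) = kraus S (map (op_lift S J f) Ks)"
proof (intro ext)
  fix \<rho> A B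
  have "superop_on S J f (kraus J Ks) \<rho> A B = (\<Sum>K\<leftarrow>Ks. superop_on S J f (conjugation J K) \<rho> A B)"
    by (cases "A \<subseteq> S \<and> B \<subseteq> S") (simp_all only: superop_on_def kraus_def if_True if_False sum_list_0 simp_thms)
  also have "\<dots> = kraus S (map (op_lift S J f) Ks) \<rho> A B"
    unfolding superop_on_conjugation[OF assms] by (simp add: kraus_def comp_def)
  finally show "superop_on S J f (kraus J Ks) \<rho> A B = kraus S (map (op_lift S J f) Ks) \<rho> A B" .
qed

lemma op_lift_sum_list: "op_lift S J f (\<lambda>A B. \<Sum>x\<leftarrow>xs. X x A B) A B = (\<Sum>x\<leftarrow>xs. op_lift S J f (X x) A B)"
  by (cases "A \<subseteq> S \<and> B \<subseteq> S \<and> A - f ` J = B - f ` J") (simp_all only: op_lift_def if_True if_False sum_list_0 simp_thms)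

lemma kraus_gram_lift:
  assumes "finite S" "inj_on f J" "f ` J \<subseteq> S"
  shows "kraus_gram S (map (op_lift S J f) Ks) = op_lift S J f (kraus_gram J Ks)"
  by (intro ext)
    (simp add: kraus_gram_def op_lift_sum_list op_adj_lift op_mult_lift[OF assms] comp_def)

subsection \<open>Positivity\<close>

lemma nonneg_Reals_sum:
  assumes "\<And>x. x \<in> A \<Longrightarrow> g x \<in> (\<real>\<^sub>\<ge>\<^sub>0 :: complex set)"
  shows "sum g A \<in> \<real>\<^sub>\<ge>\<^sub>0"
  using assms by (induction A rule: infinite_finite_induct) auto

lemma operator_on_conjugation: "operator_on S K \<Longrightarrow> operator_on S (conjugation S K \<rho>)"
  unfolding operator_on_def conjugation_def op_mult_def op_adj_def
proof (intro allI impI)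
  fix A B
  assume K: "\<forall>A B. K A B \<noteq> 0 \<longrightarrow> A \<subseteq> S \<and> B \<subseteq> S"
    and nz: "(\<Sum>D\<in>Pow S. (\<Sum>C\<in>Pow S. K A C * \<rho> C D) * cnj (K B D)) \<noteq> 0"
  from sum.not_neutral_contains_not_neutral[OF nz]
  obtain D where D: "(\<Sum>C\<in>Pow S. K A C * \<rho> C D) \<noteq> 0" "K B D \<noteq> 0" by auto
  from sum.not_neutral_contains_not_neutral[OF D(1)] D(2) K
  show "A \<subseteq> S \<and> B \<subseteq> S" by (metis mult_eq_0_iff)
qed

text \<open>The quadratic form of the conjugated operator at \<open>v\<close> is the form of \<rho>
  at \<open>u\<close>, the adjoint of \<open>K\<close> applied to \<open>v\<close>; the chain of
  exchanges only reorders four summations.\<close>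

lemma op_pos_conjugation:
  assumes "op_pos S \<rho>" "operator_on S K"
  shows "op_pos S (conjugation S K \<rho>)"
proof -
  have "(\<Sum>A\<in>Pow S. \<Sum>B\<in>Pow S. cnj (v A) * conjugation S K \<rho> A B * v B) \<in> \<real>\<^sub>\<ge>\<^sub>0" for v
  proof -
    define u where "u = (\<lambda>D. \<Sum>B\<in>Pow S. cnj (K B D) * v B)"
    have "(\<Sum>A\<in>Pow S. \<Sum>B\<in>Pow S. cnj (v A) * conjugation S K \<rho> A B * v B) =
      (\<Sum>A\<in>Pow S. \<Sum>B\<in>Pow S. \<Sum>D\<in>Pow S. \<Sum>C\<in>Pow S. cnj (v A) * K A C * \<rho> C D * cnj (K B D) * v B)"
      by (simp add: conjugation_def op_mult_def op_adj_def sum_distrib_left sum_distrib_right mult.assoc)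
    also have "\<dots> = (\<Sum>A\<in>Pow S. \<Sum>D\<in>Pow S. \<Sum>B\<in>Pow S. \<Sum>C\<in>Pow S. cnj (v A) * K A C * \<rho> C D * cnj (K B D) * v B)"
      by (intro sum.cong refl sum.swap)
    also have "\<dots> = (\<Sum>A\<in>Pow S. \<Sum>D\<in>Pow S. \<Sum>C\<in>Pow S. \<Sum>B\<in>Pow S. cnj (v A) * K A C * \<rho> C D * cnj (K B D) * v B)"
      by (intro sum.cong refl sum.swap)
    also have "\<dots> = (\<Sum>D\<in>Pow S. \<Sum>A\<in>Pow S. \<Sum>C\<in>Pow S. \<Sum>B\<in>Pow S. cnj (v A) * K A C * \<rho> C D * cnj (K B D) * v B)"
      by (rule sum.swap)
    also have "\<dots> = (\<Sum>D\<in>Pow S. \<Sum>C\<in>Pow S. \<Sum>A\<in>Pow S. \<Sum>B\<in>Pow S. cnj (v A) * K A C * \<rho> C D * cnj (K B D) * v B)"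
      by (intro sum.cong refl sum.swap)
    also have "\<dots> = (\<Sum>C\<in>Pow S. \<Sum>D\<in>Pow S. \<Sum>A\<in>Pow S. \<Sum>B\<in>Pow S. cnj (v A) * K A C * \<rho> C D * cnj (K B D) * v B)"
      by (rule sum.swap)
    also have "\<dots> = (\<Sum>C\<in>Pow S. \<Sum>D\<in>Pow S. cnj (u C) * \<rho> C D * u D)"
    proof (intro sum.cong refl)
      fix C D
      have "cnj (u C) = (\<Sum>A\<in>Pow S. cnj (v A) * K A C)"
        by (simp add: u_def mult.commute)
      then have "cnj (u C) * \<rho> C D * u D = (\<Sum>A\<in>Pow S. cnj (v A) * K A C * \<rho> C D) * u D"
        by (simp add: sum_distrib_right)
      also have "\<dots> = (\<Sum>A\<in>Pow S. \<Sum>B\<in>Pow S. cnj (v A) * K A C * \<rho> C D * cnj (K B D) * v B)"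
        by (simp add: u_def sum_product mult.assoc)
      finally show "(\<Sum>A\<in>Pow S. \<Sum>B\<in>Pow S. cnj (v A) * K A C * \<rho> C D * cnj (K B D) * v B) =
        cnj (u C) * \<rho> C D * u D" by simp
    qed
    also have "\<dots> \<in> \<real>\<^sub>\<ge>\<^sub>0" using assms(1) by (simp add: op_pos_def)
    finally show ?thesis .
  qed
  then show ?thesis using assms(2) by (simp add: op_pos_def operator_on_conjugation)
qed

lemma op_pos_zero: "op_pos S (\<lambda>A B. 0)"
  by (simp add: op_pos_def operator_on_def)

lemma op_pos_add:
  assumes "op_pos S X" "op_pos S Y"
  shows "op_pos S (\<lambda>A B. X A B + Y A B)"
proof -
  have "(\<Sum>A\<in>Pow S. \<Sum>B\<in>Pow S. cnj (v A) * (X A B + Y A B) * v B) =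
    (\<Sum>A\<in>Pow S. \<Sum>B\<in>Pow S. cnj (v A) * X A B * v B) + (\<Sum>A\<in>Pow S. \<Sum>B\<in>Pow S. cnj (v A) * Y A B * v B)" for v
    by (simp add: distrib_left distrib_right sum.distrib)
  moreover have "operator_on S (\<lambda>A B. X A B + Y A B)"
  proof -
    have "X A B \<noteq> 0 \<or> Y A B \<noteq> 0" if "X A B + Y A B \<noteq> 0" for A B using that by auto
    then show ?thesis using assms unfolding op_pos_def operator_on_def by blast
  qed
  ultimately show ?thesis using assms unfolding op_pos_def by simp
qed

lemma op_pos_scale:
  assumes "op_pos S X" "0 \<le> a"
  shows "op_pos S (\<lambda>A B. X A B * of_real a)"
proof -
  have "(\<Sum>A\<in>Pow S. \<Sum>B\<in>Pow S. cnj (v A) * (X A B * of_real a) * v B) =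
    of_real a * (\<Sum>A\<in>Pow S. \<Sum>B\<in>Pow S. cnj (v A) * X A B * v B)" for v
    by (simp add: sum_distrib_left mult_ac)
  moreover have "operator_on S (\<lambda>A B. X A B * of_real a)"
    using assms by (auto simp: op_pos_def operator_on_def)
  ultimately show ?thesis using assms unfolding op_pos_def by (simp add: nonneg_Reals_mult_I)
qed

lemma op_pos_sum:
  assumes "finite I" "\<And>i. i \<in> I \<Longrightarrow> op_pos S (X i)"
  shows "op_pos S (\<lambda>A B. \<Sum>i\<in>I. X i A B)"
  using assms by (induction I rule: finite_induct) (auto simp: op_pos_zero op_pos_add)

lemma op_pos_kraus:
  assumes "op_pos S \<rho>" "\<forall>K\<in>set Ks. operator_on S K"
  shows "op_pos S (kraus S Ks \<rho>)"
  using assms(2) unfolding kraus_def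
  by (induction Ks) (auto simp: op_pos_zero op_pos_add op_pos_conjugation[OF assms(1)])

text \<open>Each diagonal entry is the value of the quadratic form at a basis vector.\<close>

lemma op_pos_trace:
  assumes "op_pos S X" "finite S"
  shows "op_trace S X \<in> \<real>\<^sub>\<ge>\<^sub>0"
  unfolding op_trace_def
proof (rule nonneg_Reals_sum)
  fix C assume C: "C \<in> Pow S"
  define v where "v = (\<lambda>A. if A = C then 1 else 0 :: complex)"
  have inner: "(\<Sum>B\<in>Pow S. cnj (v A) * X A B * v B) = cnj (v A) * X A C" for A
  proof -
    have "(\<Sum>B\<in>Pow S. cnj (v A) * X A B * v B) = (\<Sum>B\<in>Pow S. if B = C then cnj (v A) * X A C else 0)"
      by (rule sum.cong[OF refl]) (simp add: v_def)
    then show ?thesis using C assms(2) by simp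
  qed
  have "(\<Sum>A\<in>Pow S. \<Sum>B\<in>Pow S. cnj (v A) * X A B * v B) = (\<Sum>A\<in>Pow S. if A = C then X C C else 0)"
    unfolding inner by (rule sum.cong[OF refl]) (simp add: v_def)
  also have "\<dots> = X C C" using C assms(2) by simp
  finally show "X C C \<in> \<real>\<^sub>\<ge>\<^sub>0"
    using assms(1)[unfolded op_pos_def, THEN conjunct2, rule_format, of v] by simp
qed

lemma sum_Pow_Un:
  assumes "finite S" "T \<subseteq> S"
  shows "(\<Sum>A\<in>Pow S. g A) = (\<Sum>a\<in>Pow T. \<Sum>c\<in>Pow (S - T). g (a \<union> c))"
proof -
  have "(\<Sum>A\<in>Pow S. g A) = (\<Sum>(a, c)\<in>Pow T \<times> Pow (S - T). g (a \<union> c))"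
    by (rule sum.reindex_bij_witness[where i = "\<lambda>(a, c). a \<union> c" and j = "\<lambda>A. (A \<inter> T, A - T)"])
       (use assms in \<open>auto simp: Int_Diff_Un\<close>)
  then show ?thesis by (simp add: sum.cartesian_product)
qed

text \<open>The quadratic form at \<open>v\<close> is the squared norm of \<open>K\<close> applied
  to \<open>v\<close>.\<close>

lemma op_pos_gram: "operator_on S K \<Longrightarrow> op_pos S (op_mult S (op_adj K) K)"
proof -
  assume K: "operator_on S K"
  have "(\<Sum>A\<in>Pow S. \<Sum>B\<in>Pow S. cnj (v A) * op_mult S (op_adj K) K A B * v B) \<in> \<real>\<^sub>\<ge>\<^sub>0" for v
  proof -
    have "(\<Sum>A\<in>Pow S. \<Sum>B\<in>Pow S. cnj (v A) * op_mult S (op_adj K) K A B * v B) =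
      (\<Sum>A\<in>Pow S. \<Sum>B\<in>Pow S. \<Sum>C\<in>Pow S. cnj (v A) * cnj (K C A) * K C B * v B)"
      by (simp add: op_mult_def op_adj_def sum_distrib_left sum_distrib_right mult.assoc)
    also have "\<dots> = (\<Sum>A\<in>Pow S. \<Sum>C\<in>Pow S. \<Sum>B\<in>Pow S. cnj (v A) * cnj (K C A) * K C B * v B)"
      by (intro sum.cong refl sum.swap)
    also have "\<dots> = (\<Sum>C\<in>Pow S. \<Sum>A\<in>Pow S. \<Sum>B\<in>Pow S. cnj (v A) * cnj (K C A) * K C B * v B)"
      by (rule sum.swap)
    also have "\<dots> = (\<Sum>C\<in>Pow S. cnj (\<Sum>B\<in>Pow S. K C B * v B) * (\<Sum>B\<in>Pow S. K C B * v B))"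
    proof (intro sum.cong refl)
      fix C
      have "cnj (\<Sum>B\<in>Pow S. K C B * v B) = (\<Sum>A\<in>Pow S. cnj (v A) * cnj (K C A))"
        by (simp add: mult.commute)
      then show "(\<Sum>A\<in>Pow S. \<Sum>B\<in>Pow S. cnj (v A) * cnj (K C A) * K C B * v B) =
        cnj (\<Sum>B\<in>Pow S. K C B * v B) * (\<Sum>B\<in>Pow S. K C B * v B)"
        by (simp only: sum_product mult.assoc)
    qed
    also have "\<dots> \<in> \<real>\<^sub>\<ge>\<^sub>0"
    proof (rule nonneg_Reals_sum)
      have "cnj z * z \<in> \<real>\<^sub>\<ge>\<^sub>0" for z by (simp add: complex_nonneg_Reals_iff)
      then show "cnj (\<Sum>B\<in>Pow S. K C B * v B) * (\<Sum>B\<in>Pow S. K C B * v B) \<in> \<real>\<^sub>\<ge>\<^sub>0" for C .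
    qed
    finally show ?thesis .
  qed
  moreover have "operator_on S (op_mult S (op_adj K) K)"
    unfolding operator_on_def op_mult_def op_adj_def
  proof (intro allI impI)
    fix A B
    assume nz: "(\<Sum>C\<in>Pow S. cnj (K C A) * K C B) \<noteq> 0"
    from sum.not_neutral_contains_not_neutral[OF nz]
    obtain C where "K C A \<noteq> 0" "K C B \<noteq> 0" by auto
    then show "A \<subseteq> S \<and> B \<subseteq> S" using K by (auto simp: operator_on_def)
  qed
  ultimately show ?thesis by (simp add: op_pos_def)
qed

lemma op_pos_kraus_gram: "\<forall>K\<in>set Ks. operator_on S K \<Longrightarrow> op_pos S (kraus_gram S Ks)"
  unfolding kraus_gram_def
  by (induction Ks) (auto simp: op_pos_zero op_pos_add op_pos_gram)

text \<open>Tensoring with the identity gives a block-diagonal matrix with one copy of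
  \<open>X\<close> for each basis state \<open>c\<close> of the untouched qubits, so the form is a
  sum of values of the form of \<open>X\<close>.\<close>

lemma op_pos_lift:
  assumes "finite S" "inj_on f J" "f ` J \<subseteq> S" "op_pos J X"
  shows "op_pos S (op_lift S J f X)"
proof -
  have pre: "{j\<in>J. f j \<in> f ` a \<union> c} = a" if "a \<in> Pow J" "c \<in> Pow (S - f ` J)" for a c
    using assms(2) that by (auto simp: inj_on_def)
  have diff: "f ` a \<union> c - f ` J = c" if "a \<in> Pow J" "c \<in> Pow (S - f ` J)" for a c
    using that by auto
  have reindex: "(\<Sum>a\<in>Pow (f ` J). g a) = (\<Sum>a\<in>Pow J. g (f ` a))" for g :: "nat set \<Rightarrow> complex"
    using sum.reindex[OF inj_on_image_Pow[OF assms(2)], of g] by (simp add: image_Pow_surj)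
  have "(\<Sum>A\<in>Pow S. \<Sum>B\<in>Pow S. cnj (v A) * op_lift S J f X A B * v B) \<in> \<real>\<^sub>\<ge>\<^sub>0" for v
  proof -
    have "(\<Sum>A\<in>Pow S. \<Sum>B\<in>Pow S. cnj (v A) * op_lift S J f X A B * v B) =
      (\<Sum>A\<in>Pow S. \<Sum>B\<in>Pow S. op_lift S J f X A B * (cnj (v A) * v B))"
      by (simp add: mult_ac)
    also have "\<dots> = (\<Sum>A\<in>Pow S. \<Sum>b\<in>Pow J. X {j\<in>J. f j \<in> A} b * (cnj (v A) * v (f ` b \<union> (A - f ` J))))"
      using assms by (intro sum.cong refl sum_op_lift) auto
    also have "\<dots> = (\<Sum>a\<in>Pow J. \<Sum>c\<in>Pow (S - f ` J). \<Sum>b\<in>Pow J.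
        X {j\<in>J. f j \<in> f ` a \<union> c} b * (cnj (v (f ` a \<union> c)) * v (f ` b \<union> (f ` a \<union> c - f ` J))))"
      by (simp add: sum_Pow_Un[OF assms(1,3)] reindex)
    also have "\<dots> = (\<Sum>a\<in>Pow J. \<Sum>c\<in>Pow (S - f ` J). \<Sum>b\<in>Pow J.
        X a b * (cnj (v (f ` a \<union> c)) * v (f ` b \<union> c)))"
      by (intro sum.cong refl) (simp only: pre diff)
    also have "\<dots> = (\<Sum>c\<in>Pow (S - f ` J). \<Sum>a\<in>Pow J. \<Sum>b\<in>Pow J.
        cnj (v (f ` a \<union> c)) * X a b * v (f ` b \<union> c))"
      by (subst sum.swap) (simp add: mult_ac)
    also have "\<dots> \<in> \<real>\<^sub>\<ge>\<^sub>0"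
    proof (rule nonneg_Reals_sum)
      show "(\<Sum>a\<in>Pow J. \<Sum>b\<in>Pow J. cnj (v (f ` a \<union> c)) * X a b * v (f ` b \<union> c)) \<in> \<real>\<^sub>\<ge>\<^sub>0" for c
        using assms(4)[unfolded op_pos_def, THEN conjunct2, rule_format, of "\<lambda>a. v (f ` a \<union> c)"] .
    qed
    finally show ?thesis .
  qed
  then show ?thesis by (simp add: op_pos_def operator_on_lift)
qed

lemma op_lift_diff: "op_lift S J f (\<lambda>A B. X A B - Y A B) = (\<lambda>A B. op_lift S J f X A B - op_lift S J f Y A B)"
  by (auto simp: op_lift_def fun_eq_iff)

lemma op_lift_sum: "op_lift S J f (\<lambda>A B. \<Sum>i\<in>I. X i A B) = (\<lambda>A B. \<Sum>i\<in>I. op_lift S J f (X i) A B)"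
proof (intro ext)
  fix A B
  show "op_lift S J f (\<lambda>A B. \<Sum>i\<in>I. X i A B) A B = (\<Sum>i\<in>I. op_lift S J f (X i) A B)"
    by (cases "A \<subseteq> S \<and> B \<subseteq> S \<and> A - f ` J = B - f ` J") (simp_all only: op_lift_def if_True if_False sum.neutral_const simp_thms)
qed

lemma loewner_le_lift:
  assumes "finite S" "inj_on f J" "f ` J \<subseteq> S" "loewner_le J (kraus_gram J Ks) (op_id J)"
  shows "loewner_le S (kraus_gram S (map (op_lift S J f) Ks)) (op_id S)"
proof -
  have "op_pos S (op_lift S J f (\<lambda>A B. op_id J A B - kraus_gram J Ks A B))"
    using assms by (intro op_pos_lift) (auto simp: loewner_le_def)
  then show ?thesis
    unfolding loewner_le_def op_lift_diff kraus_gram_lift[OF assms(1-3)] op_lift_id[OF assms(2,3)] .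
qed

lemma superop_on_embed:
  assumes "finite S" "inj_on f J" "f ` J \<subseteq> T" "T \<subseteq> S"
  shows "superop_on S J f (kraus J Ks) = superop_sub S T (kraus T (map (op_lift T J f) Ks))"
proof -
  have "superop_sub S T (kraus T (map (op_lift T J f) Ks)) =
      kraus S (map (op_lift S T (\<lambda>q. q)) (map (op_lift T J f) Ks))"
    unfolding superop_sub_def using assms by (intro superop_on_kraus) auto
  also have "\<dots> = superop_on S J f (kraus J Ks)"
    using assms by (subst superop_on_kraus) (auto simp: op_lift_lift comp_def)
  finally show ?thesis by simp
qed

lemma trace_nonincreasing_lift:
  assumes "finite T" "inj_on f J" "f ` J \<subseteq> T" "loewner_le J (kraus_gram J Ks) (op_id J)"
  shows "trace_nonincreasing T (kraus T (map (op_lift T J f) Ks))"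
  unfolding trace_nonincreasing_def
  using assms by (intro exI[of _ "map (op_lift T J f) Ks"]) (auto simp: loewner_le_lift operator_on_lift)

subsection \<open>Traces\<close>

text \<open>Cyclicity of the trace moves the adjoint of \<open>K\<close> in front of
  \<open>K\<close>, so the Kraus operators enter the probability only through their Gram
  matrix.\<close>

lemma op_trace_kraus:
  "op_trace S (kraus S Ks \<rho>) = (\<Sum>A\<in>Pow S. \<Sum>B\<in>Pow S. kraus_gram S Ks A B * \<rho> B A)"
proof -
  have 1: "op_trace S (conjugation S K \<rho>) = (\<Sum>A\<in>Pow S. \<Sum>B\<in>Pow S. op_mult S (op_adj K) K A B * \<rho> B A)" for K
  proof -
    have "op_trace S (conjugation S K \<rho>) =
      (\<Sum>C\<in>Pow S. \<Sum>A\<in>Pow S. \<Sum>B\<in>Pow S. cnj (K C A) * K C B * \<rho> B A)"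
      by (simp add: op_trace_def conjugation_def op_mult_def op_adj_def sum_distrib_left mult_ac)
    also have "\<dots> = (\<Sum>A\<in>Pow S. \<Sum>C\<in>Pow S. \<Sum>B\<in>Pow S. cnj (K C A) * K C B * \<rho> B A)"
      by (rule sum.swap)
    also have "\<dots> = (\<Sum>A\<in>Pow S. \<Sum>B\<in>Pow S. \<Sum>C\<in>Pow S. cnj (K C A) * K C B * \<rho> B A)"
      by (intro sum.cong refl sum.swap)
    also have "\<dots> = (\<Sum>A\<in>Pow S. \<Sum>B\<in>Pow S. op_mult S (op_adj K) K A B * \<rho> B A)"
      by (simp add: op_mult_def op_adj_def sum_distrib_right)
    finally show ?thesis .
  qed
  show ?thesis
  proof (induction Ks)
    case Nil
    then show ?case by (simp add: op_trace_def kraus_def kraus_gram_def)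
  next
    case (Cons K Ks)
    have "op_trace S (kraus S (K # Ks) \<rho>) = op_trace S (conjugation S K \<rho>) + op_trace S (kraus S Ks \<rho>)"
      by (simp add: op_trace_def kraus_def sum.distrib)
    then show ?case using Cons by (simp add: 1 kraus_gram_def sum.distrib distrib_right)
  qed
qed

lemma sum_op_trace_kraus:
  assumes "finite S" "(\<lambda>A B. \<Sum>m\<in>I. kraus_gram S (Ks m) A B) = op_id S"
  shows "(\<Sum>m\<in>I. op_trace S (kraus S (Ks m) \<rho>)) = op_trace S \<rho>"
proof -
  have "(\<Sum>m\<in>I. op_trace S (kraus S (Ks m) \<rho>)) =
    (\<Sum>A\<in>Pow S. \<Sum>m\<in>I. \<Sum>B\<in>Pow S. kraus_gram S (Ks m) A B * \<rho> B A)"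
    unfolding op_trace_kraus by (rule sum.swap)
  also have "\<dots> = (\<Sum>A\<in>Pow S. \<Sum>B\<in>Pow S. \<Sum>m\<in>I. kraus_gram S (Ks m) A B * \<rho> B A)"
    by (intro sum.cong refl sum.swap)
  also have "\<dots> = (\<Sum>A\<in>Pow S. \<Sum>B\<in>Pow S. op_id S A B * \<rho> B A)"
    using assms(2)[THEN fun_cong, THEN fun_cong] by (simp flip: sum_distrib_right)
  also have "\<dots> = (\<Sum>A\<in>Pow S. \<Sum>B\<in>Pow S. if A = B then \<rho> B A else 0)"
    by (intro sum.cong refl) (auto simp: op_id_def)
  also have "\<dots> = op_trace S \<rho>"
    using assms(1) by (simp add: op_trace_def)
  finally show ?thesis .
qed

text \<open>No signalling: the Gram matrix of an operation on \<open>T\<close> is tensored with the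
  identity on \<open>S - T\<close>, and the identity contracts the remaining indices of \<rho> to a
  partial trace. So the probability depends only on the reduced state on \<open>T\<close>, which is
  why bisimilar distributions give every outcome the same weight.\<close>

lemma op_trace_superop_sub:
  assumes "finite S" "T \<subseteq> S"
  shows "op_trace S (superop_sub S T (kraus T Ks) \<rho>) =
    (\<Sum>a\<in>Pow T. \<Sum>b\<in>Pow T. kraus_gram T Ks a b * partial_trace (S - T) \<rho> b a)"
proof -
  let ?G = "kraus_gram T Ks"
  have lift: "kraus_gram S (map (op_lift S T (\<lambda>q. q)) Ks) = op_lift S T (\<lambda>q. q) ?G"
    using assms by (intro kraus_gram_lift) auto
  have "op_trace S (superop_sub S T (kraus T Ks) \<rho>) =
    (\<Sum>A\<in>Pow S. \<Sum>B\<in>Pow S. op_lift S T (\<lambda>q. q) ?G A B * \<rho> B A)"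
    using assms unfolding superop_sub_def
    by (subst superop_on_kraus) (auto simp: op_trace_kraus lift)
  also have "\<dots> = (\<Sum>A\<in>Pow S. \<Sum>b\<in>Pow T. ?G {q\<in>T. q \<in> A} b * \<rho> (b \<union> (A - T)) A)"
  proof (rule sum.cong[OF refl])
    fix A assume "A \<in> Pow S"
    then show "(\<Sum>B\<in>Pow S. op_lift S T (\<lambda>q. q) ?G A B * \<rho> B A) =
        (\<Sum>b\<in>Pow T. ?G {q\<in>T. q \<in> A} b * \<rho> (b \<union> (A - T)) A)"
      using sum_op_lift[OF assms(1), of "\<lambda>q. q" T A ?G "\<lambda>B. \<rho> B A"] assms(2) by simp
  qed
  also have "\<dots> = (\<Sum>a\<in>Pow T. \<Sum>c\<in>Pow (S - T). \<Sum>b\<in>Pow T.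
      ?G {q\<in>T. q \<in> a \<union> c} b * \<rho> (b \<union> (a \<union> c - T)) (a \<union> c))"
    by (rule sum_Pow_Un[OF assms])
  also have "\<dots> = (\<Sum>a\<in>Pow T. \<Sum>c\<in>Pow (S - T). \<Sum>b\<in>Pow T. ?G a b * \<rho> (b \<union> c) (a \<union> c))"
  proof (intro sum.cong refl)
    fix a b c assume "a \<in> Pow T" "c \<in> Pow (S - T)"
    then have "{q\<in>T. q \<in> a \<union> c} = a" "a \<union> c - T = c" by auto
    then show "?G {q\<in>T. q \<in> a \<union> c} b * \<rho> (b \<union> (a \<union> c - T)) (a \<union> c) = ?G a b * \<rho> (b \<union> c) (a \<union> c)"
      by simp
  qed
  also have "\<dots> = (\<Sum>a\<in>Pow T. \<Sum>b\<in>Pow T. \<Sum>c\<in>Pow (S - T). ?G a b * \<rho> (b \<union> c) (a \<union> c))"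
    by (intro sum.cong refl sum.swap)
  also have "\<dots> = (\<Sum>a\<in>Pow T. \<Sum>b\<in>Pow T. ?G a b * partial_trace (S - T) \<rho> b a)"
  proof (intro sum.cong refl)
    fix a b assume "a \<in> Pow T" "b \<in> Pow T"
    then have "a \<inter> (S - T) = {}" "b \<inter> (S - T) = {}" by auto
    then show "(\<Sum>c\<in>Pow (S - T). ?G a b * \<rho> (b \<union> c) (a \<union> c)) = ?G a b * partial_trace (S - T) \<rho> b a"
      by (simp add: partial_trace_def sum_distrib_left)
  qed
  finally show ?thesis .
qed

lemma op_trace_partial_trace:
  assumes "finite S" "T \<subseteq> S"
  shows "op_trace S \<rho> = op_trace (S - T) (partial_trace T \<rho>)"
proof -
  have "a \<inter> T = {}" if "a \<in> Pow (S - T)" for a using that by auto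
  then show ?thesis
    using assms sum_Pow_Un[OF assms(1), of "S - T" "\<lambda>A. \<rho> A A"]
    by (simp add: op_trace_def partial_trace_def double_diff)
qed

lemma partial_trace_Un:
  assumes "finite T" "U \<subseteq> T"
  shows "partial_trace T X = partial_trace (T - U) (partial_trace U X)"
proof (intro ext)
  fix A B
  show "partial_trace T X A B = partial_trace (T - U) (partial_trace U X) A B"
  proof (cases "A \<inter> T = {} \<and> B \<inter> T = {}")
    case True
    have "(A \<union> c) \<inter> U = {}" "(B \<union> c) \<inter> U = {}" if "c \<in> Pow (T - U)" for c using that True assms by auto
    moreover have "A \<inter> (T - U) = {} \<and> B \<inter> (T - U) = {}" using True by auto
    ultimately show ?thesis
      using True assms sum_Pow_Un[OF assms(1), of "T - U" "\<lambda>C. X (A \<union> C) (B \<union> C)"]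
      by (simp add: partial_trace_def double_diff Un_assoc)
  next
    case False
    \<comment> \<open>If both indices avoid \<open>T - U\<close> but one of them meets
      \<open>T\<close>, that one meets \<open>U\<close>, where the inner partial trace is 0 by
      definition.\<close>
    have "(A \<union> c) \<inter> U \<noteq> {} \<or> (B \<union> c) \<inter> U \<noteq> {}"
      if "A \<inter> (T - U) = {} \<and> B \<inter> (T - U) = {}" for c
    proof -
      have "A \<inter> U = A \<inter> T" "B \<inter> U = B \<inter> T" using that assms(2) by auto
      then show ?thesis using False by auto
    qed
    then show ?thesis using False by (auto simp: partial_trace_def intro!: sum.neutral)
  qed
qed

section \<open>Typing and substitution\<close>

inductive_cases exp_typedE:
  "exp_typed (EVar x) T" "exp_typed (EVal v) T" "exp_typed (ENot e) T"
  "exp_typed (EOr e e') T" "exp_typed (ELe e e') T" "exp_typed (EEq e e') T"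

lemma exp_typed_TQubit:
  assumes "exp_typed e TQubit"
  obtains x where "e = EVar x" "var_ty x = TQubit" | q where "e = EVal (QubitV q)"
  using assms
proof cases
  case (2 v) then show ?thesis using that by (cases v) auto
qed (use that in auto)

lemma evaluates_typed: "evaluates e v \<Longrightarrow> exp_typed e T \<Longrightarrow> val_ty v = T"
  by (induction e v arbitrary: T rule: evaluates.induct) (auto elim: exp_typedE)

lemma exp_typed_subst: "exp_typed e T \<Longrightarrow> val_ty v = var_ty x \<Longrightarrow> exp_typed (exp_subst x v e) T"
  by (induction e T rule: exp_typed.induct) (auto intro: exp_typed.intros exp_typed.intros(2)[of v, THEN back_subst[of "exp_typed (EVal v)"]])

lemma exp_fv_subst: "exp_fv (exp_subst x v e) = exp_fv e - {x}"
  by (induction e) auto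

lemma fv_subst: "fv (subst x v P) = fv P - {x}"
  by (induction P) (auto simp: exp_fv_subst)

inductive_cases proc_typedE:
  "proc_typed \<Sigma> (Tau t P)" "proc_typed \<Sigma> (TauPair t t' P)" "proc_typed \<Sigma> (Apply t E es P)"
  "proc_typed \<Sigma> (Measure t M es x P)" "proc_typed \<Sigma> (Recv t c x P)" "proc_typed \<Sigma> (Discard es)"
  "proc_typed \<Sigma> (Send t c e P)" "proc_typed \<Sigma> (Cond e P Q)" "proc_typed \<Sigma> (Choice P Q)"
  "proc_typed \<Sigma> (Par P Q)" "proc_typed \<Sigma> (Restrict P c)"

lemma proc_typed_TQubit: "proc_typed \<Sigma> P \<Longrightarrow> e \<in> \<Sigma> \<Longrightarrow> exp_typed e TQubit"
  by (induction \<Sigma> P arbitrary: e rule: proc_typed.induct) auto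

lemma proc_typed_unique: "proc_typed \<Sigma> P \<Longrightarrow> proc_typed \<Sigma>' P \<Longrightarrow> \<Sigma> = \<Sigma>'"
proof (induction \<Sigma> P arbitrary: \<Sigma>' rule: proc_typed.induct)
  case (typed_qrecv c x \<Sigma> P t)
  from typed_qrecv.prems typed_qrecv.hyps
  have *: "EVar x \<notin> \<Sigma>'" "proc_typed (\<Sigma>' \<union> {EVar x}) P" by (auto elim!: proc_typedE)
  then show ?case using typed_qrecv.IH[OF *(2)] typed_qrecv.hyps by blast
next
  case (typed_qsend c e \<Sigma> P t)
  from typed_qsend.prems typed_qsend.hyps
  have *: "e \<in> \<Sigma>'" "proc_typed (\<Sigma>' - {e}) P" by (auto elim!: proc_typedE)
  then show ?case using typed_qsend.IH[OF *(2)] typed_qsend.hyps by blast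
next
  case (typed_recv c x \<Sigma> P t)
  from typed_recv.prems typed_recv.hyps have "proc_typed \<Sigma>' P" by (auto elim!: proc_typedE)
  then show ?case by (rule typed_recv.IH)
next
  case (typed_send c e \<Sigma> P t)
  from typed_send.prems typed_send.hyps have "proc_typed \<Sigma>' P" by (auto elim!: proc_typedE)
  then show ?case by (rule typed_send.IH)
next
  case (typed_par \<Sigma>1 \<Sigma>2 P Q)
  from typed_par.prems obtain \<Sigma>1' \<Sigma>2' where
    "\<Sigma>' = \<Sigma>1' \<union> \<Sigma>2'" "proc_typed \<Sigma>1' P" "proc_typed \<Sigma>2' Q" by (auto elim!: proc_typedE)
  with typed_par.IH(1)[of \<Sigma>1'] typed_par.IH(2)[of \<Sigma>2'] show ?case by simp
next
  case (typed_discard es)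
  then show ?case by (auto elim!: proc_typedE)
next
  case (typed_tau \<Sigma> P t)
  from typed_tau.prems have "proc_typed \<Sigma>' P" by (auto elim!: proc_typedE)
  then show ?case by (rule typed_tau.IH)
next
  case (typed_tau_pair \<Sigma> P t t')
  from typed_tau_pair.prems have "proc_typed \<Sigma>' P" by (auto elim!: proc_typedE)
  then show ?case by (rule typed_tau_pair.IH)
next
  case (typed_apply es \<Sigma> E P t)
  from typed_apply.prems have "proc_typed \<Sigma>' P" by (auto elim!: proc_typedE)
  then show ?case by (rule typed_apply.IH)
next
  case (typed_measure es \<Sigma> M x P t)
  from typed_measure.prems have "proc_typed \<Sigma>' P" by (auto elim!: proc_typedE)
  then show ?case by (rule typed_measure.IH)
next
  case (typed_cond e \<Sigma> P Q)
  from typed_cond.prems have "proc_typed \<Sigma>' P" by (auto elim!: proc_typedE)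
  then show ?case by (rule typed_cond.IH(1))
next
  case (typed_choice \<Sigma> P Q)
  from typed_choice.prems have "proc_typed \<Sigma>' P" by (auto elim!: proc_typedE)
  then show ?case by (rule typed_choice.IH(1))
next
  case (typed_restrict \<Sigma> P c)
  from typed_restrict.prems have "proc_typed \<Sigma>' P" by (auto elim!: proc_typedE)
  then show ?case by (rule typed_restrict.IH)
qed

lemma exp_subst_fresh: "exp_typed e TQubit \<Longrightarrow> e \<noteq> EVar x \<Longrightarrow> exp_subst x v e = e"
  by (erule exp_typed_TQubit) auto

lemma exp_subst_image_fresh:
  assumes "proc_typed \<Sigma> P" "EVar x \<notin> \<Sigma>"
  shows "exp_subst x v ` \<Sigma> = \<Sigma>" "inj_on (exp_subst x v) \<Sigma>"
proof -
  have "exp_subst x v e = e" if "e \<in> \<Sigma>" for e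
    using that assms proc_typed_TQubit exp_subst_fresh by metis
  then show "exp_subst x v ` \<Sigma> = \<Sigma>" "inj_on (exp_subst x v) \<Sigma>" by (auto simp: inj_on_def)
qed

lemma exp_subst_eq_EVar: "exp_subst x v e = EVar y \<Longrightarrow> e = EVar y"
  by (cases e) (auto split: if_splits)

lemma exp_subst_EVar_image: "EVar y \<notin> \<Sigma> \<Longrightarrow> EVar y \<notin> exp_subst x v ` \<Sigma>"
  using exp_subst_eq_EVar by (metis imageE)

lemma proc_typed_classical_fresh: "proc_typed \<Sigma> P \<Longrightarrow> var_ty x \<noteq> TQubit \<Longrightarrow> EVar x \<notin> \<Sigma>"
  using proc_typed_TQubit[of \<Sigma> P "EVar x"] by (auto elim!: exp_typedE)

text \<open>Injectivity on \<Sigma> keeps tuples duplicate-free and the two sides of a parallel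
  composition disjoint: substituting a qubit already in \<Sigma> would merge it with the
  variable.\<close>

lemma proc_typed_subst:
  assumes "proc_typed \<Sigma> P" "val_ty v = var_ty x" "inj_on (exp_subst x v) \<Sigma>"
  shows "proc_typed (exp_subst x v ` \<Sigma>) (subst x v P)"
  using assms
proof (induction \<Sigma> P rule: proc_typed.induct)
  case (typed_discard es)
  then have "proc_typed (set (map (exp_subst x v) es)) (Discard (map (exp_subst x v) es))"
    by (intro proc_typed.typed_discard) (auto simp: distinct_map exp_typed_subst)
  then show ?case by simp
next
  case (typed_apply es \<Sigma> E P t)
  have "distinct (map (exp_subst x v) es)"
    using typed_apply.hyps typed_apply.prems(2) by (auto simp: distinct_map intro: inj_on_subset)
  moreover have "set (map (exp_subst x v) es) \<subseteq> exp_subst x v ` \<Sigma>"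
    using typed_apply.hyps by auto
  ultimately show ?case
    unfolding subst.simps using typed_apply by (intro proc_typed.typed_apply) simp_all
next
  case (typed_measure es \<Sigma> M y P t)
  have "distinct (map (exp_subst x v) es)"
    using typed_measure.hyps typed_measure.prems(2) by (auto simp: distinct_map intro: inj_on_subset)
  moreover have "set (map (exp_subst x v) es) \<subseteq> exp_subst x v ` \<Sigma>"
    using typed_measure.hyps by auto
  moreover have "proc_typed (exp_subst x v ` \<Sigma>) (if x = y then P else subst x v P)"
  proof (cases "x = y")
    case True
    \<comment> \<open>The binder shadows the substitution; as \<open>x\<close> is classical it does
      not occur in \<Sigma>, so the type must not change either.\<close>
    then have "EVar x \<notin> \<Sigma>" using typed_measure.hyps by (intro proc_typed_classical_fresh) auto
    then show ?thesis using True typed_measure.hyps exp_subst_image_fresh(1)[of \<Sigma> P x v] by simp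
  qed (use typed_measure in simp)
  ultimately show ?case
    unfolding subst.simps using typed_measure.hyps by (intro proc_typed.typed_measure) simp_all
next
  case (typed_recv c y \<Sigma> P t)
  have "proc_typed (exp_subst x v ` \<Sigma>) (if x = y then P else subst x v P)"
  proof (cases "x = y")
    case True
    then have "EVar x \<notin> \<Sigma>" using typed_recv.hyps by (intro proc_typed_classical_fresh) auto
    then show ?thesis using True typed_recv.hyps exp_subst_image_fresh(1)[of \<Sigma> P x v] by simp
  qed (use typed_recv in simp)
  then show ?case
    unfolding subst.simps using typed_recv.hyps by (intro proc_typed.typed_recv)
next
  case (typed_qrecv c y \<Sigma> P t)
  show ?case
  proof (cases "x = y")
    case True
    have "proc_typed \<Sigma> (Recv t c y P)" using typed_qrecv.hyps by (rule proc_typed.typed_qrecv)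
    then show ?thesis using True exp_subst_image_fresh(1)[of \<Sigma> "Recv t c y P" x] typed_qrecv.hyps by simp
  next
    case False
    have notin: "EVar y \<notin> exp_subst x v ` \<Sigma>"
      using typed_qrecv.hyps by (intro exp_subst_EVar_image)
    then have "inj_on (exp_subst x v) (\<Sigma> \<union> {EVar y})"
      using typed_qrecv.prems(2) False by auto
    then have "proc_typed (exp_subst x v ` (\<Sigma> \<union> {EVar y})) (subst x v P)"
      using typed_qrecv by blast
    moreover have "exp_subst x v ` (\<Sigma> \<union> {EVar y}) = exp_subst x v ` \<Sigma> \<union> {EVar y}" using False by simp
    ultimately show ?thesis
      using typed_qrecv.hyps notin False by (simp add: proc_typed.typed_qrecv)
  qed
next
  case (typed_send c e \<Sigma> P t)
  then show ?case
    unfolding subst.simps by (intro proc_typed.typed_send exp_typed_subst)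
next
  case (typed_qsend c e \<Sigma> P t)
  have "exp_subst x v ` (\<Sigma> - {e}) = exp_subst x v ` \<Sigma> - {exp_subst x v e}"
    using inj_on_image_set_diff[OF typed_qsend.prems(2), of \<Sigma> "{e}"] typed_qsend.hyps by auto
  moreover have "proc_typed (exp_subst x v ` (\<Sigma> - {e})) (subst x v P)"
    using typed_qsend.IH typed_qsend.prems inj_on_diff by blast
  ultimately show ?case
    unfolding subst.simps using typed_qsend.hyps typed_qsend.prems
    by (intro proc_typed.typed_qsend exp_typed_subst imageI) simp_all
next
  case (typed_par \<Sigma>1 \<Sigma>2 P Q)
  have "exp_subst x v ` \<Sigma>1 \<inter> exp_subst x v ` \<Sigma>2 = {}"
    using inj_on_image_Int[OF typed_par.prems(2), of \<Sigma>1 \<Sigma>2] typed_par.hyps by auto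
  then show ?case
    unfolding subst.simps image_Un using typed_par by (intro proc_typed.typed_par) (auto simp: inj_on_Un)
qed (simp_all add: proc_typed.intros exp_typed_subst)

text \<open>Converse of \<open>proc_typed_subst\<close>: a typable instance forces injectivity. This
  is what rules out that a process receives a qubit it already owns.\<close>

lemma proc_typed_subst_inj:
  assumes "proc_typed \<Sigma> P" "proc_typed \<Sigma>' (subst x v P)"
  shows "inj_on (exp_subst x v) \<Sigma> \<and> \<Sigma>' = exp_subst x v ` \<Sigma>"
  using assms
proof (induction \<Sigma> P arbitrary: \<Sigma>' rule: proc_typed.induct)
  case (typed_discard es)
  then show ?case by (auto elim!: proc_typedE simp: distinct_map)
next
  case (typed_measure es \<Sigma> M y P t)
  show ?case
  proof (cases "x = y")
    case True
    from typed_measure.prems have "proc_typed \<Sigma>' P" using True typed_measure.hyps by (auto elim!: proc_typedE)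
    then have "\<Sigma>' = \<Sigma>" using typed_measure.hyps proc_typed_unique by blast
    moreover have "EVar x \<notin> \<Sigma>" using True typed_measure.hyps by (intro proc_typed_classical_fresh) auto
    ultimately show ?thesis using typed_measure.hyps exp_subst_image_fresh by metis
  next
    case False
    from typed_measure.prems have "proc_typed \<Sigma>' (subst x v P)" using False typed_measure.hyps by (auto elim!: proc_typedE)
    then show ?thesis by (rule typed_measure.IH)
  qed
next
  case (typed_recv c y \<Sigma> P t)
  show ?case
  proof (cases "x = y")
    case True
    from typed_recv.prems have "proc_typed \<Sigma>' P" using True typed_recv.hyps by (auto elim!: proc_typedE)
    then have "\<Sigma>' = \<Sigma>" using typed_recv.hyps proc_typed_unique by blast
    moreover have "EVar x \<notin> \<Sigma>" using True typed_recv.hyps by (intro proc_typed_classical_fresh) auto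
    ultimately show ?thesis using typed_recv.hyps exp_subst_image_fresh by metis
  next
    case False
    from typed_recv.prems have "proc_typed \<Sigma>' (subst x v P)" using False typed_recv.hyps by (auto elim!: proc_typedE)
    then show ?thesis by (rule typed_recv.IH)
  qed
next
  case (typed_qrecv c y \<Sigma> P t)
  have typed: "proc_typed \<Sigma> (Recv t c y P)" using typed_qrecv.hyps by (rule proc_typed.typed_qrecv)
  show ?case
  proof (cases "x = y")
    case True
    then show ?thesis
      using exp_subst_image_fresh[OF typed, of x v] typed_qrecv.hyps typed_qrecv.prems
        proc_typed_unique[OF typed, of \<Sigma>'] by simp
  next
    case False
    from typed_qrecv.prems have "proc_typed \<Sigma>' (Recv t c y (subst x v P))" using False by simp
    then have *: "EVar y \<notin> \<Sigma>'" "proc_typed (\<Sigma>' \<union> {EVar y}) (subst x v P)"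
      using typed_qrecv.hyps by (auto elim!: proc_typedE)
    from typed_qrecv.IH[OF *(2)] have
      inj: "inj_on (exp_subst x v) (\<Sigma> \<union> {EVar y})" and
      eq: "\<Sigma>' \<union> {EVar y} = exp_subst x v ` \<Sigma> \<union> {EVar y}" using False by auto
    have "EVar y \<notin> exp_subst x v ` \<Sigma>"
      using typed_qrecv.hyps by (intro exp_subst_EVar_image)
    then have "\<Sigma>' = exp_subst x v ` \<Sigma>"
      using eq *(1) insert_ident[of "EVar y" \<Sigma>' "exp_subst x v ` \<Sigma>"] by simp
    then show ?thesis using inj by (simp add: inj_on_Un)
  qed
next
  case (typed_qsend c e \<Sigma> P t)
  from typed_qsend.prems have *: "exp_subst x v e \<in> \<Sigma>'" "proc_typed (\<Sigma>' - {exp_subst x v e}) (subst x v P)"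
    using typed_qsend.hyps by (auto elim!: proc_typedE)
  from typed_qsend.IH[OF *(2)] have
    inj: "inj_on (exp_subst x v) (\<Sigma> - {e})" and
    eq: "\<Sigma>' - {exp_subst x v e} = exp_subst x v ` (\<Sigma> - {e})" by auto
  have "\<Sigma> = insert e (\<Sigma> - {e})" using typed_qsend.hyps by auto
  moreover have "exp_subst x v e \<notin> exp_subst x v ` (\<Sigma> - {e})" using eq by auto
  ultimately have "inj_on (exp_subst x v) \<Sigma>" using inj by (metis Diff_idemp inj_on_insert)
  moreover have "\<Sigma>' = exp_subst x v ` \<Sigma>"
    using eq *(1) typed_qsend.hyps by auto
  ultimately show ?case by simp
next
  case (typed_par \<Sigma>1 \<Sigma>2 P Q)
  from typed_par.prems obtain \<Sigma>1' \<Sigma>2' where *: "\<Sigma>' = \<Sigma>1' \<union> \<Sigma>2'" "\<Sigma>1' \<inter> \<Sigma>2' = {}"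
    "proc_typed \<Sigma>1' (subst x v P)" "proc_typed \<Sigma>2' (subst x v Q)"
    by (auto elim!: proc_typedE)
  with typed_par.IH(1)[OF *(3)] typed_par.IH(2)[OF *(4)] show ?case
    by (auto simp: inj_on_Un image_Un)
next
  case (typed_tau \<Sigma> P t)
  from typed_tau.prems typed_tau.hyps have "proc_typed \<Sigma>' (subst x v P)" by (auto elim!: proc_typedE)
  then show ?case by (rule typed_tau.IH)
next
  case (typed_tau_pair \<Sigma> P t t')
  from typed_tau_pair.prems typed_tau_pair.hyps have "proc_typed \<Sigma>' (subst x v P)" by (auto elim!: proc_typedE)
  then show ?case by (rule typed_tau_pair.IH)
next
  case (typed_apply es \<Sigma> E P t)
  from typed_apply.prems typed_apply.hyps have "proc_typed \<Sigma>' (subst x v P)" by (auto elim!: proc_typedE)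
  then show ?case by (rule typed_apply.IH)
next
  case (typed_send c e \<Sigma> P t)
  from typed_send.prems typed_send.hyps have "proc_typed \<Sigma>' (subst x v P)" by (auto elim!: proc_typedE)
  then show ?case by (rule typed_send.IH)
next
  case (typed_cond e \<Sigma> P Q)
  from typed_cond.prems typed_cond.hyps have "proc_typed \<Sigma>' (subst x v P)" by (auto elim!: proc_typedE)
  then show ?case by (rule typed_cond.IH(1))
next
  case (typed_choice \<Sigma> P Q)
  from typed_choice.prems typed_choice.hyps have "proc_typed \<Sigma>' (subst x v P)" by (auto elim!: proc_typedE)
  then show ?case by (rule typed_choice.IH(1))
next
  case (typed_restrict \<Sigma> P c)
  from typed_restrict.prems typed_restrict.hyps have "proc_typed \<Sigma>' (subst x v P)" by (auto elim!: proc_typedE)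
  then show ?case by (rule typed_restrict.IH)
qed

section \<open>Types of closed processes as sets of qubit names\<close>

lemma inj_qexp: "inj qexp"
  by (simp add: inj_def qexp_def)

lemma has_qubits_unique: "has_qubits \<Sigma> P \<Longrightarrow> has_qubits \<Sigma>' P \<Longrightarrow> \<Sigma> = \<Sigma>'"
  using proc_typed_unique inj_image_eq_iff[OF inj_qexp] unfolding has_qubits_def by metis

lemma has_qubits_Par:
  "has_qubits \<Sigma> (Par P Q) \<longleftrightarrow>
    (\<exists>\<Sigma>1 \<Sigma>2. \<Sigma> = \<Sigma>1 \<union> \<Sigma>2 \<and> \<Sigma>1 \<inter> \<Sigma>2 = {} \<and> has_qubits \<Sigma>1 P \<and> has_qubits \<Sigma>2 Q)"
proof
  assume "has_qubits \<Sigma> (Par P Q)"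
  then obtain T1 T2 where T: "qexp ` \<Sigma> = T1 \<union> T2" "T1 \<inter> T2 = {}" "proc_typed T1 P" "proc_typed T2 Q"
    unfolding has_qubits_def by (auto elim!: proc_typedE)
  then obtain \<Sigma>1 \<Sigma>2 where S: "T1 = qexp ` \<Sigma>1" "T2 = qexp ` \<Sigma>2"
    by (metis Un_upper1 Un_upper2 subset_imageE)
  then have "\<Sigma> = \<Sigma>1 \<union> \<Sigma>2"
    using T(1) inj_image_eq_iff[OF inj_qexp] by (metis image_Un)
  moreover have "\<Sigma>1 \<inter> \<Sigma>2 = {}" using T(2) S by auto
  ultimately show "\<exists>\<Sigma>1 \<Sigma>2. \<Sigma> = \<Sigma>1 \<union> \<Sigma>2 \<and> \<Sigma>1 \<inter> \<Sigma>2 = {} \<and> has_qubits \<Sigma>1 P \<and> has_qubits \<Sigma>2 Q"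
    using T S unfolding has_qubits_def by blast
next
  assume "\<exists>\<Sigma>1 \<Sigma>2. \<Sigma> = \<Sigma>1 \<union> \<Sigma>2 \<and> \<Sigma>1 \<inter> \<Sigma>2 = {} \<and> has_qubits \<Sigma>1 P \<and> has_qubits \<Sigma>2 Q"
  then show "has_qubits \<Sigma> (Par P Q)"
    unfolding has_qubits_def image_Un
    by (metis (no_types, lifting) image_Int[OF inj_qexp] image_Un image_empty proc_typed.typed_par)
qed

lemma has_qubits_ParI:
  "\<Sigma>1 \<inter> \<Sigma>2 = {} \<Longrightarrow> has_qubits \<Sigma>1 P \<Longrightarrow> has_qubits \<Sigma>2 Q \<Longrightarrow> has_qubits (\<Sigma>1 \<union> \<Sigma>2) (Par P Q)"
  by (auto simp: has_qubits_Par)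

lemma has_qubits_simps:
  "has_qubits \<Sigma> (Tau t P) \<longleftrightarrow> has_qubits \<Sigma> P"
  "has_qubits \<Sigma> (TauPair t t' P) \<longleftrightarrow> has_qubits \<Sigma> P"
  "has_qubits \<Sigma> (Restrict P c) \<longleftrightarrow> has_qubits \<Sigma> P"
  "has_qubits \<Sigma> (Choice P Q) \<longleftrightarrow> has_qubits \<Sigma> P \<and> has_qubits \<Sigma> Q"
  "has_qubits \<Sigma> (Cond e P Q) \<longleftrightarrow> exp_typed e TBool \<and> has_qubits \<Sigma> P \<and> has_qubits \<Sigma> Q"
  unfolding has_qubits_def by (auto elim!: proc_typedE intro: proc_typed.intros)

lemma closed_proc_simps:
  "closed_proc (Par P Q) \<longleftrightarrow> closed_proc P \<and> closed_proc Q"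
  "closed_proc (Restrict P c) \<longleftrightarrow> closed_proc P"
  "closed_proc (Tau t P) \<longleftrightarrow> closed_proc P"
  "closed_proc (TauPair t t' P) \<longleftrightarrow> closed_proc P"
  "closed_proc (Cond e P Q) \<longleftrightarrow> exp_fv e = {} \<and> closed_proc P \<and> closed_proc Q"
  "closed_proc (Choice P Q) \<longleftrightarrow> closed_proc P \<and> closed_proc Q"
  by (auto simp: closed_proc_def)

lemma has_qubits_subst_classical:
  assumes "has_qubits \<Sigma> P" "val_ty v = var_ty x"
  shows "has_qubits \<Sigma> (subst x v P)"
proof -
  have "EVar x \<notin> qexp ` \<Sigma>" by (auto simp: qexp_def)
  then show ?thesis
    using proc_typed_subst[of "qexp ` \<Sigma>" P v x] exp_subst_image_fresh[of "qexp ` \<Sigma>" P x v] assms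
    unfolding has_qubits_def by simp
qed

lemma exp_subst_qexp: "exp_subst x v (qexp q) = qexp q"
  by (simp add: qexp_def)

lemma exp_subst_qexp_image: "exp_subst x (QubitV q) ` (qexp ` \<Sigma> \<union> {EVar x}) = qexp ` insert q \<Sigma>"
  by (auto simp: image_image exp_subst_qexp) (auto simp: qexp_def)

lemma has_qubits_subst_qubit:
  assumes "proc_typed (qexp ` \<Sigma> \<union> {EVar x}) P" "var_ty x = TQubit"
  shows "has_qubits \<Sigma>' (subst x (QubitV q) P) \<longleftrightarrow> q \<notin> \<Sigma> \<and> \<Sigma>' = insert q \<Sigma>"
proof
  assume "has_qubits \<Sigma>' (subst x (QubitV q) P)"
  then have inj: "inj_on (exp_subst x (QubitV q)) (qexp ` \<Sigma> \<union> {EVar x})"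
    and eq: "qexp ` \<Sigma>' = qexp ` insert q \<Sigma>"
    using proc_typed_subst_inj[OF assms(1)] exp_subst_qexp_image unfolding has_qubits_def by metis+
  have "q \<notin> \<Sigma>"
  proof
    assume "q \<in> \<Sigma>"
    then have "qexp q = EVar x"
      using inj_onD[OF inj, of "qexp q" "EVar x"] by (auto simp: exp_subst_qexp) (auto simp: qexp_def)
    then show False by (simp add: qexp_def)
  qed
  then show "q \<notin> \<Sigma> \<and> \<Sigma>' = insert q \<Sigma>" using eq inj_image_eq_iff[OF inj_qexp] by metis
next
  assume *: "q \<notin> \<Sigma> \<and> \<Sigma>' = insert q \<Sigma>"
  have "inj_on (exp_subst x (QubitV q)) (qexp ` \<Sigma> \<union> {EVar x})"
    using * by (auto simp: inj_on_def exp_subst_qexp) (auto simp: qexp_def)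
  from proc_typed_subst[OF assms(1) _ this] show "has_qubits \<Sigma>' (subst x (QubitV q) P)"
    using * assms(2) exp_subst_qexp_image unfolding has_qubits_def by simp
qed

text \<open>Expressions do not count, so the size is invariant under substitution; as there is no
  recursion, every transition makes it smaller. Its use is to show that a component that has moved
  differs from what it was, which tells a move of the process from a move of its context.\<close>

fun psize :: "proc \<Rightarrow> nat" where
  "psize (Tau t P) = Suc (psize P)"
| "psize (TauPair t t' P) = Suc (psize P)"
| "psize (Apply t E es P) = Suc (psize P)"
| "psize (Measure t M es x P) = Suc (psize P)"
| "psize (Recv t c x P) = Suc (psize P)"
| "psize (Discard es) = 0"
| "psize (Send t c e P) = Suc (psize P)"
| "psize (Cond e P Q) = Suc (psize P + psize Q)"
| "psize (Choice P Q) = Suc (psize P + psize Q)"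
| "psize (Par P Q) = Suc (psize P + psize Q)"
| "psize (Restrict P c) = Suc (psize P)"

lemma psize_subst: "psize (subst x v P) = psize P"
  by (induction P) auto

section \<open>Transitions\<close>

fun owned_after :: "act \<Rightarrow> qubit set \<Rightarrow> qubit set" where
  "owned_after (Output c (QubitV q)) \<Sigma> = \<Sigma> - {q}"
| "owned_after (Input c (QubitV q)) \<Sigma> = insert q \<Sigma>"
| "owned_after \<mu> \<Sigma> = \<Sigma>"

lemma owned_after_Output: "owned_after (Output c v) \<Sigma> = (case v of QubitV q \<Rightarrow> \<Sigma> - {q} | _ \<Rightarrow> \<Sigma>)"
  by (cases v) auto

lemma owned_after_Input: "owned_after (Input c v) \<Sigma> = (case v of QubitV q \<Rightarrow> insert q \<Sigma> | _ \<Rightarrow> \<Sigma>)"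
  by (cases v) auto

lemma step_psize: "step (S, \<rho>, P) \<mu> s D \<Longrightarrow> (S', \<rho>', P') \<in> set_pmf D \<Longrightarrow> psize P' < psize P"
proof (induction "(S, \<rho>, P)" \<mu> s D arbitrary: P S' \<rho>' P' rule: step.induct)
  case (step_measure t M qs y P)
  then show ?case by (auto simp: psize_subst)
qed (fastforce simp: psize_subst map_proc_def)+

text \<open>No rule for a visible action reads or changes the state: communication only rewrites the
  process. Hence a communication of the context found next to one configuration is available next to
  all of them, whatever their states.\<close>

lemma step_visible:
  "step (S, \<rho>, P) \<mu> s D \<Longrightarrow> \<mu> \<noteq> Silent \<Longrightarrow>
    \<exists>P'. D = return_pmf (S, \<rho>, P') \<and> (\<forall>\<rho>'. step (S, \<rho>', P) \<mu> s (return_pmf (S, \<rho>', P')))"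
proof (induction "(S, \<rho>, P)" \<mu> s D arbitrary: P rule: step.induct)
  case (step_restrict P \<mu> s \<Delta> c)
  then obtain P' where "\<Delta> = return_pmf (S, \<rho>, P')" "\<forall>\<rho>'. step (S, \<rho>', P) \<mu> s (return_pmf (S, \<rho>', P'))" by auto
  moreover from this step_restrict have "step (S, \<rho>', Restrict P c) \<mu> s (return_pmf (S, \<rho>', Restrict P' c))" for \<rho>'
    using step.step_restrict[of S \<rho>' P \<mu> s "return_pmf (S, \<rho>', P')" c] by (simp add: map_proc_def)
  ultimately show ?case by (simp add: map_proc_def)
next
  case (step_par_left P \<mu> s \<Delta> Q)
  then obtain P' where "\<Delta> = return_pmf (S, \<rho>, P')" "\<forall>\<rho>'. step (S, \<rho>', P) \<mu> s (return_pmf (S, \<rho>', P'))" by auto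
  moreover from this step_par_left have "step (S, \<rho>', Par P Q) \<mu> s (return_pmf (S, \<rho>', Par P' Q))" for \<rho>'
    using step.step_par_left[of S \<rho>' P \<mu> s "return_pmf (S, \<rho>', P')" Q] by (simp add: map_proc_def)
  ultimately show ?case by (simp add: map_proc_def)
next
  case (step_par_right Q \<mu> s \<Delta> P)
  then obtain Q' where "\<Delta> = return_pmf (S, \<rho>, Q')" "\<forall>\<rho>'. step (S, \<rho>', Q) \<mu> s (return_pmf (S, \<rho>', Q'))" by auto
  moreover from this step_par_right have "step (S, \<rho>', Par P Q) \<mu> s (return_pmf (S, \<rho>', Par P Q'))" for \<rho>'
    using step.step_par_right[of S \<rho>' Q \<mu> s "return_pmf (S, \<rho>', Q')" P] by (simp add: map_proc_def)
  ultimately show ?case by (simp add: map_proc_def)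
qed (auto intro: step.intros)

lemma takes_from_Input:
  "has_qubits \<Sigma> Q \<Longrightarrow> takes_from Q \<mu> \<longleftrightarrow> (\<exists>c q. \<mu> = Input c (QubitV q) \<and> q \<in> \<Sigma>)"
  unfolding takes_from_def using has_qubits_unique by blast

text \<open>Substituting a name already in the type would merge it with the variable, so by
  \<open>has_qubits_subst_qubit\<close> the instance has no type. In a parallel composition
  \<open>takes_from\<close> excludes that the idle side owns \<open>q\<close>, so the moving side
  does and the induction applies.\<close>

lemma step_Input_owned:
  "step (S, \<rho>, P) (Input c (QubitV q)) s D \<Longrightarrow> has_qubits \<Sigma> P \<Longrightarrow> q \<in> \<Sigma> \<Longrightarrow>
    (S', \<rho>', P') \<in> set_pmf D \<Longrightarrow> \<not> has_qubits \<Sigma>' P'"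
proof (induction "(S, \<rho>, P)" "Input c (QubitV q)" s D arbitrary: P \<Sigma> S' \<rho>' P' \<Sigma>' rule: step.induct)
  case (step_recv t x P)
  then show ?case
    by (auto simp: has_qubits_def[of _ "Recv t c x P"] has_qubits_subst_qubit elim!: proc_typedE)
next
  case (step_par_left P s \<Delta> Q)
  from step_par_left.prems obtain P'' where P'': "P' = Par P'' Q" "(S', \<rho>', P'') \<in> set_pmf \<Delta>"
    by (auto simp: map_proc_def)
  from step_par_left.prems obtain \<Sigma>1 \<Sigma>2 where *: "\<Sigma> = \<Sigma>1 \<union> \<Sigma>2" "has_qubits \<Sigma>1 P" "has_qubits \<Sigma>2 Q"
    by (auto simp: has_qubits_Par)
  then have "q \<in> \<Sigma>1" using step_par_left by (auto simp: takes_from_Input)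
  then show ?case using step_par_left.hyps(2)[OF *(2) _ P''(2)] P''(1) by (auto simp: has_qubits_Par)
next
  case (step_par_right Q s \<Delta> P)
  from step_par_right.prems obtain Q'' where Q'': "P' = Par P Q''" "(S', \<rho>', Q'') \<in> set_pmf \<Delta>"
    by (auto simp: map_proc_def)
  from step_par_right.prems obtain \<Sigma>1 \<Sigma>2 where *: "\<Sigma> = \<Sigma>1 \<union> \<Sigma>2" "has_qubits \<Sigma>1 P" "has_qubits \<Sigma>2 Q"
    by (auto simp: has_qubits_Par)
  then have "q \<in> \<Sigma>2" using step_par_right by (auto simp: takes_from_Input)
  then show ?case using step_par_right.hyps(2)[OF *(3) _ Q''(2)] Q''(1) by (auto simp: has_qubits_Par)
next
  case (step_restrict P s \<Delta> d)
  then show ?case by (fastforce simp: has_qubits_simps map_proc_def)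
qed (auto simp: has_qubits_simps)

text \<open>Subject reduction, together with the fact that only owned qubits are sent. The latter is
  needed inside the induction: in a synchronisation a sent qubit belongs to the sender, hence by
  disjointness not to the receiver, and this is the freshness required of the reception.\<close>

lemma step_typed:
  "step (S, \<rho>, P) \<mu> s D \<Longrightarrow> has_qubits \<Sigma> P \<Longrightarrow> closed_proc P \<Longrightarrow>
    \<forall>c q. \<mu> = Input c (QubitV q) \<longrightarrow> q \<notin> \<Sigma> \<Longrightarrow>
    (\<forall>c q. \<mu> = Output c (QubitV q) \<longrightarrow> q \<in> \<Sigma>) \<and>
    (\<forall>S' \<rho>' P'. (S', \<rho>', P') \<in> set_pmf D \<longrightarrow> S' = S \<and> has_qubits (owned_after \<mu> \<Sigma>) P' \<and> closed_proc P')"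
proof (induction "(S, \<rho>, P)" \<mu> s D arbitrary: P \<Sigma> rule: step.induct)
  case (step_send e v t c P)
  show ?case
  proof (cases "chan_ty c = TQubit")
    case True
    then have typed: "exp_typed e TQubit" "e \<in> qexp ` \<Sigma>" "proc_typed (qexp ` \<Sigma> - {e}) P"
      using step_send.prems by (auto simp: has_qubits_def elim: proc_typedE)
    then obtain q where q: "e = qexp q" "q \<in> \<Sigma>" by auto
    moreover from this step_send.hyps have "v = QubitV q" by (auto simp: qexp_def elim: evaluates.cases)
    moreover have "qexp ` \<Sigma> - {qexp q} = qexp ` (\<Sigma> - {q})" using inj_qexp by (auto simp: inj_def)
    ultimately show ?thesis using typed step_send.prems by (auto simp: has_qubits_def closed_proc_def)
  next
    case False
    then have typed: "exp_typed e (chan_ty c)" "has_qubits \<Sigma> P"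
      using step_send.prems by (auto simp: has_qubits_def elim: proc_typedE)
    then have "val_ty v \<noteq> TQubit" using evaluates_typed[OF step_send.hyps] False by simp
    then show ?thesis using typed step_send.prems
      by (cases v) (auto simp: closed_proc_def)
  qed
next
  case (step_recv v c t x P)
  have closed: "closed_proc (subst x v P)" using step_recv.prems by (auto simp: closed_proc_def fv_subst)
  show ?case
  proof (cases v)
    case (QubitV q)
    then have "proc_typed (qexp ` \<Sigma> \<union> {EVar x}) P" "var_ty x = TQubit" "q \<notin> \<Sigma>"
      using step_recv by (auto simp: has_qubits_def elim: proc_typedE)
    then show ?thesis using closed QubitV by (auto simp: has_qubits_subst_qubit)
  next
    case (NatV n)
    then have "has_qubits \<Sigma> P" "var_ty x = val_ty v"
      using step_recv by (auto simp: has_qubits_def elim: proc_typedE)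
    then show ?thesis using closed NatV by (auto simp: has_qubits_subst_classical)
  next
    case (BoolV b)
    then have "has_qubits \<Sigma> P" "var_ty x = val_ty v"
      using step_recv by (auto simp: has_qubits_def elim: proc_typedE)
    then show ?thesis using closed BoolV by (auto simp: has_qubits_subst_classical)
  qed
next
  case (step_apply t E qs P)
  then show ?case by (auto simp: has_qubits_def closed_proc_def elim: proc_typedE)
next
  case (step_measure t M qs y P)
  then have "has_qubits \<Sigma> P" "var_ty y = TNat" by (auto simp: has_qubits_def elim: proc_typedE)
  then show ?case using step_measure
    by (auto simp: has_qubits_subst_classical closed_proc_def fv_subst)
next
  case (step_par_left P \<mu> s \<Delta> Q)
  from step_par_left.prems obtain \<Sigma>1 \<Sigma>2 where *: "\<Sigma> = \<Sigma>1 \<union> \<Sigma>2" "\<Sigma>1 \<inter> \<Sigma>2 = {}" "has_qubits \<Sigma>1 P" "has_qubits \<Sigma>2 Q"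
    by (auto simp: has_qubits_Par)
  have "closed_proc P" "\<forall>c q. \<mu> = Input c (QubitV q) \<longrightarrow> q \<notin> \<Sigma>1"
    using * step_par_left.prems by (auto simp: closed_proc_simps)
  note IH = step_par_left.hyps(2)[OF *(3) this]
  have "owned_after \<mu> \<Sigma> = owned_after \<mu> \<Sigma>1 \<union> \<Sigma>2" "owned_after \<mu> \<Sigma>1 \<inter> \<Sigma>2 = {}"
    using *(1,2) IH step_par_left.prems(3)
    by (cases \<mu>; auto simp: owned_after_Output owned_after_Input split: val.splits)+
  then have "has_qubits (owned_after \<mu> \<Sigma>) (Par P' Q)" if "(S', \<rho>', P') \<in> set_pmf \<Delta>" for S' \<rho>' P'
    using IH that *(4) has_qubits_ParI by metis
  then show ?case using IH *(1) step_par_left.prems(2)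
    by (auto simp: map_proc_def closed_proc_simps)
next
  case (step_par_right Q \<mu> s \<Delta> P)
  from step_par_right.prems obtain \<Sigma>1 \<Sigma>2 where *: "\<Sigma> = \<Sigma>1 \<union> \<Sigma>2" "\<Sigma>1 \<inter> \<Sigma>2 = {}" "has_qubits \<Sigma>1 P" "has_qubits \<Sigma>2 Q"
    by (auto simp: has_qubits_Par)
  have "closed_proc Q" "\<forall>c q. \<mu> = Input c (QubitV q) \<longrightarrow> q \<notin> \<Sigma>2"
    using * step_par_right.prems by (auto simp: closed_proc_simps)
  note IH = step_par_right.hyps(2)[OF *(4) this]
  have "owned_after \<mu> \<Sigma> = \<Sigma>1 \<union> owned_after \<mu> \<Sigma>2" "\<Sigma>1 \<inter> owned_after \<mu> \<Sigma>2 = {}"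
    using *(1,2) IH step_par_right.prems(3)
    by (cases \<mu>; auto simp: owned_after_Output owned_after_Input split: val.splits)+
  then have "has_qubits (owned_after \<mu> \<Sigma>) (Par P Q')" if "(S', \<rho>', Q') \<in> set_pmf \<Delta>" for S' \<rho>' Q'
    using IH that *(3) has_qubits_ParI by metis
  then show ?case using IH *(1) step_par_right.prems(2)
    by (auto simp: map_proc_def closed_proc_simps)
next
  case (step_sync_left P c v t P' Q t' Q')
  from step_sync_left.prems obtain \<Sigma>1 \<Sigma>2 where *: "\<Sigma> = \<Sigma>1 \<union> \<Sigma>2" "\<Sigma>1 \<inter> \<Sigma>2 = {}" "has_qubits \<Sigma>1 P" "has_qubits \<Sigma>2 Q"
    by (auto simp: has_qubits_Par)
  have "closed_proc P" "closed_proc Q" using step_sync_left.prems by (auto simp: closed_proc_simps)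
  note 1 = step_sync_left.hyps(2)[OF *(3) this(1), simplified]
  have "\<forall>d q. Input c v = Input d (QubitV q) \<longrightarrow> q \<notin> \<Sigma>2" using 1 *(2) by auto
  note 2 = step_sync_left.hyps(4)[OF *(4) \<open>closed_proc Q\<close> this, simplified]
  have "\<Sigma> = owned_after (Output c v) \<Sigma>1 \<union> owned_after (Input c v) \<Sigma>2"
    "owned_after (Output c v) \<Sigma>1 \<inter> owned_after (Input c v) \<Sigma>2 = {}"
    using *(1,2) 1 by (cases v; auto)+
  then have "has_qubits \<Sigma> (Par P' Q')" using 1 2 has_qubits_ParI by metis
  then show ?case using 1 2 by (auto simp: closed_proc_simps)
next
  case (step_sync_right P c v t P' Q t' Q')
  from step_sync_right.prems obtain \<Sigma>1 \<Sigma>2 where *: "\<Sigma> = \<Sigma>2 \<union> \<Sigma>1" "\<Sigma>2 \<inter> \<Sigma>1 = {}" "has_qubits \<Sigma>1 P" "has_qubits \<Sigma>2 Q"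
    by (auto simp: has_qubits_Par)
  have "closed_proc P" "closed_proc Q" using step_sync_right.prems by (auto simp: closed_proc_simps)
  note 1 = step_sync_right.hyps(2)[OF *(3) this(1), simplified]
  have "\<forall>d q. Input c v = Input d (QubitV q) \<longrightarrow> q \<notin> \<Sigma>2" using 1 *(2) by auto
  note 2 = step_sync_right.hyps(4)[OF *(4) \<open>closed_proc Q\<close> this, simplified]
  have "\<Sigma> = owned_after (Input c v) \<Sigma>2 \<union> owned_after (Output c v) \<Sigma>1"
    "owned_after (Input c v) \<Sigma>2 \<inter> owned_after (Output c v) \<Sigma>1 = {}"
    using *(1,2) 1 by (cases v; auto)+
  then have "has_qubits \<Sigma> (Par Q' P')" using 1 2 has_qubits_ParI by metis
  then show ?case using 1 2 by (auto simp: closed_proc_simps)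
next
  case (step_restrict P \<mu> s \<Delta> c)
  have "has_qubits \<Sigma> P" "closed_proc P"
    using step_restrict.prems by (auto simp: has_qubits_simps closed_proc_simps)
  note IH = step_restrict.hyps(2)[OF this step_restrict.prems(3)]
  then show ?case by (auto simp: map_proc_def has_qubits_simps closed_proc_simps)
next
  case (step_cond_true e P \<mu> s \<Delta> Q)
  have "has_qubits \<Sigma> P" "closed_proc P"
    using step_cond_true.prems by (auto simp: has_qubits_simps closed_proc_simps)
  then show ?case by (rule step_cond_true.hyps(3)[OF _ _ step_cond_true.prems(3)])
next
  case (step_cond_false e Q \<mu> s \<Delta> P)
  have "has_qubits \<Sigma> Q" "closed_proc Q"
    using step_cond_false.prems by (auto simp: has_qubits_simps closed_proc_simps)
  then show ?case by (rule step_cond_false.hyps(3)[OF _ _ step_cond_false.prems(3)])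
next
  case (step_choice_left P \<mu> s \<Delta> Q)
  have "has_qubits \<Sigma> P" "closed_proc P"
    using step_choice_left.prems by (auto simp: has_qubits_simps closed_proc_simps)
  then show ?case by (rule step_choice_left.hyps(2)[OF _ _ step_choice_left.prems(3)])
next
  case (step_choice_right Q \<mu> s \<Delta> P)
  have "has_qubits \<Sigma> Q" "closed_proc Q"
    using step_choice_right.prems by (auto simp: has_qubits_simps closed_proc_simps)
  then show ?case by (rule step_choice_right.hyps(2)[OF _ _ step_choice_right.prems(3)])
qed (auto simp: has_qubits_simps closed_proc_simps)

section \<open>States after an operation\<close>

lemma op_trace_prob_of:
  assumes "op_pos S X" "finite S"
  shows "op_trace S X = of_real (prob_of S X)" "0 \<le> prob_of S X"
  using op_pos_trace[OF assms] by (auto simp: complex_nonneg_Reals_iff prob_of_def complex_eq_iff)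

lemma density_normalised:
  assumes "finite S" "op_pos S X" "prob_of S X \<noteq> 0"
  shows "density_operator S (normalised S X)"
proof -
  have "normalised S X = (\<lambda>A B. X A B * of_real (1 / prob_of S X))"
    by (simp add: normalised_def fun_eq_iff)
  moreover have "op_trace S (normalised S X) = op_trace S X / of_real (prob_of S X)"
    by (simp add: op_trace_def normalised_def sum_divide_distrib)
  ultimately show ?thesis
    using assms op_trace_prob_of[OF assms(2,1)] op_pos_scale[OF assms(2), of "1 / prob_of S X"]
    by (simp add: density_operator_def)
qed

section \<open>Distributions as linear functionals\<close>

text \<open>The entry for \<open>\<bottom>\<close> counts 0, so a distribution becomes a subprobability functional that
  can be added and scaled freely.\<close>

definition expect :: "dist \<Rightarrow> (conf \<Rightarrow> real) \<Rightarrow> real" where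
  "expect \<Delta> \<phi> = (\<Sum>x\<in>set_pmf \<Delta>. pmf \<Delta> x * case_option 0 \<phi> x)"

lemma expect_eq_integral:
  "finite (set_pmf \<Delta>) \<Longrightarrow> expect \<Delta> \<phi> = measure_pmf.expectation \<Delta> (case_option 0 \<phi>)"
  by (simp add: expect_def integral_measure_pmf_real mult.commute)

lemma expect_return [simp]: "expect (return_pmf None) \<phi> = 0" "expect (return_pmf (Some C)) \<phi> = \<phi> C"
  by (simp_all add: expect_def)

lemma expect_cong: "(\<And>C. Some C \<in> set_pmf \<Delta> \<Longrightarrow> \<phi> C = \<psi> C) \<Longrightarrow> expect \<Delta> \<phi> = expect \<Delta> \<psi>"
  unfolding expect_def by (rule sum.cong[OF refl]) (auto split: option.split)

lemma expect_zero: "expect \<Delta> (\<lambda>C. 0) = 0"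
  unfolding expect_def by (rule sum.neutral) (auto split: option.split)

lemma expect_add: "expect \<Delta> (\<lambda>C. \<phi> C + \<psi> C) = expect \<Delta> \<phi> + expect \<Delta> \<psi>"
  unfolding expect_def sum.distrib[symmetric]
  by (rule sum.cong[OF refl]) (auto simp: distrib_left split: option.split)

lemma expect_mult: "expect \<Delta> (\<lambda>C. a * \<phi> C) = a * expect \<Delta> \<phi>"
  unfolding expect_def sum_distrib_left
  by (rule sum.cong[OF refl]) (auto split: option.split)

lemma expect_sum: "expect \<Delta> (\<lambda>C. \<Sum>i\<in>I. \<phi> i C) = (\<Sum>i\<in>I. expect \<Delta> (\<phi> i))"
  by (induction I rule: infinite_finite_induct) (simp_all add: expect_zero expect_add)

lemma expect_map:
  assumes "finite (set_pmf \<Delta>)"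
  shows "expect (map_pmf (map_option g) \<Delta>) \<phi> = expect \<Delta> (\<lambda>C. \<phi> (g C))"
proof -
  have "case_option 0 \<phi> (map_option g x) = case_option 0 (\<lambda>C. \<phi> (g C)) x" for x
    by (cases x) auto
  then show ?thesis using assms by (simp add: expect_eq_integral)
qed

lemma expect_map_Some:
  assumes "finite (set_pmf D)"
  shows "expect (map_pmf Some D) \<phi> = (\<Sum>C\<in>set_pmf D. pmf D C * \<phi> C)"
  using assms by (simp add: expect_eq_integral integral_measure_pmf_real mult.commute)

lemma expect_bind:
  assumes "finite (set_pmf M)" "\<And>x. x \<in> set_pmf M \<Longrightarrow> finite (set_pmf (F x))"
  shows "expect (bind_pmf M F) \<phi> = (\<Sum>x\<in>set_pmf M. pmf M x * expect (F x) \<phi>)"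
proof -
  have "expect (bind_pmf M F) \<phi> = measure_pmf.expectation (bind_pmf M F) (case_option 0 \<phi>)"
    using assms by (intro expect_eq_integral) (auto simp: set_bind_pmf)
  also have "\<dots> = (\<Sum>x\<in>set_pmf M. pmf M x *\<^sub>R measure_pmf.expectation (F x) (case_option 0 \<phi>))"
    using assms by (intro pmf_expectation_bind) auto
  also have "\<dots> = (\<Sum>x\<in>set_pmf M. pmf M x * expect (F x) \<phi>)"
    using assms(2) by (intro sum.cong refl) (simp add: expect_eq_integral)
  finally show ?thesis .
qed

lemma expect_one:
  assumes "finite (set_pmf \<Delta>)"
  shows "expect \<Delta> (\<lambda>C. 1) = mass \<Delta>"
proof -
  have "(\<Sum>x\<in>set_pmf \<Delta>. pmf \<Delta> x) = 1" using assms by (simp add: sum_pmf_eq_1)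
  moreover have "(\<Sum>x\<in>set_pmf \<Delta>. pmf \<Delta> x) =
      (\<Sum>x\<in>set_pmf \<Delta>. pmf \<Delta> x * case_option 0 (\<lambda>C. 1) x) + (\<Sum>x\<in>set_pmf \<Delta>. if x = None then pmf \<Delta> x else 0)"
    unfolding sum.distrib[symmetric] by (rule sum.cong[OF refl]) (auto split: option.split)
  moreover have "(\<Sum>x\<in>set_pmf \<Delta>. if x = None then pmf \<Delta> x else 0) = pmf \<Delta> None"
    using assms by (simp add: set_pmf_iff)
  ultimately show ?thesis by (simp add: expect_def mass_def)
qed

section \<open>Transitions as a function\<close>

lemma total_step_exists: "\<exists>D. total_step x \<mu> s D"
  using total_step_move total_step_stuck by (metis (mono_tags, lifting))

definition successor :: "conf option \<Rightarrow> act \<Rightarrow> sched \<Rightarrow> dist" where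
  "successor x \<mu> s = (SOME D. total_step x \<mu> s D)"

lemma successor: "total_step x \<mu> s (successor x \<mu> s)"
  unfolding successor_def using total_step_exists by (rule someI_ex)

lemma lift_dist_bind:
  assumes "finite (set_pmf \<Delta>)" "\<And>x. x \<in> set_pmf \<Delta> \<Longrightarrow> R x (F x)"
  shows "lift_dist R \<Delta> (bind_pmf \<Delta> F)"
  unfolding lift_dist_def
proof (intro exI conjI)
  let ?S = "set_pmf \<Delta>"
  \<comment> \<open>\<open>lift_dist\<close> indexes its convex combinations by natural numbers, so
    the finite support is enumerated.\<close>
  let ?w = "map_pmf (to_nat_on ?S) \<Delta>"
  have inv: "from_nat_into ?S (to_nat_on ?S x) = x" if "x \<in> ?S" for x
    using that assms(1) by (simp add: countable_finite)
  show "finite (set_pmf ?w)" using assms(1) by simp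
  show "\<Delta> = map_pmf (from_nat_into ?S) ?w"
    by (simp add: map_pmf_comp inv cong: map_pmf_cong)
  show "\<forall>i\<in>set_pmf ?w. R (from_nat_into ?S i) (F (from_nat_into ?S i))"
    using inv assms(2) by auto
  show "bind_pmf \<Delta> F = bind_pmf ?w (\<lambda>i. F (from_nat_into ?S i))"
    by (simp add: bind_map_pmf inv cong: bind_pmf_cong)
qed

text \<open>When \<open>R\<close> is functional on the support, the chosen convex combination no
  longer matters: repeated points get equal targets.\<close>

lemma lift_dist_unique:
  assumes "lift_dist R \<Delta> \<Theta>" "\<And>x D. x \<in> set_pmf \<Delta> \<Longrightarrow> R x D \<Longrightarrow> D = F x"
  shows "\<Theta> = bind_pmf \<Delta> F"
proof -
  from assms(1) obtain w :: "nat pmf" and x G where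
    w: "\<Delta> = map_pmf x w" "\<forall>i\<in>set_pmf w. R (x i) (G i)" "\<Theta> = bind_pmf w G"
    unfolding lift_dist_def by blast
  have "bind_pmf w G = bind_pmf w (\<lambda>i. F (x i))"
    using w assms(2) by (intro bind_pmf_cong refl) auto
  then show ?thesis using w by (simp add: bind_map_pmf)
qed

lemma lift_dist_nonempty: "lift_dist R \<Delta> \<Theta> \<Longrightarrow> \<exists>x\<in>set_pmf \<Delta>. \<exists>D. R x D"
  unfolding lift_dist_def by (metis (no_types, lifting) all_not_in_conv imageI pmf.set_map set_pmf_not_empty)

lemma lift_dist_finite: "lift_dist R \<Delta> \<Theta> \<Longrightarrow> finite (set_pmf \<Delta>)"
  unfolding lift_dist_def by auto

definition unique_successors :: "dist \<Rightarrow> bool" where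
  "unique_successors \<Delta> \<longleftrightarrow> (\<forall>x\<in>set_pmf \<Delta>. \<forall>\<mu> s D. total_step x \<mu> s D \<longrightarrow> D = successor x \<mu> s)"

definition next_dist :: "dist \<Rightarrow> act \<Rightarrow> sched pmf \<Rightarrow> dist" where
  "next_dist \<Delta> \<mu> \<delta> = bind_pmf \<Delta> (\<lambda>x. bind_pmf \<delta> (successor x \<mu>))"

text \<open>With unique successors the transition relation is the Kleisli extension of
  \<open>successor\<close> to both distributions. Finiteness of \<delta> remains as a condition
  because \<open>lift_dist\<close> uses finite combinations.\<close>

lemma dist_trans_iff:
  assumes "finite (set_pmf \<Delta>)" "unique_successors \<Delta>"
  shows "dist_trans \<Delta> \<mu> \<delta> \<Delta>' \<longleftrightarrow> finite (set_pmf \<delta>) \<and> \<Delta>' = next_dist \<Delta> \<mu> \<delta>"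
proof
  assume trans: "dist_trans \<Delta> \<mu> \<delta> \<Delta>'"
  then have "finite (set_pmf \<delta>)"
    unfolding dist_trans_def conf_trans_def by (metis lift_dist_finite lift_dist_nonempty)
  moreover have "\<Delta>' = next_dist \<Delta> \<mu> \<delta>"
    unfolding next_dist_def
  proof (rule lift_dist_unique[OF trans[unfolded dist_trans_def]])
    fix x D assume "x \<in> set_pmf \<Delta>" "conf_trans x \<mu> \<delta> D"
    then show "D = bind_pmf \<delta> (successor x \<mu>)"
      using assms(2) lift_dist_unique[of "total_step x \<mu>" \<delta> D "successor x \<mu>"]
      by (auto simp: conf_trans_def unique_successors_def)
  qed
  ultimately show "finite (set_pmf \<delta>) \<and> \<Delta>' = next_dist \<Delta> \<mu> \<delta>" by simp
next
  assume "finite (set_pmf \<delta>) \<and> \<Delta>' = next_dist \<Delta> \<mu> \<delta>"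
  then show "dist_trans \<Delta> \<mu> \<delta> \<Delta>'"
    unfolding dist_trans_def next_dist_def conf_trans_def
    using assms(1) by (auto intro!: lift_dist_bind successor)
qed

lemma total_step_None: "total_step None \<mu> s D \<longleftrightarrow> D = return_pmf None"
  by (auto elim: total_step.cases intro: total_step_stuck)

section \<open>Determinism as a property of single processes\<close>

lemma dist_trans_return:
  "total_step x \<mu> s D \<Longrightarrow> dist_trans (return_pmf x) \<mu> (return_pmf s) D"
  unfolding dist_trans_def conf_trans_def
  using lift_dist_bind[of "return_pmf x" "\<lambda>x. lift_dist (total_step x \<mu>) (return_pmf s)" "\<lambda>x. D"]
    lift_dist_bind[of "return_pmf s" "total_step x \<mu>" "\<lambda>s. D"]
  by (simp add: bind_return_pmf)

text \<open>The pointwise form of \<open>deterministically_tagged\<close>: it speaks of point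
  distributions only, and so it is inherited along the transitions of a single process.\<close>

definition well_tagged :: "proc \<Rightarrow> bool" where
  "well_tagged P \<longleftrightarrow> (\<forall>P' S \<rho>. proc_next\<^sup>*\<^sup>* P P' \<longrightarrow> well_typed (return_pmf (Some (S, \<rho>, P'))) \<longrightarrow>
     deterministic (return_pmf (Some (S, \<rho>, P'))) \<and> output_deterministic (return_pmf (Some (S, \<rho>, P'))))"

lemma well_tagged_next: "well_tagged P \<Longrightarrow> proc_next P P' \<Longrightarrow> well_tagged P'"
  unfolding well_tagged_def by (meson converse_rtranclp_into_rtranclp)

lemma well_typed_return_Some: "well_typed \<Delta> \<Longrightarrow> Some C \<in> set_pmf \<Delta> \<Longrightarrow> well_typed (return_pmf (Some C))"
proof -
  assume "well_typed \<Delta>" "Some C \<in> set_pmf \<Delta>"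
  then obtain \<Sigma> \<Sigma>' where "conf_typed \<Sigma> \<Sigma>' C" unfolding well_typed_def dist_typed_def by blast
  then have "dist_typed \<Sigma> \<Sigma>' (return_pmf (Some C))" by (simp add: dist_typed_def)
  then show ?thesis unfolding well_typed_def by blast
qed

lemma well_tagged_unique:
  assumes "well_tagged P" "well_typed (return_pmf (Some (S, \<rho>, P)))"
    "total_step (Some (S, \<rho>, P)) \<mu> s D"
  shows "D = successor (Some (S, \<rho>, P)) \<mu> s"
  using assms dist_trans_return[OF assms(3)] dist_trans_return[OF successor]
  unfolding well_tagged_def deterministic_def by blast

lemma unique_successorsI:
  assumes "\<forall>P\<in>procs \<Delta>. well_tagged P" "well_typed \<Delta>"
  shows "unique_successors \<Delta>"
  unfolding unique_successors_def
proof (intro ballI allI impI)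
  fix x \<mu> s D assume x: "x \<in> set_pmf \<Delta>" and D: "total_step x \<mu> s D"
  show "D = successor x \<mu> s"
  proof (cases x)
    case None
    then show ?thesis using D successor[of x \<mu> s] by (simp add: total_step_None)
  next
    case (Some C)
    obtain S \<rho> P where C: "C = (S, \<rho>, P)" by (cases C)
    then have "well_tagged P" using x Some assms(1) by (auto simp: procs_def)
    then show ?thesis
      using well_tagged_unique well_typed_return_Some[OF assms(2)] D x unfolding Some C by blast
  qed
qed

text \<open>Transitions of a distribution are assembled from those of its points, so determinism at
  the points carries over to the distribution; conversely, point distributions are among those
  quantified over.\<close>

lemma deterministically_tagged_iff: "deterministically_tagged \<Delta> \<longleftrightarrow> (\<forall>P\<in>procs \<Delta>. well_tagged P)"
proof
  assume dt: "deterministically_tagged \<Delta>"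
  show "\<forall>P\<in>procs \<Delta>. well_tagged P"
    unfolding well_tagged_def
  proof (intro ballI allI impI)
    fix P P' S \<rho>
    assume *: "P \<in> procs \<Delta>" "proc_next\<^sup>*\<^sup>* P P'" "well_typed (return_pmf (Some (S, \<rho>, P')))"
    have "procs (return_pmf (Some (S, \<rho>, P'))) = {P'}" by (auto simp: procs_def)
    with * have "\<forall>Q\<in>procs (return_pmf (Some (S, \<rho>, P'))). \<exists>P\<in>procs \<Delta>. proc_next\<^sup>*\<^sup>* P Q" by auto
    with * show "deterministic (return_pmf (Some (S, \<rho>, P'))) \<and> output_deterministic (return_pmf (Some (S, \<rho>, P')))"
      using dt[unfolded deterministically_tagged_def, rule_format, of "return_pmf (Some (S, \<rho>, P'))"] by blast
  qed
next
  assume ok: "\<forall>P\<in>procs \<Delta>. well_tagged P"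
  show "deterministically_tagged \<Delta>"
    unfolding deterministically_tagged_def
  proof (intro allI impI, elim conjE)
    fix \<Theta> assume wt: "well_typed \<Theta>" and reach: "\<forall>P'\<in>procs \<Theta>. \<exists>P\<in>procs \<Delta>. proc_next\<^sup>*\<^sup>* P P'"
    have tagged: "well_tagged P'" if P': "P' \<in> procs \<Theta>" for P'
    proof -
      from reach P' ok obtain P where "well_tagged P" "proc_next\<^sup>*\<^sup>* P P'" by blast
      then show ?thesis unfolding well_tagged_def by (meson rtranclp_trans)
    qed
    have "finite (set_pmf \<Theta>)" using wt by (auto simp: well_typed_def dist_typed_def)
    moreover have "unique_successors \<Theta>" using tagged wt by (intro unique_successorsI) auto
    ultimately have "deterministic \<Theta>" unfolding deterministic_def by (simp add: dist_trans_iff)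
    moreover have "output_deterministic \<Theta>"
      unfolding output_deterministic_def
    proof (intro allI impI)
      fix C s c v c' v' D D'
      assume C: "Some C \<in> set_pmf \<Theta>" and st: "typed_step C (Output c v) s D" "typed_step C (Output c' v') s D'"
      obtain S \<rho> P where P: "C = (S, \<rho>, P)" by (cases C)
      with C have "well_tagged P" using tagged by (auto simp: procs_def)
      then have "output_deterministic (return_pmf (Some C))"
        using well_typed_return_Some[OF wt C] unfolding P well_tagged_def by blast
      then show "c = c' \<and> v = v'" using st by (force simp: output_deterministic_def)
    qed
    ultimately show "deterministic \<Theta> \<and> output_deterministic \<Theta>" by simp
  qed
qed

lemma successor_move:
  assumes "well_tagged P" "typed_step (S, \<rho>, P) \<mu> s D"
  shows "successor (Some (S, \<rho>, P)) \<mu> s = map_pmf Some D"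
  using well_tagged_unique[OF assms(1) _ total_step_move[OF assms(2)]] assms(2) by (simp add: typed_step_def)

lemma successor_stuck:
  assumes "\<nexists>D. typed_step C \<mu> s D"
  shows "successor (Some C) \<mu> s = return_pmf None"
  using successor[of "Some C" \<mu> s] assms by (auto elim: total_step.cases)

lemma successor_None [simp]: "successor None \<mu> s = return_pmf None"
  using successor[of None \<mu> s] by (simp add: total_step_None)

lemma successor_cases:
  obtains D where "typed_step C \<mu> s D" "successor (Some C) \<mu> s = map_pmf Some D"
  | "\<nexists>D. typed_step C \<mu> s D" "successor (Some C) \<mu> s = return_pmf None"
  using successor[of "Some C" \<mu> s] by (auto elim: total_step.cases)

lemma finite_successor: "finite (set_pmf (successor x \<mu> s))"
proof (cases x)
  case (Some C)
  show ?thesis unfolding Some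
    by (cases rule: successor_cases[of C \<mu> s])
      (auto simp: typed_step_def well_typed_def dist_typed_def)
qed simp

section \<open>Typing of transitions\<close>

lemma well_typed_Some: "well_typed (return_pmf (Some C)) \<longleftrightarrow> (\<exists>\<Sigma> \<Sigma>'. conf_typed \<Sigma> \<Sigma>' C)"
  by (auto simp: well_typed_def dist_typed_def)

text \<open>\<open>typed_step\<close> only asserts that the target has some type. Uniqueness of
  types identifies it with the one given by subject reduction; reception of an owned qubit, which
  subject reduction does not cover, would leave the target without a type.\<close>

lemma typed_step_typed:
  assumes "typed_step (S, \<rho>, P) \<mu> s D" "conf_typed \<Sigma> \<Sigma>' (S, \<rho>, P)"
  shows "dist_typed \<Sigma> (owned_after \<mu> \<Sigma>') (map_pmf Some D)"
    "\<mu> = Input c (QubitV q) \<Longrightarrow> q \<notin> \<Sigma>'"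
    "\<mu> = Output c (QubitV q) \<Longrightarrow> q \<in> \<Sigma>'"
proof -
  have st: "step (S, \<rho>, P) \<mu> s D" and P: "has_qubits \<Sigma>' P" "closed_proc P" and S: "S = \<Sigma>"
    and wt: "well_typed (map_pmf Some D)"
    using assms by (auto simp: typed_step_def)
  from wt obtain T T' where T: "dist_typed T T' (map_pmf Some D)" by (auto simp: well_typed_def)
  have input: "\<forall>c q. \<mu> = Input c (QubitV q) \<longrightarrow> q \<notin> \<Sigma>'"
  proof (intro allI impI notI)
    fix c q assume mu: "\<mu> = Input c (QubitV q)" and q: "q \<in> \<Sigma>'"
    obtain S' \<rho>' P' where C: "(S', \<rho>', P') \<in> set_pmf D"
      using set_pmf_not_empty[of D] by (metis all_not_in_conv prod_cases3)
    then have "has_qubits T' P'" using T by (auto simp: dist_typed_def)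
    then show False using step_Input_owned[OF st[unfolded mu] P(1) q C] by blast
  qed
  note * = step_typed[OF st P input]
  show "\<mu> = Input c (QubitV q) \<Longrightarrow> q \<notin> \<Sigma>'" using input by blast
  show "\<mu> = Output c (QubitV q) \<Longrightarrow> q \<in> \<Sigma>'" using * by blast
  show "dist_typed \<Sigma> (owned_after \<mu> \<Sigma>') (map_pmf Some D)"
    unfolding dist_typed_def
  proof (intro conjI allI impI)
    show "finite (set_pmf (map_pmf Some D))" using T by (simp add: dist_typed_def)
    fix C assume C: "Some C \<in> set_pmf (map_pmf Some D)"
    obtain S' \<rho>' P' where C': "C = (S', \<rho>', P')" by (cases C)
    have 1: "S' = S" "has_qubits (owned_after \<mu> \<Sigma>') P'" "closed_proc P'" using * C unfolding C' by auto
    have 2: "conf_typed T T' (S', \<rho>', P')" using T C unfolding C' dist_typed_def by auto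
    then have "T' = owned_after \<mu> \<Sigma>'" using 1(2) has_qubits_unique by auto
    then show "conf_typed \<Sigma> (owned_after \<mu> \<Sigma>') C" using 1 2 S C' by auto
  qed
qed

lemma conf_typed_unique:
  "conf_typed \<Sigma> \<Sigma>' C \<Longrightarrow> conf_typed T T' C \<Longrightarrow> T = \<Sigma> \<and> T' = \<Sigma>'"
  using has_qubits_unique by (cases C) auto

lemma successor_typed:
  assumes "conf_typed \<Sigma> \<Sigma>' C"
  shows "dist_typed \<Sigma> (owned_after \<mu> \<Sigma>') (successor (Some C) \<mu> s)"
proof (cases rule: successor_cases[of C \<mu> s])
  case (1 D)
  then show ?thesis using typed_step_typed(1) assms by (metis prod_cases3)
qed (simp add: dist_typed_def)

lemma successor_procs:
  assumes "Some (S', \<rho>', P') \<in> set_pmf (successor (Some (S, \<rho>, P)) \<mu> s)"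
  shows "proc_next P P'"
proof (cases rule: successor_cases[of "(S, \<rho>, P)" \<mu> s])
  case (1 D)
  then show ?thesis using assms unfolding proc_next_def by (metis (no_types, lifting) imageE option.inject pmf.set_map)
qed (use assms in simp)

lemma set_next_dist:
  "set_pmf (next_dist \<Delta> \<mu> \<delta>) = (\<Union>x\<in>set_pmf \<Delta>. \<Union>s\<in>set_pmf \<delta>. set_pmf (successor x \<mu> s))"
  by (simp add: next_dist_def)

lemma next_dist_typed:
  assumes "dist_typed \<Sigma> \<Sigma>' \<Delta>" "finite (set_pmf \<delta>)"
  shows "dist_typed \<Sigma> (owned_after \<mu> \<Sigma>') (next_dist \<Delta> \<mu> \<delta>)"
  unfolding dist_typed_def
proof (intro conjI allI impI)
  show "finite (set_pmf (next_dist \<Delta> \<mu> \<delta>))"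
    using assms by (auto simp: set_next_dist dist_typed_def finite_successor)
  fix C assume "Some C \<in> set_pmf (next_dist \<Delta> \<mu> \<delta>)"
  then obtain x s where x: "x \<in> set_pmf \<Delta>" "Some C \<in> set_pmf (successor x \<mu> s)"
    by (auto simp: set_next_dist)
  then obtain C' where "x = Some C'" by (cases x) auto
  with x show "conf_typed \<Sigma> (owned_after \<mu> \<Sigma>') C"
    using assms(1) successor_typed unfolding dist_typed_def by blast
qed

lemma next_dist_procs:
  assumes "P' \<in> procs (next_dist \<Delta> \<mu> \<delta>)"
  shows "\<exists>P\<in>procs \<Delta>. proc_next P P'"
proof -
  from assms obtain S' \<rho>' x s where x: "x \<in> set_pmf \<Delta>" "Some (S', \<rho>', P') \<in> set_pmf (successor x \<mu> s)"
    by (auto simp: procs_def set_next_dist)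
  then obtain S \<rho> P where "x = Some (S, \<rho>, P)" by (cases x) auto
  with x show ?thesis using successor_procs by (fastforce simp: procs_def)
qed

text \<open>A move acts on functionals by replacing the test function with its expected value after
  the step. \<bottom> contributes nothing, since its only successor is \<bottom>; so the action is
  linear.\<close>

lemma expect_next_dist:
  assumes "finite (set_pmf \<Delta>)" "finite (set_pmf \<delta>)"
  shows "expect (next_dist \<Delta> \<mu> \<delta>) \<phi> =
    (\<Sum>s\<in>set_pmf \<delta>. pmf \<delta> s * expect \<Delta> (\<lambda>C. expect (successor (Some C) \<mu> s) \<phi>))"
proof -
  have "expect (next_dist \<Delta> \<mu> \<delta>) \<phi> = (\<Sum>x\<in>set_pmf \<Delta>. pmf \<Delta> x * expect (bind_pmf \<delta> (successor x \<mu>)) \<phi>)"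
    unfolding next_dist_def using assms by (intro expect_bind) (auto simp: finite_successor)
  also have "\<dots> = (\<Sum>x\<in>set_pmf \<Delta>. pmf \<Delta> x *
      case_option 0 (\<lambda>C. \<Sum>s\<in>set_pmf \<delta>. pmf \<delta> s * expect (successor (Some C) \<mu> s) \<phi>) x)"
    using assms by (intro sum.cong refl) (auto simp: expect_bind finite_successor split: option.split)
  also have "\<dots> = expect \<Delta> (\<lambda>C. \<Sum>s\<in>set_pmf \<delta>. pmf \<delta> s * expect (successor (Some C) \<mu> s) \<phi>)"
    unfolding expect_def[of \<Delta>] ..
  finally show ?thesis unfolding expect_sum expect_mult .
qed

lemma pmf_embed_finite:
  assumes "finite A" "\<And>x. 0 \<le> f x" "\<And>x. x \<notin> A \<Longrightarrow> f x = 0" "sum f A = 1"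
  shows "pmf (embed_pmf f) x = f x"
proof (rule pmf_embed_pmf)
  have "(\<integral>\<^sup>+ x. ennreal (f x) \<partial>count_space UNIV) = (\<Sum>x\<in>A. ennreal (f x))"
    using assms by (intro nn_integral_count_space') auto
  also have "\<dots> = 1" using assms by (simp add: sum_ennreal)
  finally show "(\<integral>\<^sup>+ x. ennreal (f x) \<partial>count_space UNIV) = 1" .
qed (use assms in auto)

section \<open>Instruments\<close>

text \<open>All moves of a process act on the state by an instrument: an application has one outcome, and a
  move that leaves the state alone applies the identity on no qubits.\<close>

definition instrument :: "nat \<Rightarrow> nat set \<Rightarrow> (nat \<Rightarrow> operator list) \<Rightarrow> bool" where
  "instrument n I Ks \<longleftrightarrow> finite I \<and> (\<forall>m\<in>I. \<forall>K\<in>set (Ks m). operator_on {..<n} K) \<and>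
     (\<lambda>A B. \<Sum>m\<in>I. kraus_gram {..<n} (Ks m) A B) = op_id {..<n}"

lemma nth_inj_image:
  assumes "distinct qs"
  shows "inj_on (\<lambda>i. qs ! i) {..<length qs}" "(\<lambda>i. qs ! i) ` {..<length qs} = set qs"
  using assms by (auto simp: inj_on_nth set_conv_nth)

definition branch :: "qubit set \<Rightarrow> qubit list \<Rightarrow> operator list \<Rightarrow> operator \<Rightarrow> operator" where
  "branch S qs Ks = superop_tuple S qs (kraus {..<length qs} Ks)"

lemma branch_kraus:
  assumes "finite S" "distinct qs" "set qs \<subseteq> S"
  shows "branch S qs Ks = kraus S (map (op_lift S {..<length qs} (\<lambda>i. qs ! i)) Ks)"
  using assms nth_inj_image[OF assms(2)] unfolding branch_def superop_tuple_def
  by (intro superop_on_kraus) auto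

lemma branch_pos:
  assumes "finite S" "distinct qs" "set qs \<subseteq> S" "density_operator S \<rho>"
  shows "op_pos S (branch S qs Ks \<rho>)"
  unfolding branch_kraus[OF assms(1-3)] using assms(4)
  by (intro op_pos_kraus) (auto simp: operator_on_lift density_operator_def)

lemma branch_prob_sum:
  assumes "finite S" "distinct qs" "set qs \<subseteq> S" "density_operator S \<rho>" "instrument (length qs) I Ks"
  shows "(\<Sum>m\<in>I. prob_of S (branch S qs (Ks m) \<rho>)) = 1"
proof -
  let ?L = "op_lift S {..<length qs} (\<lambda>i. qs ! i)"
  note inj = nth_inj_image[OF assms(2)]
  have sub: "(\<lambda>i. qs ! i) ` {..<length qs} \<subseteq> S" using inj(2) assms(3) by simp
  have "(\<lambda>A B. \<Sum>m\<in>I. kraus_gram S (map ?L (Ks m)) A B) =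
      ?L (\<lambda>A B. \<Sum>m\<in>I. kraus_gram {..<length qs} (Ks m) A B)"
    unfolding op_lift_sum kraus_gram_lift[OF assms(1) inj(1) sub] ..
  also have "\<dots> = op_id S"
    using assms(5) op_lift_id[OF inj(1) sub] by (simp add: instrument_def)
  finally have "(\<Sum>m\<in>I. op_trace S (branch S qs (Ks m) \<rho>)) = op_trace S \<rho>"
    unfolding branch_kraus[OF assms(1-3)] by (intro sum_op_trace_kraus[OF assms(1)])
  then show ?thesis
    using assms(4) unfolding prob_of_def density_operator_def by (metis Re_sum one_complex.sel(1))
qed

text \<open>Subtracting one Gram matrix from the identity leaves the sum of the others, which is
  positive. So a single outcome of the context is among the operations that labelled bisimulation
  admits.\<close>

lemma instrument_nonincreasing:
  assumes "instrument n I Ks" "m \<in> I"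
  shows "loewner_le {..<n} (kraus_gram {..<n} (Ks m)) (op_id {..<n})"
proof -
  have "op_id {..<n} A B - kraus_gram {..<n} (Ks m) A B =
      (\<Sum>i\<in>I - {m}. kraus_gram {..<n} (Ks i) A B)" for A B
  proof -
    have "op_id {..<n} A B = (\<Sum>m\<in>I. kraus_gram {..<n} (Ks m) A B)"
      using assms(1) unfolding instrument_def by metis
    also have "\<dots> = kraus_gram {..<n} (Ks m) A B + (\<Sum>i\<in>I - {m}. kraus_gram {..<n} (Ks i) A B)"
      using assms by (intro sum.remove) (auto simp: instrument_def)
    finally show ?thesis by simp
  qed
  moreover have "op_pos {..<n} (\<lambda>A B. \<Sum>i\<in>I - {m}. kraus_gram {..<n} (Ks i) A B)"
    using assms by (intro op_pos_sum op_pos_kraus_gram) (auto simp: instrument_def)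
  ultimately show ?thesis by (simp add: loewner_le_def)
qed

text \<open>The Kraus families and the residuals \<open>R m\<close> are the same for all states;
  only the weights depend on \<rho>. An outcome of probability 0 lies outside the support of
  \<open>W\<close>, so its meaningless normalisation does no harm.\<close>

definition realises :: "qubit set \<Rightarrow> proc \<Rightarrow> act \<Rightarrow> sched \<Rightarrow> qubit list \<Rightarrow> nat set \<Rightarrow>
    (nat \<Rightarrow> operator list) \<Rightarrow> (nat \<Rightarrow> proc) \<Rightarrow> bool" where
  "realises S Q \<mu> s qs I Ks R \<longleftrightarrow> (\<forall>\<rho>. density_operator S \<rho> \<longrightarrow>
     (\<exists>W. (\<forall>m. pmf W m = (if m \<in> I then prob_of S (branch S qs (Ks m) \<rho>) else 0)) \<and>
       step (S, \<rho>, Q) \<mu> s (map_pmf (\<lambda>m. (S, normalised S (branch S qs (Ks m) \<rho>), R m)) W)))"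

lemma realises_map:
  assumes "realises S Q \<mu> s qs I Ks R"
    "\<And>\<rho> D. step (S, \<rho>, Q) \<mu> s D \<Longrightarrow> step (S, \<rho>, Q') \<mu> s (map_pmf (map_proc f) D)"
  shows "realises S Q' \<mu> s qs I Ks (\<lambda>m. f (R m))"
  unfolding realises_def
proof (intro allI impI)
  fix \<rho> assume "density_operator S \<rho>"
  with assms(1) obtain W where W: "\<forall>m. pmf W m = (if m \<in> I then prob_of S (branch S qs (Ks m) \<rho>) else 0)"
    "step (S, \<rho>, Q) \<mu> s (map_pmf (\<lambda>m. (S, normalised S (branch S qs (Ks m) \<rho>), R m)) W)"
    unfolding realises_def by blast
  from assms(2)[OF W(2)] W(1)
  show "\<exists>W. (\<forall>m. pmf W m = (if m \<in> I then prob_of S (branch S qs (Ks m) \<rho>) else 0)) \<and>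
       step (S, \<rho>, Q') \<mu> s (map_pmf (\<lambda>m. (S, normalised S (branch S qs (Ks m) \<rho>), f (R m))) W)"
    by (intro exI[of _ W]) (simp add: map_pmf_comp map_proc_def)
qed

lemma realises_mono:
  assumes "realises S Q \<mu> s qs I Ks R" "\<And>\<rho> D. step (S, \<rho>, Q) \<mu> s D \<Longrightarrow> step (S, \<rho>, Q') \<mu> s D"
  shows "realises S Q' \<mu> s qs I Ks R"
  using assms unfolding realises_def by blast

lemma realises_single:
  assumes "finite S" "distinct qs" "set qs \<subseteq> S" "instrument (length qs) {0} (\<lambda>m. Ks)"
    "\<And>\<rho>. density_operator S \<rho> \<Longrightarrow> step (S, \<rho>, Q) \<mu> s (return_pmf (S, branch S qs Ks \<rho>, Q'))"
  shows "realises S Q \<mu> s qs {0} (\<lambda>m. Ks) (\<lambda>m. Q')"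
  unfolding realises_def
proof (intro allI impI exI conjI)
  fix \<rho> assume \<rho>: "density_operator S \<rho>"
  \<comment> \<open>A single outcome has probability 1, so the normalisation in
    \<open>realises\<close> divides by 1.\<close>
  have p: "prob_of S (branch S qs Ks \<rho>) = 1"
    using branch_prob_sum[OF assms(1-3) \<rho> assms(4)] by simp
  then show "pmf (return_pmf 0) m = (if m \<in> {0} then prob_of S (branch S qs Ks \<rho>) else 0)" for m :: nat
    by (simp add: pmf_return)
  show "step (S, \<rho>, Q) \<mu> s (map_pmf (\<lambda>m. (S, normalised S (branch S qs Ks \<rho>), Q')) (return_pmf 0))"
    using assms(5)[OF \<rho>] p by (simp add: normalised_def)
qed

lemma kraus_id:
  assumes "finite S" "operator_on S \<rho>"
  shows "kraus S [op_id S] \<rho> = \<rho>"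
proof (intro ext)
  fix A B
  have left: "op_mult S (op_id S) \<rho> = \<rho>"
  proof (intro ext)
    fix A C
    have "op_mult S (op_id S) \<rho> A C = (\<Sum>B\<in>Pow S. if B = A then \<rho> A C else 0)"
      unfolding op_mult_def by (rule sum.cong[OF refl]) (auto simp: op_id_def)
    then show "op_mult S (op_id S) \<rho> A C = \<rho> A C" using assms by (auto simp: operator_on_def)
  qed
  have "op_mult S \<rho> (op_adj (op_id S)) A B = (\<Sum>C\<in>Pow S. if C = B then \<rho> A B else 0)"
    unfolding op_mult_def by (rule sum.cong[OF refl]) (auto simp: op_id_def op_adj_def)
  then show "kraus S [op_id S] \<rho> A B = \<rho> A B"
    using assms left by (auto simp: kraus_def conjugation_def operator_on_def)
qed

lemma realises_identity:
  assumes "finite S" "\<And>\<rho>. step (S, \<rho>, Q) \<mu> s (return_pmf (S, \<rho>, Q'))"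
  shows "\<exists>I Ks R. instrument 0 I Ks \<and> realises S Q \<mu> s [] I Ks R"
proof -
  have inst: "instrument (length []) {0} (\<lambda>m. [op_id {}])"
    by (auto simp: instrument_def operator_on_def kraus_gram_def op_mult_def op_adj_def op_id_def fun_eq_iff)
  have "branch S [] [op_id {}] \<rho> = \<rho>" if "density_operator S \<rho>" for \<rho>
    using assms(1) that op_lift_id[of "(!) []" "{}" S]
    by (simp add: branch_kraus kraus_id density_operator_def op_pos_def)
  then have "realises S Q \<mu> s [] {0} (\<lambda>m. [op_id {}]) (\<lambda>m. Q')"
    using assms inst by (intro realises_single) simp_all
  then show ?thesis using inst by auto
qed

lemma has_qubits_tuple:
  assumes "distinct (map qexp qs)" "set (map qexp qs) \<subseteq> qexp ` \<Sigma>"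
  shows "distinct qs" "set qs \<subseteq> \<Sigma>"
  using assms by (simp_all add: distinct_map inj_image_subset_iff[OF inj_qexp])

text \<open>Which rule applies depends on the process and the register, never on \<rho>: a move
  found in one state exists in every state, with the same instrument. This makes the moves of the
  context independent of the configuration in the hole.\<close>

lemma step_realises:
  assumes "finite S"
  shows "step (S, \<rho>, Q) \<mu> s D \<Longrightarrow> has_qubits \<Sigma> Q \<Longrightarrow> \<Sigma> \<subseteq> S \<Longrightarrow>
    \<exists>qs I Ks R. distinct qs \<and> set qs \<subseteq> \<Sigma> \<and> instrument (length qs) I Ks \<and> realises S Q \<mu> s qs I Ks R"
proof (induction "(S, \<rho>, Q)" \<mu> s D arbitrary: Q \<Sigma> rule: step.induct)
  case (step_tau P t)
  from realises_identity[OF assms step.step_tau, of P t]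
  show ?case by (intro exI[of _ "[]"]) simp
next
  case (step_tau_pair P t t')
  from realises_identity[OF assms step.step_tau_pair, of P t t']
  show ?case by (intro exI[of _ "[]"]) simp
next
  case (step_send e v t c P)
  from realises_identity[OF assms step.step_send[OF step_send.hyps(1)], of t c P]
  show ?case by (intro exI[of _ "[]"]) simp
next
  case (step_recv v c t x P)
  from realises_identity[OF assms step.step_recv[OF step_recv.hyps(1,2)], of t x P]
  show ?case by (intro exI[of _ "[]"]) simp
next
  case (step_apply t E qs P)
  then have *: "distinct (map qexp qs)" "set (map qexp qs) \<subseteq> qexp ` \<Sigma>" "trace_preserving {..<length qs} E"
    unfolding has_qubits_def by (auto elim!: proc_typedE)
  note qs = has_qubits_tuple[OF *(1,2)]
  from *(3) obtain Ks where Ks: "\<forall>K\<in>set Ks. operator_on {..<length qs} K"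
    "kraus_gram {..<length qs} Ks = op_id {..<length qs}" "E = kraus {..<length qs} Ks"
    unfolding trace_preserving_def by blast
  then have inst: "instrument (length qs) {0} (\<lambda>m. Ks)" by (simp add: instrument_def)
  have "realises S (Apply t E (map qexp qs) P) Silent (Tag t) qs {0} (\<lambda>m. Ks) (\<lambda>m. P)"
    using qs step_apply.prems step.step_apply[of S _ t E qs P]
    by (intro realises_single[OF assms _ _ inst]) (auto simp: branch_def Ks(3))
  then show ?case using qs inst by blast
next
  case (step_measure t M qs y P)
  then have *: "distinct (map qexp qs)" "set (map qexp qs) \<subseteq> qexp ` \<Sigma>" "is_measurement {..<length qs} M"
    unfolding has_qubits_def by (auto elim!: proc_typedE)
  note qs = has_qubits_tuple[OF *(1,2)]
  \<comment> \<open>Outside \<open>dom M\<close> the operator is unspecified, but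
    \<open>dom M\<close> is the index set of the instrument.\<close>
  define Ks where "Ks = (\<lambda>m. [the (M m)])"
  have inst: "instrument (length qs) (dom M) Ks"
    using *(3) by (simp add: instrument_def is_measurement_def Ks_def kraus_gram_def)
  have "realises S (Measure t M (map qexp qs) y P) Silent (Tag t) qs (dom M) Ks (\<lambda>m. subst y (NatV m) P)"
    unfolding realises_def
  proof (intro allI impI exI conjI)
    fix \<rho> assume \<rho>: "density_operator S \<rho>"
    have kraus1: "kraus {..<length qs} [K] = conjugation {..<length qs} K" for K
      by (simp add: kraus_def fun_eq_iff)
    have out: "outcome_state S qs M m \<rho> = (if m \<in> dom M then branch S qs (Ks m) \<rho> else (\<lambda>A B. 0))" for m
      by (auto simp: outcome_state_def branch_def Ks_def kraus1 split: option.split)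
    have S: "set qs \<subseteq> S" using qs step_measure.prems by auto
    show pmf: "pmf (outcomes S qs M \<rho>) m = (if m \<in> dom M then prob_of S (branch S qs (Ks m) \<rho>) else 0)" for m
    proof -
      let ?f = "\<lambda>m. prob_of S (outcome_state S qs M m \<rho>)"
      have f: "?f m = (if m \<in> dom M then prob_of S (branch S qs (Ks m) \<rho>) else 0)" for m
        by (simp add: out prob_of_def op_trace_def)
      have "pmf (outcomes S qs M \<rho>) m = ?f m"
        unfolding outcomes_def
      proof (rule pmf_embed_finite[of "dom M"])
        show "finite (dom M)" using inst by (simp add: instrument_def)
        show "0 \<le> ?f m" for m
          using op_trace_prob_of(2)[OF branch_pos[OF assms qs(1) S \<rho>] assms] by (simp add: f)
        show "sum ?f (dom M) = 1"
          using branch_prob_sum[OF assms qs(1) S \<rho> inst] by (simp add: f)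
      qed (simp add: f)
      then show ?thesis by (simp add: f)
    qed
    \<comment> \<open>The two sides can differ only at outcomes outside \<open>dom M\<close>, which
      have probability 0.\<close>
    have eq: "map_pmf (\<lambda>m. (S, normalised S (outcome_state S qs M m \<rho>), subst y (NatV m) P)) (outcomes S qs M \<rho>) =
      map_pmf (\<lambda>m. (S, normalised S (branch S qs (Ks m) \<rho>), subst y (NatV m) P)) (outcomes S qs M \<rho>)"
    proof (rule map_pmf_cong[OF refl])
      fix m assume "m \<in> set_pmf (outcomes S qs M \<rho>)"
      have "m \<in> dom M"
      proof (rule ccontr)
        assume "m \<notin> dom M"
        then have "pmf (outcomes S qs M \<rho>) m = 0" unfolding pmf by (rule if_not_P)
        then show False using \<open>m \<in> set_pmf _\<close> by (simp add: set_pmf_iff)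
      qed
      then show "(S, normalised S (outcome_state S qs M m \<rho>), subst y (NatV m) P) =
        (S, normalised S (branch S qs (Ks m) \<rho>), subst y (NatV m) P)" unfolding out by simp
    qed
    show "step (S, \<rho>, Measure t M (map qexp qs) y P) Silent (Tag t)
       (map_pmf (\<lambda>m. (S, normalised S (branch S qs (Ks m) \<rho>), subst y (NatV m) P)) (outcomes S qs M \<rho>))"
      unfolding eq[symmetric] by (rule step.step_measure)
  qed
  then show ?case using qs inst by blast
next
  case (step_cond_true e P \<mu> s \<Delta> Q)
  then have "has_qubits \<Sigma> P" by (simp add: has_qubits_simps)
  from step_cond_true.hyps(3)[OF this step_cond_true.prems(2)] obtain qs I Ks R where
    *: "distinct qs" "set qs \<subseteq> \<Sigma>" "instrument (length qs) I Ks" and R: "realises S P \<mu> s qs I Ks R" by blast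
  from * realises_mono[OF R step.step_cond_true[OF step_cond_true.hyps(1)]] show ?case by blast
next
  case (step_cond_false e Q \<mu> s \<Delta> P)
  then have "has_qubits \<Sigma> Q" by (simp add: has_qubits_simps)
  from step_cond_false.hyps(3)[OF this step_cond_false.prems(2)] obtain qs I Ks R where
    *: "distinct qs" "set qs \<subseteq> \<Sigma>" "instrument (length qs) I Ks" and R: "realises S Q \<mu> s qs I Ks R" by blast
  from * realises_mono[OF R step.step_cond_false[OF step_cond_false.hyps(1)]] show ?case by blast
next
  case (step_choice_left P \<mu> s \<Delta> Q)
  then have "has_qubits \<Sigma> P" by (simp add: has_qubits_simps)
  from step_choice_left.hyps(2)[OF this step_choice_left.prems(2)] obtain qs I Ks R where
    *: "distinct qs" "set qs \<subseteq> \<Sigma>" "instrument (length qs) I Ks" and R: "realises S P \<mu> s qs I Ks R" by blast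
  from * realises_mono[OF R step.step_choice_left] show ?case by blast
next
  case (step_choice_right Q \<mu> s \<Delta> P)
  then have "has_qubits \<Sigma> Q" by (simp add: has_qubits_simps)
  from step_choice_right.hyps(2)[OF this step_choice_right.prems(2)] obtain qs I Ks R where
    *: "distinct qs" "set qs \<subseteq> \<Sigma>" "instrument (length qs) I Ks" and R: "realises S Q \<mu> s qs I Ks R" by blast
  from * realises_mono[OF R step.step_choice_right] show ?case by blast
next
  case (step_restrict P \<mu> s \<Delta> c)
  then have "has_qubits \<Sigma> P" by (simp add: has_qubits_simps)
  from step_restrict.hyps(2)[OF this step_restrict.prems(2)] obtain qs I Ks R where
    "distinct qs" "set qs \<subseteq> \<Sigma>" "instrument (length qs) I Ks" "realises S P \<mu> s qs I Ks R" by blast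
  moreover from realises_map[OF this(4) step.step_restrict[OF _ step_restrict.hyps(3)]]
  have "realises S (Restrict P c) \<mu> s qs I Ks (\<lambda>m. Restrict (R m) c)" .
  ultimately show ?case by blast
next
  case (step_par_left P \<mu> s \<Delta> Q)
  then obtain \<Sigma>1 where \<Sigma>1: "has_qubits \<Sigma>1 P" "\<Sigma>1 \<subseteq> \<Sigma>" by (auto simp: has_qubits_Par)
  with step_par_left.prems have "\<Sigma>1 \<subseteq> S" by simp
  from step_par_left.hyps(2)[OF \<Sigma>1(1) this] obtain qs I Ks R where
    "distinct qs" "set qs \<subseteq> \<Sigma>1" "instrument (length qs) I Ks" "realises S P \<mu> s qs I Ks R" by blast
  moreover from realises_map[OF this(4) step.step_par_left[OF _ step_par_left.hyps(3)]]
  have "realises S (Par P Q) \<mu> s qs I Ks (\<lambda>m. Par (R m) Q)" .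
  ultimately show ?case using \<Sigma>1(2) by blast
next
  case (step_par_right Q \<mu> s \<Delta> P)
  then obtain \<Sigma>1 where \<Sigma>1: "has_qubits \<Sigma>1 Q" "\<Sigma>1 \<subseteq> \<Sigma>" by (auto simp: has_qubits_Par)
  with step_par_right.prems have "\<Sigma>1 \<subseteq> S" by simp
  from step_par_right.hyps(2)[OF \<Sigma>1(1) this] obtain qs I Ks R where
    "distinct qs" "set qs \<subseteq> \<Sigma>1" "instrument (length qs) I Ks" "realises S Q \<mu> s qs I Ks R" by blast
  moreover from realises_map[OF this(4) step.step_par_right[OF _ step_par_right.hyps(3)]]
  have "realises S (Par P Q) \<mu> s qs I Ks (\<lambda>m. Par P (R m))" .
  ultimately show ?case using \<Sigma>1(2) by blast
next
  case (step_sync_left P c v t P' Q t' Q')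
  have "step (S, \<rho>', Par P Q) Silent (TagPair t t') (return_pmf (S, \<rho>', Par P' Q'))" for \<rho>'
    using step_visible[OF step_sync_left.hyps(1)] step_visible[OF step_sync_left.hyps(3)]
    by (intro step.step_sync_left[of S \<rho>' P c v]) auto
  from realises_identity[OF assms this] show ?case by (intro exI[of _ "[]"]) simp
next
  case (step_sync_right P c v t P' Q t' Q')
  have "step (S, \<rho>', Par Q P) Silent (TagPair t t') (return_pmf (S, \<rho>', Par Q' P'))" for \<rho>'
    using step_visible[OF step_sync_right.hyps(1)] step_visible[OF step_sync_right.hyps(3)]
    by (intro step.step_sync_right[of S \<rho>' P c v]) auto
  from realises_identity[OF assms this] show ?case by (intro exI[of _ "[]"]) simp
qed

section \<open>Quantum operations on distributions\<close>

lemma dist_typedD: "dist_typed \<Sigma> \<Sigma>' \<Delta> \<Longrightarrow> Some C \<in> set_pmf \<Delta> \<Longrightarrow> conf_typed \<Sigma> \<Sigma>' C"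
  unfolding dist_typed_def by blast

lemma dist_typed_finite: "dist_typed \<Sigma> \<Sigma>' \<Delta> \<Longrightarrow> finite (set_pmf \<Delta>)"
  unfolding dist_typed_def by blast

lemma pmf_mix:
  assumes "0 \<le> p" "p \<le> 1"
  shows "pmf (mix p X Y) x = p * pmf X x + (1 - p) * pmf Y x"
  using assms unfolding mix_def pmf_bind by (subst integral_bernoulli_pmf) auto

lemma mix_zero: "mix 0 X Y = Y"
  by (rule pmf_eqI) (simp add: pmf_mix)

lemma Some_in_mix:
  assumes "0 < p" "p \<le> 1"
  shows "Some C \<in> set_pmf (mix p X (return_pmf None)) \<longleftrightarrow> Some C \<in> set_pmf X"
  using assms by (simp add: set_pmf_iff pmf_mix pmf_return)

lemma expect_mix:
  assumes "0 \<le> p" "p \<le> 1" "finite (set_pmf X)"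
  shows "expect (mix p X (return_pmf None)) \<phi> = p * expect X \<phi>"
proof -
  have "set_pmf (mix p X (return_pmf None)) \<subseteq> insert None (set_pmf X)"
    by (auto simp: mix_def split: if_splits)
  then have "finite (set_pmf (mix p X (return_pmf None)))" using assms(3) finite_subset by blast
  then have "expect (mix p X (return_pmf None)) \<phi> =
      measure_pmf.expectation (mix p X (return_pmf None)) (case_option 0 \<phi>)" by (rule expect_eq_integral)
  also have "\<dots> = (\<Sum>b\<in>UNIV. pmf (bernoulli_pmf p) b *\<^sub>R
      measure_pmf.expectation (if b then X else return_pmf None) (case_option 0 \<phi>))"
    unfolding mix_def using assms(3) by (intro pmf_expectation_bind) auto
  also have "\<dots> = p * expect X \<phi>"
    using assms by (simp add: UNIV_bool expect_eq_integral)
  finally show ?thesis .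
qed

lemma superop_sub_pos:
  assumes "finite S" "T \<subseteq> S" "trace_nonincreasing T E" "density_operator S \<rho>"
  shows "op_pos S (superop_sub S T E \<rho>)"
proof -
  from assms(3) obtain Ks where E: "E = kraus T Ks" unfolding trace_nonincreasing_def by blast
  have "superop_sub S T E = kraus S (map (op_lift S T (\<lambda>q. q)) Ks)"
    using assms(1,2) unfolding E superop_sub_def by (intro superop_on_kraus) auto
  then show ?thesis using assms(4)
    by (auto intro!: op_pos_kraus simp: operator_on_lift density_operator_def)
qed

lemma conf_prob_nonneg:
  assumes "conf_typed \<Sigma> \<Sigma>' C" "T \<subseteq> \<Sigma>" "trace_nonincreasing T E"
  shows "0 \<le> conf_prob T E C"
proof -
  obtain \<rho> P where C: "C = (\<Sigma>, \<rho>, P)" "density_operator \<Sigma> \<rho>" using assms(1) by (cases C) auto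
  then have "finite \<Sigma>" by (simp add: density_operator_def)
  then show ?thesis
    using op_trace_prob_of(2)[OF superop_sub_pos[OF _ assms(2,3)]] C by (simp add: conf_prob_def)
qed

lemma conf_post_typed:
  assumes "conf_typed \<Sigma> \<Sigma>' C" "T \<subseteq> \<Sigma>" "trace_nonincreasing T E" "conf_prob T E C \<noteq> 0"
  shows "conf_typed \<Sigma> \<Sigma>' (conf_post T E C)"
proof -
  obtain \<rho> P where C: "C = (\<Sigma>, \<rho>, P)" "density_operator \<Sigma> \<rho>" using assms(1) by (cases C) auto
  then have "finite \<Sigma>" by (simp add: density_operator_def)
  then have "density_operator \<Sigma> (normalised \<Sigma> (superop_sub \<Sigma> T E \<rho>))"
    using assms(4) C superop_sub_pos[OF _ assms(2,3)]
    by (intro density_normalised) (auto simp: conf_prob_def)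
  then show ?thesis using assms(1) C by (simp add: conf_post_def)
qed

text \<open>The identity for \<open>expect\<close> is cleared of denominators. With mass p, proper
  part \<open>D\<close> and t the success probability in \<open>D\<close>, both sides are p times p
  times the unnormalised sum over \<open>D\<close>: t cancels against the normalisation, and the
  operation keeps the mass at p. In this form it also covers \<bottom>, whose success probability is
  0.\<close>

lemma apply_dist_expect:
  assumes "apply_dist T E \<Delta> \<Delta>'" "dist_typed \<Sigma> \<Sigma>' \<Delta>" "T \<subseteq> \<Sigma>" "trace_nonincreasing T E"
  shows "finite (set_pmf \<Delta>')"
    and "Some C' \<in> set_pmf \<Delta>' \<Longrightarrow> \<exists>C. Some C \<in> set_pmf \<Delta> \<and> conf_prob T E C \<noteq> 0 \<and> C' = conf_post T E C"
    and "expect \<Delta> (conf_prob T E) * expect \<Delta>' \<phi> = mass \<Delta> * expect \<Delta> (\<lambda>C. conf_prob T E C * \<phi> (conf_post T E C))"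
    and "mass \<Delta> \<noteq> 0 \<Longrightarrow> expect \<Delta> (conf_prob T E) \<noteq> 0"
proof -
  from assms(1) obtain p D where p: "0 \<le> p" "p \<le> 1" and wt: "well_typed (map_pmf Some D)"
    and tp: "total_prob T E D \<noteq> 0"
    and \<Delta>: "\<Delta> = mix p (map_pmf Some D) (return_pmf None)"
    and \<Delta>': "\<Delta>' = mix p (map_pmf Some (apply_proper T E D)) (return_pmf None)"
    by (auto elim: apply_dist.cases)
  have finD: "finite (set_pmf D)" using wt by (auto simp: well_typed_def dist_typed_def finite_image_iff)
  have "finite (set_pmf \<Delta>') \<and>
    (\<forall>C'. Some C' \<in> set_pmf \<Delta>' \<longrightarrow> (\<exists>C. Some C \<in> set_pmf \<Delta> \<and> conf_prob T E C \<noteq> 0 \<and> C' = conf_post T E C)) \<and>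
    (\<forall>\<phi>. expect \<Delta> (conf_prob T E) * expect \<Delta>' \<phi> = mass \<Delta> * expect \<Delta> (\<lambda>C. conf_prob T E C * \<phi> (conf_post T E C))) \<and>
    (mass \<Delta> \<noteq> 0 \<longrightarrow> expect \<Delta> (conf_prob T E) \<noteq> 0)"
  proof (cases "p = 0")
    case True
    \<comment> \<open>\<open>D\<close> is arbitrary here, since with weight 0 both mixtures are
      \<bottom>.\<close>
    then show ?thesis by (simp add: \<Delta> \<Delta>' mix_zero mass_def)
  next
    case False
    then have p0: "0 < p" using p by simp
    have nonneg: "0 \<le> conf_prob T E C" if "C \<in> set_pmf D" for C
    proof -
      have "Some C \<in> set_pmf \<Delta>" using that p0 p by (simp add: \<Delta> Some_in_mix)
      then show ?thesis using conf_prob_nonneg[OF dist_typedD[OF assms(2)] assms(3,4)] by blast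
    qed
    define f where "f = (\<lambda>C. pmf D C * conf_prob T E C / total_prob T E D)"
    define W where "W = embed_pmf f"
    have tp_pos: "0 < total_prob T E D"
      using tp nonneg by (auto simp: total_prob_def order_less_le intro!: sum_nonneg)
    have W: "pmf W C = f C" for C
      unfolding W_def
    proof (rule pmf_embed_finite[OF finD])
      show "0 \<le> f x" for x
        using nonneg[of x] tp_pos by (cases "x \<in> set_pmf D") (auto simp: f_def set_pmf_iff)
      show "sum f (set_pmf D) = 1"
        using tp_pos by (simp add: f_def total_prob_def flip: sum_divide_distrib)
    qed (simp add: f_def set_pmf_iff)
    have setW: "set_pmf W \<subseteq> set_pmf D" by (auto simp: set_pmf_iff W f_def)
    then have finW: "finite (set_pmf W)" using finD finite_subset by blast
    have AP: "map_pmf Some (apply_proper T E D) = map_pmf (map_option (conf_post T E)) (map_pmf Some W)"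
      by (simp add: apply_proper_def W_def f_def map_pmf_comp)
    have eD: "expect \<Delta> \<psi> = p * (\<Sum>C\<in>set_pmf D. pmf D C * \<psi> C)" for \<psi>
      using p finD by (simp add: \<Delta> expect_mix expect_map_Some)
    have m: "mass \<Delta> = p"
    proof -
      have "finite (set_pmf \<Delta>)" using assms(2) by (simp add: dist_typed_def)
      then have "mass \<Delta> = expect \<Delta> (\<lambda>C. 1)" by (simp add: expect_one)
      then show ?thesis using finD by (simp add: eD sum_pmf_eq_1)
    qed
    have tE: "expect \<Delta> (conf_prob T E) = p * total_prob T E D" by (simp add: eD total_prob_def)
    have eD': "expect \<Delta>' \<phi> = p * (\<Sum>C\<in>set_pmf D. f C * \<phi> (conf_post T E C))" for \<phi>
    proof -
      have "expect \<Delta>' \<phi> = p * (\<Sum>C\<in>set_pmf W. pmf W C * \<phi> (conf_post T E C))"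
        using p finW unfolding \<Delta>' AP by (simp add: expect_mix expect_map expect_map_Some)
      also have "(\<Sum>C\<in>set_pmf W. pmf W C * \<phi> (conf_post T E C)) = (\<Sum>C\<in>set_pmf D. pmf W C * \<phi> (conf_post T E C))"
        using setW finD by (intro sum.mono_neutral_left) (auto simp: set_pmf_iff)
      finally show ?thesis by (simp add: W)
    qed
    have set: "Some C' \<in> set_pmf \<Delta>' \<longleftrightarrow> (\<exists>C\<in>set_pmf W. C' = conf_post T E C)" for C'
      using p0 p unfolding \<Delta>' AP by (subst Some_in_mix) auto
    have "set_pmf \<Delta>' \<subseteq> insert None (Some ` conf_post T E ` set_pmf W)"
    proof
      fix x assume "x \<in> set_pmf \<Delta>'"
      then show "x \<in> insert None (Some ` conf_post T E ` set_pmf W)" using set by (cases x) auto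
    qed
    then have "finite (set_pmf \<Delta>')" using finW finite_subset by blast
    moreover have "\<exists>C. Some C \<in> set_pmf \<Delta> \<and> conf_prob T E C \<noteq> 0 \<and> C' = conf_post T E C" if "Some C' \<in> set_pmf \<Delta>'" for C'
    proof -
      from that obtain C where C: "C \<in> set_pmf W" "C' = conf_post T E C" using set by blast
      then have "f C \<noteq> 0" by (simp add: set_pmf_iff W)
      then have "conf_prob T E C \<noteq> 0" by (auto simp: f_def)
      moreover have "Some C \<in> set_pmf \<Delta>" using C setW p0 p by (auto simp: \<Delta> Some_in_mix)
      ultimately show ?thesis using C by blast
    qed
    moreover have "expect \<Delta> (conf_prob T E) * expect \<Delta>' \<phi> =
        mass \<Delta> * expect \<Delta> (\<lambda>C. conf_prob T E C * \<phi> (conf_post T E C))" for \<phi>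
    proof -
      have "(\<Sum>C\<in>set_pmf D. f C * \<phi> (conf_post T E C)) =
          (\<Sum>C\<in>set_pmf D. pmf D C * (conf_prob T E C * \<phi> (conf_post T E C))) / total_prob T E D"
        unfolding sum_divide_distrib by (rule sum.cong[OF refl]) (simp add: f_def)
      then show ?thesis using tp by (simp add: tE eD' m) (simp add: eD)
    qed
    moreover have "expect \<Delta> (conf_prob T E) \<noteq> 0" using tp p0 by (simp add: tE)
    ultimately show ?thesis by blast
  qed
  then show "finite (set_pmf \<Delta>')"
    and "Some C' \<in> set_pmf \<Delta>' \<Longrightarrow> \<exists>C. Some C \<in> set_pmf \<Delta> \<and> conf_prob T E C \<noteq> 0 \<and> C' = conf_post T E C"
    and "expect \<Delta> (conf_prob T E) * expect \<Delta>' \<phi> = mass \<Delta> * expect \<Delta> (\<lambda>C. conf_prob T E C * \<phi> (conf_post T E C))"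
    and "mass \<Delta> \<noteq> 0 \<Longrightarrow> expect \<Delta> (conf_prob T E) \<noteq> 0" by blast+
qed

lemma measure_proper: "measure (measure_pmf \<Delta>) (- {None}) = mass \<Delta>"
  using measure_pmf.prob_compl[of "{None}" \<Delta>] by (simp add: mass_def measure_pmf_single Compl_eq_Diff_UNIV)

lemma mix_decomposition:
  assumes "mass \<Delta> \<noteq> 0"
  shows "\<exists>D. \<Delta> = mix (mass \<Delta>) (map_pmf Some D) (return_pmf None) \<and> 0 < mass \<Delta> \<and> mass \<Delta> \<le> 1"
proof -
  let ?A = "- {None} :: conf option set"
  note m = measure_proper[of \<Delta>]
  have m01: "0 < mass \<Delta>" "mass \<Delta> \<le> 1"
    using assms pmf_le_1[of \<Delta> None] by (auto simp: mass_def)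
  have ne: "set_pmf \<Delta> \<inter> ?A \<noteq> {}"
  proof
    assume "set_pmf \<Delta> \<inter> ?A = {}"
    then have "measure (measure_pmf \<Delta>) ?A = 0" by (simp add: measure_pmf_zero_iff)
    then show False using m assms by simp
  qed
  define D where "D = map_pmf the (cond_pmf \<Delta> ?A)"
  have D: "map_pmf Some D = cond_pmf \<Delta> ?A"
    unfolding D_def map_pmf_comp using ne by (intro map_pmf_idI) auto
  have "\<Delta> = mix (mass \<Delta>) (map_pmf Some D) (return_pmf None)"
  proof (rule pmf_eqI)
    fix x
    show "pmf \<Delta> x = pmf (mix (mass \<Delta>) (map_pmf Some D) (return_pmf None)) x"
      using m01 ne m unfolding D by (cases x) (simp_all add: pmf_mix pmf_cond pmf_return mass_def)
  qed
  then show ?thesis using m01 by blast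
qed

lemma mass_zero: "mass \<Delta> = 0 \<Longrightarrow> \<Delta> = return_pmf None"
proof -
  assume "mass \<Delta> = 0"
  then have "set_pmf \<Delta> \<inter> - {None} = {}" using measure_proper[of \<Delta>] by (simp add: measure_pmf_zero_iff)
  then have "set_pmf \<Delta> \<subseteq> {None}" by auto
  then show ?thesis by (simp add: set_pmf_subset_singleton)
qed

lemma apply_dist_exists:
  assumes "dist_typed \<Sigma> \<Sigma>' \<Delta>" "expect \<Delta> (conf_prob T E) \<noteq> 0"
  shows "\<exists>\<Delta>'. apply_dist T E \<Delta> \<Delta>'"
proof -
  have "mass \<Delta> \<noteq> 0" using assms(2) mass_zero by force
  then obtain D where D: "\<Delta> = mix (mass \<Delta>) (map_pmf Some D) (return_pmf None)" "0 < mass \<Delta>" "mass \<Delta> \<le> 1"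
    using mix_decomposition by blast
  have sub: "Some C \<in> set_pmf \<Delta>" if "C \<in> set_pmf D" for C
    using that D Some_in_mix[OF D(2,3), of C "map_pmf Some D"] by simp
  have "Some ` set_pmf D \<subseteq> set_pmf \<Delta>" using sub by blast
  then have fin: "finite (set_pmf D)"
    using finite_imageD[OF finite_subset[OF _ dist_typed_finite[OF assms(1)]] inj_Some] by blast
  have "dist_typed \<Sigma> \<Sigma>' (map_pmf Some D)"
    using assms(1) fin sub by (auto simp: dist_typed_def simp del: conf_typed.simps)
  then have wt: "well_typed (map_pmf Some D)" unfolding well_typed_def by blast
  have "expect \<Delta> (conf_prob T E) = expect (mix (mass \<Delta>) (map_pmf Some D) (return_pmf None)) (conf_prob T E)"
    by (rule arg_cong[OF D(1)])
  also have "\<dots> = mass \<Delta> * total_prob T E D"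
    using D(2,3) fin by (simp add: expect_mix expect_map_Some total_prob_def)
  finally have "total_prob T E D \<noteq> 0" using assms(2) by auto
  from apply_dist.intros[OF less_imp_le[OF D(2)] D(3) wt this, folded D(1)] show ?thesis by blast
qed

lemma apply_dist_bot:
  assumes "apply_dist T E (return_pmf None) \<Delta>'"
  shows "\<Delta>' = return_pmf None"
  using assms
proof cases
  case (1 p D)
  have "p = 0"
  proof (rule ccontr)
    assume "p \<noteq> 0"
    then have "0 < p" using 1 by simp
    obtain C where "C \<in> set_pmf D" using set_pmf_not_empty[of D] by blast
    then have "Some C \<in> set_pmf (map_pmf Some D)" by simp
    then have "Some C \<in> set_pmf (mix p (map_pmf Some D) (return_pmf None))"
      by (subst Some_in_mix[OF \<open>0 < p\<close> 1(4)])
    then have "Some C \<in> set_pmf (return_pmf None)" unfolding 1(1)[symmetric] .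
    then show False by simp
  qed
  then show ?thesis using 1 by (simp add: mix_zero)
qed

section \<open>What the environment observes\<close>

text \<open>Entries of the reduced state as real test functions: equality of partial traces becomes
  equality of functionals on these tests, and so passes to linear combinations.\<close>

definition obs_re :: "qubit set \<Rightarrow> nat set \<Rightarrow> nat set \<Rightarrow> conf \<Rightarrow> real" where
  "obs_re U A B = (\<lambda>(S, \<rho>, P). Re (partial_trace U \<rho> A B))"

definition obs_im :: "qubit set \<Rightarrow> nat set \<Rightarrow> nat set \<Rightarrow> conf \<Rightarrow> real" where
  "obs_im U A B = (\<lambda>(S, \<rho>, P). Im (partial_trace U \<rho> A B))"

lemma partial_trace_quantum_state:
  "partial_trace U (quantum_state \<Delta>) A B = Complex (expect \<Delta> (obs_re U A B)) (expect \<Delta> (obs_im U A B))"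
proof -
  have "partial_trace U (quantum_state \<Delta>) A B =
    (\<Sum>x\<in>set_pmf \<Delta>. case x of None \<Rightarrow> 0 | Some (S, \<rho>, P) \<Rightarrow> of_real (pmf \<Delta> x) * partial_trace U \<rho> A B)"
  proof (cases "A \<inter> U = {} \<and> B \<inter> U = {}")
    case True
    then have "partial_trace U (quantum_state \<Delta>) A B = (\<Sum>C\<in>Pow U. quantum_state \<Delta> (A \<union> C) (B \<union> C))"
      by (simp add: partial_trace_def)
    also have "\<dots> = (\<Sum>x\<in>set_pmf \<Delta>. \<Sum>C\<in>Pow U. case x of None \<Rightarrow> 0 |
        Some (S, \<rho>, P) \<Rightarrow> of_real (pmf \<Delta> x) * \<rho> (A \<union> C) (B \<union> C))"
      unfolding quantum_state_def by (rule sum.swap)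
    finally show ?thesis
      using True by (auto simp: partial_trace_def sum_distrib_left intro!: sum.cong split: option.split)
  next
    case False
    then have 0: "partial_trace U X A B = 0" for X by (auto simp: partial_trace_def)
    show ?thesis unfolding 0 by (rule sum.neutral[symmetric]) (auto split: option.split)
  qed
  then show ?thesis
    by (auto simp: complex_eq_iff expect_def obs_re_def obs_im_def intro!: sum.cong split: option.split)
qed

lemma expect_obs_eq:
  assumes "partial_trace U (quantum_state \<Delta>) = partial_trace U (quantum_state \<Theta>)"
  shows "expect \<Delta> (obs_re U A B) = expect \<Theta> (obs_re U A B)" "expect \<Delta> (obs_im U A B) = expect \<Theta> (obs_im U A B)"
  using fun_cong[OF fun_cong[OF assms], of A B] unfolding partial_trace_quantum_state by auto

lemma partial_trace_mono_eq:
  assumes "finite V" "U \<subseteq> V" "partial_trace U X = partial_trace U Y"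
  shows "partial_trace V X = partial_trace V Y"
  using assms(3) partial_trace_Un[OF assms(1,2)] by metis

text \<open>By \<open>op_trace_superop_sub\<close> the probability is the real part of the trace of
  the Gram matrix times the reduced state. It is thus a combination of the observables whose
  coefficients do not depend on the configuration; the minus sign is that of the real part of a
  product.\<close>

lemma conf_prob_obs:
  assumes "conf_typed \<Sigma> \<Sigma>' C" "trace_nonincreasing (\<Sigma> - \<Sigma>') E"
  shows "\<exists>G. \<forall>C. conf_typed \<Sigma> \<Sigma>' C \<longrightarrow> conf_prob (\<Sigma> - \<Sigma>') E C =
    (\<Sum>a\<in>Pow (\<Sigma> - \<Sigma>'). \<Sum>b\<in>Pow (\<Sigma> - \<Sigma>'). Re (G a b) * obs_re \<Sigma>' b a C + - Im (G a b) * obs_im \<Sigma>' b a C)"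
proof -
  from assms(2) obtain Ks where E: "E = kraus (\<Sigma> - \<Sigma>') Ks" unfolding trace_nonincreasing_def by blast
  show ?thesis
  proof (intro exI allI impI)
    fix C assume C: "conf_typed \<Sigma> \<Sigma>' C"
    then obtain \<rho> P where C': "C = (\<Sigma>, \<rho>, P)" "finite \<Sigma>" "\<Sigma>' \<subseteq> \<Sigma>"
      by (cases C) (auto simp: density_operator_def)
    then show "conf_prob (\<Sigma> - \<Sigma>') E C =
      (\<Sum>a\<in>Pow (\<Sigma> - \<Sigma>'). \<Sum>b\<in>Pow (\<Sigma> - \<Sigma>'). Re (kraus_gram (\<Sigma> - \<Sigma>') Ks a b) * obs_re \<Sigma>' b a C +
        - Im (kraus_gram (\<Sigma> - \<Sigma>') Ks a b) * obs_im \<Sigma>' b a C)"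
      by (simp add: conf_prob_def prob_of_def E op_trace_superop_sub double_diff obs_re_def obs_im_def)
  qed
qed

lemma expect_conf_prob_eq:
  assumes "dist_typed \<Sigma> \<Sigma>' \<Delta>" "dist_typed \<Sigma> \<Sigma>' \<Theta>" "trace_nonincreasing (\<Sigma> - \<Sigma>') E"
    "partial_trace \<Sigma>' (quantum_state \<Delta>) = partial_trace \<Sigma>' (quantum_state \<Theta>)"
  shows "expect \<Delta> (conf_prob (\<Sigma> - \<Sigma>') E) = expect \<Theta> (conf_prob (\<Sigma> - \<Sigma>') E)"
proof (cases "\<exists>C. conf_typed \<Sigma> \<Sigma>' C")
  case True
  then obtain G where G: "\<And>C. conf_typed \<Sigma> \<Sigma>' C \<Longrightarrow> conf_prob (\<Sigma> - \<Sigma>') E C =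
    (\<Sum>a\<in>Pow (\<Sigma> - \<Sigma>'). \<Sum>b\<in>Pow (\<Sigma> - \<Sigma>'). Re (G a b) * obs_re \<Sigma>' b a C + - Im (G a b) * obs_im \<Sigma>' b a C)"
    using conf_prob_obs[OF _ assms(3)] by blast
  have "expect X (conf_prob (\<Sigma> - \<Sigma>') E) = (\<Sum>a\<in>Pow (\<Sigma> - \<Sigma>'). \<Sum>b\<in>Pow (\<Sigma> - \<Sigma>').
      Re (G a b) * expect X (obs_re \<Sigma>' b a) + - Im (G a b) * expect X (obs_im \<Sigma>' b a))"
    if "dist_typed \<Sigma> \<Sigma>' X" for X
  proof -
    have "expect X (conf_prob (\<Sigma> - \<Sigma>') E) = expect X (\<lambda>C. \<Sum>a\<in>Pow (\<Sigma> - \<Sigma>'). \<Sum>b\<in>Pow (\<Sigma> - \<Sigma>').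
        Re (G a b) * obs_re \<Sigma>' b a C + - Im (G a b) * obs_im \<Sigma>' b a C)"
      using that G by (intro expect_cong) (auto simp: dist_typed_def simp del: conf_typed.simps)
    then show ?thesis by (simp only: expect_sum expect_add expect_mult)
  qed
  then show ?thesis using assms(1,2) expect_obs_eq[OF assms(4)] by simp
next
  case False
  \<comment> \<open>Without any configuration of this type both distributions are \<bottom>, and
    every functional is 0.\<close>
  have "expect X \<phi> = 0" if "dist_typed \<Sigma> \<Sigma>' X" for X \<phi>
    using expect_cong[of X \<phi> "\<lambda>C. 0"] that False by (auto simp: dist_typed_def expect_zero simp del: conf_typed.simps)
  then show ?thesis using assms(1,2) by simp
qed

text \<open>Every proper configuration has a reduced state of trace 1, so the mass is the trace of
  the observed state. This supplies the clause on masses, which saturated bisimulation states and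
  labelled bisimulation does not.\<close>

lemma mass_eq:
  assumes "dist_typed \<Sigma> \<Sigma>' \<Delta>" "dist_typed \<Sigma> \<Sigma>' \<Theta>"
    "partial_trace \<Sigma>' (quantum_state \<Delta>) = partial_trace \<Sigma>' (quantum_state \<Theta>)"
  shows "mass \<Delta> = mass \<Theta>"
proof -
  have "mass X = (\<Sum>A\<in>Pow (\<Sigma> - \<Sigma>'). expect X (obs_re \<Sigma>' A A))" if X: "dist_typed \<Sigma> \<Sigma>' X" for X
  proof -
    have "mass X = expect X (\<lambda>C. 1)" using X by (simp add: expect_one dist_typed_def)
    also have "\<dots> = expect X (\<lambda>C. \<Sum>A\<in>Pow (\<Sigma> - \<Sigma>'). obs_re \<Sigma>' A A C)"
    proof (rule expect_cong)
      fix C assume "Some C \<in> set_pmf X"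
      with X obtain \<rho> P where C: "C = (\<Sigma>, \<rho>, P)" "density_operator \<Sigma> \<rho>" "\<Sigma>' \<subseteq> \<Sigma>"
        by (cases C) (auto simp: dist_typed_def)
      then have "1 = Re (op_trace (\<Sigma> - \<Sigma>') (partial_trace \<Sigma>' \<rho>))"
        using op_trace_partial_trace[of \<Sigma> \<Sigma>' \<rho>] by (simp add: density_operator_def)
      then show "1 = (\<Sum>A\<in>Pow (\<Sigma> - \<Sigma>'). obs_re \<Sigma>' A A C)" using C(1) by (simp add: op_trace_def obs_re_def)
    qed
    finally show ?thesis by (simp add: expect_sum)
  qed
  then show ?thesis using assms(1,2) expect_obs_eq[OF assms(3)] by simp
qed

section \<open>Labelled bisimilarity\<close>

lemma labelled_bisimulation_bisimilarity: "labelled_bisimulation labelled_bisimilarity"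
  unfolding labelled_bisimulation_def
proof (intro ballI, clarify)
  fix \<Delta> \<Theta> assume "(\<Delta>, \<Theta>) \<in> labelled_bisimilarity"
  then obtain R where R: "labelled_bisimulation R" "(\<Delta>, \<Theta>) \<in> R" and sub: "R \<subseteq> labelled_bisimilarity"
    unfolding labelled_bisimilarity_def by blast
  from bspec[OF R(1)[unfolded labelled_bisimulation_def] R(2)]
  have dt: "deterministically_tagged \<Delta>" "deterministically_tagged \<Theta>"
    and ty: "\<exists>\<Sigma> \<Sigma>'. dist_typed \<Sigma> \<Sigma>' \<Delta> \<and> dist_typed \<Sigma> \<Sigma>' \<Theta> \<and>
       partial_trace \<Sigma>' (quantum_state \<Delta>) = partial_trace \<Sigma>' (quantum_state \<Theta>) \<and>
       (\<forall>E \<Delta>' \<Theta>'. trace_nonincreasing (\<Sigma> - \<Sigma>') E \<and>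
          apply_dist (\<Sigma> - \<Sigma>') E \<Delta> \<Delta>' \<and> apply_dist (\<Sigma> - \<Sigma>') E \<Theta> \<Theta>' \<longrightarrow> (\<Delta>', \<Theta>') \<in> R)"
    and l: "\<And>\<mu> \<delta> \<Delta>'. dist_trans \<Delta> \<mu> \<delta> \<Delta>' \<Longrightarrow> \<exists>\<Theta>'. dist_trans \<Theta> \<mu> \<delta> \<Theta>' \<and> (\<Delta>', \<Theta>') \<in> R"
    and r: "\<And>\<mu> \<delta> \<Theta>'. dist_trans \<Theta> \<mu> \<delta> \<Theta>' \<Longrightarrow> \<exists>\<Delta>'. dist_trans \<Delta> \<mu> \<delta> \<Delta>' \<and> (\<Delta>', \<Theta>') \<in> R"
    by auto
  from ty obtain \<Sigma> \<Sigma>' where ty': "dist_typed \<Sigma> \<Sigma>' \<Delta> \<and> dist_typed \<Sigma> \<Sigma>' \<Theta> \<and>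
       partial_trace \<Sigma>' (quantum_state \<Delta>) = partial_trace \<Sigma>' (quantum_state \<Theta>)"
       "\<And>E \<Delta>' \<Theta>'. trace_nonincreasing (\<Sigma> - \<Sigma>') E \<and>
          apply_dist (\<Sigma> - \<Sigma>') E \<Delta> \<Delta>' \<and> apply_dist (\<Sigma> - \<Sigma>') E \<Theta> \<Theta>' \<Longrightarrow> (\<Delta>', \<Theta>') \<in> R" by auto
  have "\<exists>\<Sigma> \<Sigma>'. dist_typed \<Sigma> \<Sigma>' \<Delta> \<and> dist_typed \<Sigma> \<Sigma>' \<Theta> \<and>
       partial_trace \<Sigma>' (quantum_state \<Delta>) = partial_trace \<Sigma>' (quantum_state \<Theta>) \<and>
       (\<forall>E \<Delta>' \<Theta>'. trace_nonincreasing (\<Sigma> - \<Sigma>') E \<and>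
          apply_dist (\<Sigma> - \<Sigma>') E \<Delta> \<Delta>' \<and> apply_dist (\<Sigma> - \<Sigma>') E \<Theta> \<Theta>' \<longrightarrow> (\<Delta>', \<Theta>') \<in> labelled_bisimilarity)"
    using ty' sub by (intro exI[of _ \<Sigma>] exI[of _ \<Sigma>']) blast
  moreover have "(\<forall>\<Delta>'. dist_trans \<Delta> \<mu> \<delta> \<Delta>' \<longrightarrow> (\<exists>\<Theta>'. dist_trans \<Theta> \<mu> \<delta> \<Theta>' \<and> (\<Delta>', \<Theta>') \<in> labelled_bisimilarity)) \<and>
       (\<forall>\<Theta>'. dist_trans \<Theta> \<mu> \<delta> \<Theta>' \<longrightarrow> (\<exists>\<Delta>'. dist_trans \<Delta> \<mu> \<delta> \<Delta>' \<and> (\<Delta>', \<Theta>') \<in> labelled_bisimilarity))" for \<mu> \<delta>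
    using l r sub by blast
  ultimately show "deterministically_tagged \<Delta> \<and> deterministically_tagged \<Theta> \<and>
     (\<exists>\<Sigma> \<Sigma>'. dist_typed \<Sigma> \<Sigma>' \<Delta> \<and> dist_typed \<Sigma> \<Sigma>' \<Theta> \<and>
       partial_trace \<Sigma>' (quantum_state \<Delta>) = partial_trace \<Sigma>' (quantum_state \<Theta>) \<and>
       (\<forall>E \<Delta>' \<Theta>'. trace_nonincreasing (\<Sigma> - \<Sigma>') E \<and>
          apply_dist (\<Sigma> - \<Sigma>') E \<Delta> \<Delta>' \<and> apply_dist (\<Sigma> - \<Sigma>') E \<Theta> \<Theta>' \<longrightarrow> (\<Delta>', \<Theta>') \<in> labelled_bisimilarity)) \<and>
     (\<forall>\<mu> \<delta>.
       (\<forall>\<Delta>'. dist_trans \<Delta> \<mu> \<delta> \<Delta>' \<longrightarrow> (\<exists>\<Theta>'. dist_trans \<Theta> \<mu> \<delta> \<Theta>' \<and> (\<Delta>', \<Theta>') \<in> labelled_bisimilarity)) \<and>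
       (\<forall>\<Theta>'. dist_trans \<Theta> \<mu> \<delta> \<Theta>' \<longrightarrow> (\<exists>\<Delta>'. dist_trans \<Delta> \<mu> \<delta> \<Delta>' \<and> (\<Delta>', \<Theta>') \<in> labelled_bisimilarity)))"
    using dt by blast
qed

lemma bisimilar_cases:
  assumes "(\<Delta>, \<Theta>) \<in> labelled_bisimilarity"
  obtains \<Sigma> \<Sigma>' where "deterministically_tagged \<Delta>" "deterministically_tagged \<Theta>"
    "dist_typed \<Sigma> \<Sigma>' \<Delta>" "dist_typed \<Sigma> \<Sigma>' \<Theta>"
    "partial_trace \<Sigma>' (quantum_state \<Delta>) = partial_trace \<Sigma>' (quantum_state \<Theta>)"
    "\<And>E \<Delta>' \<Theta>'. trace_nonincreasing (\<Sigma> - \<Sigma>') E \<Longrightarrow> apply_dist (\<Sigma> - \<Sigma>') E \<Delta> \<Delta>' \<Longrightarrow>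
       apply_dist (\<Sigma> - \<Sigma>') E \<Theta> \<Theta>' \<Longrightarrow> (\<Delta>', \<Theta>') \<in> labelled_bisimilarity"
    "\<And>\<mu> \<delta> \<Delta>'. dist_trans \<Delta> \<mu> \<delta> \<Delta>' \<Longrightarrow> \<exists>\<Theta>'. dist_trans \<Theta> \<mu> \<delta> \<Theta>' \<and> (\<Delta>', \<Theta>') \<in> labelled_bisimilarity"
    "\<And>\<mu> \<delta> \<Theta>'. dist_trans \<Theta> \<mu> \<delta> \<Theta>' \<Longrightarrow> \<exists>\<Delta>'. dist_trans \<Delta> \<mu> \<delta> \<Delta>' \<and> (\<Delta>', \<Theta>') \<in> labelled_bisimilarity"
proof -
  from bspec[OF labelled_bisimulation_bisimilarity[unfolded labelled_bisimulation_def] assms]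
  show thesis by (auto intro: that)
qed

lemma dist_typed_unique:
  assumes "dist_typed \<Sigma> \<Sigma>' \<Delta>" "dist_typed T T' \<Delta>" "\<Delta> \<noteq> return_pmf None"
  shows "T = \<Sigma> \<and> T' = \<Sigma>'"
proof -
  have "\<exists>C. Some C \<in> set_pmf \<Delta>"
  proof (rule ccontr)
    assume "\<not> ?thesis"
    then have "set_pmf \<Delta> \<subseteq> {None}" by (metis option.exhaust singletonI subsetI)
    then show False using assms(3) by (simp add: set_pmf_subset_singleton)
  qed
  then show ?thesis using assms(1,2) conf_typed_unique unfolding dist_typed_def by blast
qed

text \<open>Labelled bisimulation provides these clauses for some type. The type is unique unless
  both distributions are \<bottom>, and then the clauses are immediate, since operations send
  \<bottom> to \<bottom>.\<close>

lemma bisimilar_typed: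
  assumes bis: "(\<Delta>, \<Theta>) \<in> labelled_bisimilarity" and typed: "dist_typed \<Sigma> \<Sigma>' \<Delta>" "dist_typed \<Sigma> \<Sigma>' \<Theta>"
  shows "partial_trace \<Sigma>' (quantum_state \<Delta>) = partial_trace \<Sigma>' (quantum_state \<Theta>)"
    "trace_nonincreasing (\<Sigma> - \<Sigma>') E \<Longrightarrow> apply_dist (\<Sigma> - \<Sigma>') E \<Delta> \<Delta>' \<Longrightarrow>
      apply_dist (\<Sigma> - \<Sigma>') E \<Theta> \<Theta>' \<Longrightarrow> (\<Delta>', \<Theta>') \<in> labelled_bisimilarity"
proof -
  from bis obtain T T' where T: "dist_typed T T' \<Delta>" "dist_typed T T' \<Theta>"
    "partial_trace T' (quantum_state \<Delta>) = partial_trace T' (quantum_state \<Theta>)"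
    "\<And>E \<Delta>' \<Theta>'. trace_nonincreasing (T - T') E \<Longrightarrow> apply_dist (T - T') E \<Delta> \<Delta>' \<Longrightarrow>
       apply_dist (T - T') E \<Theta> \<Theta>' \<Longrightarrow> (\<Delta>', \<Theta>') \<in> labelled_bisimilarity"
    by (elim bisimilar_cases) blast
  have "(T = \<Sigma> \<and> T' = \<Sigma>') \<or> (\<Delta> = return_pmf None \<and> \<Theta> = return_pmf None)"
    using dist_typed_unique T(1,2) typed by blast
  then show "partial_trace \<Sigma>' (quantum_state \<Delta>) = partial_trace \<Sigma>' (quantum_state \<Theta>)"
    "trace_nonincreasing (\<Sigma> - \<Sigma>') E \<Longrightarrow> apply_dist (\<Sigma> - \<Sigma>') E \<Delta> \<Delta>' \<Longrightarrow>
      apply_dist (\<Sigma> - \<Sigma>') E \<Theta> \<Theta>' \<Longrightarrow> (\<Delta>', \<Theta>') \<in> labelled_bisimilarity"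
    using T(3,4) apply_dist_bot bis by blast+
qed

lemma bisimilar_tagged:
  assumes "(\<Delta>, \<Theta>) \<in> labelled_bisimilarity"
  shows "finite (set_pmf \<Delta>)" "finite (set_pmf \<Theta>)" "unique_successors \<Delta>" "unique_successors \<Theta>"
    "\<forall>P\<in>procs \<Delta>. well_tagged P" "\<forall>P\<in>procs \<Theta>. well_tagged P"
proof -
  from assms obtain \<Sigma> \<Sigma>' where "deterministically_tagged \<Delta>" "deterministically_tagged \<Theta>"
    and typed: "dist_typed \<Sigma> \<Sigma>' \<Delta>" "dist_typed \<Sigma> \<Sigma>' \<Theta>" by (elim bisimilar_cases) blast
  then show *: "\<forall>P\<in>procs \<Delta>. well_tagged P" "\<forall>P\<in>procs \<Theta>. well_tagged P"
    by (simp_all add: deterministically_tagged_iff)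
  show "finite (set_pmf \<Delta>)" "finite (set_pmf \<Theta>)" using typed by (simp_all add: dist_typed_def)
  have wt: "well_typed \<Delta>" "well_typed \<Theta>" using typed unfolding well_typed_def by blast+
  show "unique_successors \<Delta>" "unique_successors \<Theta>"
    using *(1)  *(2) wt(1) wt(2) by (simp_all only: unique_successorsI)
qed

text \<open>The answer promised by bisimilarity is unique by determinism, so it must be
  \<open>next_dist\<close>; bisimilarity becomes closure under a function.\<close>

lemma bisimilar_next:
  assumes "(\<Delta>, \<Theta>) \<in> labelled_bisimilarity" "finite (set_pmf \<delta>)"
  shows "(next_dist \<Delta> \<mu> \<delta>, next_dist \<Theta> \<mu> \<delta>) \<in> labelled_bisimilarity"
proof -
  note tagged = bisimilar_tagged[OF assms(1)]
  have "dist_trans \<Delta> \<mu> \<delta> (next_dist \<Delta> \<mu> \<delta>)" using tagged assms(2) by (simp add: dist_trans_iff)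
  with assms(1) obtain \<Theta>' where "dist_trans \<Theta> \<mu> \<delta> \<Theta>'" "(next_dist \<Delta> \<mu> \<delta>, \<Theta>') \<in> labelled_bisimilarity"
    by (elim bisimilar_cases) blast
  then show ?thesis using tagged by (simp add: dist_trans_iff)
qed

section \<open>Processes in contexts\<close>

definition beside :: "proc \<Rightarrow> conf \<Rightarrow> conf" where
  "beside Q = map_proc (\<lambda>P. Par P Q)"

lemma beside_simp [simp]: "beside Q (S, \<rho>, P) = (S, \<rho>, Par P Q)"
  by (simp add: beside_def map_proc_def)

lemma beside_typed:
  assumes "conf_typed \<Sigma> \<Sigma>1 C" "\<Sigma>1 \<subseteq> \<Sigma>2" "\<Sigma>2 \<subseteq> \<Sigma>" "closed_proc Q" "has_qubits (\<Sigma>2 - \<Sigma>1) Q"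
  shows "conf_typed \<Sigma> \<Sigma>2 (beside Q C)"
proof -
  obtain S \<rho> P where C: "C = (S, \<rho>, P)" by (cases C)
  have "has_qubits (\<Sigma>1 \<union> (\<Sigma>2 - \<Sigma>1)) (Par P Q)"
    using assms C by (intro has_qubits_ParI) auto
  then show ?thesis using assms C by (auto simp: closed_proc_simps Un_absorb1)
qed

lemma beside_effect [simp]:
  "conf_prob T E (beside Q C) = conf_prob T E C"
  "conf_post T E (beside Q C) = beside Q (conf_post T E C)"
  "obs_re U A B (beside Q C) = obs_re U A B C"
  "obs_im U A B (beside Q C) = obs_im U A B C"
  by (cases C; simp add: conf_prob_def conf_post_def obs_re_def obs_im_def)+

lemma step_Input_in: "step (S, \<rho>, P) (Input c (QubitV q)) s D \<Longrightarrow> q \<in> S"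
  by (induction "(S, \<rho>, P)" "Input c (QubitV q)" s D arbitrary: P rule: step.induct) auto

lemma typed_stepI:
  assumes st: "step (S, \<rho>, P) \<mu> s D" and ty: "conf_typed \<Sigma> \<Sigma>' (S, \<rho>, P)"
    and inp: "\<forall>c q. \<mu> = Input c (QubitV q) \<longrightarrow> q \<notin> \<Sigma>'"
    and fin: "finite (set_pmf D)" and dens: "\<And>S' \<rho>' P'. (S', \<rho>', P') \<in> set_pmf D \<Longrightarrow> density_operator S' \<rho>'"
  shows "typed_step (S, \<rho>, P) \<mu> s D"
proof -
  have P: "has_qubits \<Sigma>' P" "closed_proc P" and S: "S = \<Sigma>" "\<Sigma>' \<subseteq> \<Sigma>" using ty by auto
  note * = step_typed[OF st P inp]
  have sub: "owned_after \<mu> \<Sigma>' \<subseteq> \<Sigma>"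
  proof (cases \<mu>)
    case (Input c v)
    then show ?thesis using step_Input_in st S by (cases v) auto
  qed (use S in \<open>auto simp: owned_after_Output split: val.splits\<close>)
  have "dist_typed \<Sigma> (owned_after \<mu> \<Sigma>') (map_pmf Some D)"
    unfolding dist_typed_def
  proof (intro conjI allI impI)
    show "finite (set_pmf (map_pmf Some D))" using fin by simp
    fix C assume C: "Some C \<in> set_pmf (map_pmf Some D)"
    obtain S' \<rho>' P' where C': "C = (S', \<rho>', P')" by (cases C)
    then have "(S', \<rho>', P') \<in> set_pmf D" using C by auto
    then show "conf_typed \<Sigma> (owned_after \<mu> \<Sigma>') C" using * sub S dens C' by auto
  qed
  then have "well_typed (map_pmf Some D)" unfolding well_typed_def by blast
  moreover have "well_typed (return_pmf (Some (S, \<rho>, P)))" using ty well_typed_Some by blast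
  ultimately show ?thesis using st by (simp add: typed_step_def)
qed

lemma typed_step_density:
  assumes "typed_step C \<mu> s D"
  shows "finite (set_pmf D)" "(S', \<rho>', P') \<in> set_pmf D \<Longrightarrow> density_operator S' \<rho>'"
proof -
  from assms obtain T T' where T: "dist_typed T T' (map_pmf Some D)"
    unfolding typed_step_def well_typed_def by blast
  then show "finite (set_pmf D)" using finite_imageD[of Some "set_pmf D"] by (simp add: dist_typed_def)
  assume "(S', \<rho>', P') \<in> set_pmf D"
  then have "conf_typed T T' (S', \<rho>', P')" by (intro dist_typedD[OF T]) simp
  then show "density_operator S' \<rho>'" by auto
qed

text \<open>Finiteness of \<Sigma> is listed separately because typing says nothing about \<Sigma>
  for \<bottom>. Tagging is demanded of the compositions, since well tagged processes may become
  non-deterministic next to \<open>Q\<close>.\<close>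

definition placed :: "qubit set \<Rightarrow> qubit set \<Rightarrow> qubit set \<Rightarrow> proc \<Rightarrow> dist \<Rightarrow> bool" where
  "placed \<Sigma> \<Sigma>' U Q X \<longleftrightarrow> finite \<Sigma> \<and> dist_typed \<Sigma> \<Sigma>' X \<and> \<Sigma>' \<subseteq> U \<and> U \<subseteq> \<Sigma> \<and> closed_proc Q \<and>
     has_qubits (U - \<Sigma>') Q \<and> (\<forall>P\<in>procs X. well_tagged (Par P Q))"

lemma placed_conf:
  assumes "placed \<Sigma> \<Sigma>' U Q X" "Some C \<in> set_pmf X"
  obtains \<rho> P where "C = (\<Sigma>, \<rho>, P)" "density_operator \<Sigma> \<rho>" "has_qubits \<Sigma>' P" "closed_proc P"
    "conf_typed \<Sigma> \<Sigma>' (\<Sigma>, \<rho>, P)" "conf_typed \<Sigma> U (\<Sigma>, \<rho>, Par P Q)" "well_tagged (Par P Q)"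
proof -
  obtain S \<rho> P where C: "C = (S, \<rho>, P)" by (cases C)
  have ty: "conf_typed \<Sigma> \<Sigma>' (S, \<rho>, P)" using assms C dist_typedD unfolding placed_def by blast
  then have "conf_typed \<Sigma> U (beside Q (S, \<rho>, P))"
    using assms(1) unfolding placed_def by (intro beside_typed) auto
  moreover have "P \<in> procs X" using assms(2) C by (auto simp: procs_def)
  ultimately show thesis using that[of \<rho> P] ty C assms(1) by (simp add: placed_def)
qed

lemma next_dist_return:
  assumes "finite (set_pmf X)"
  shows "expect (next_dist X \<mu> (return_pmf s)) \<phi> = expect X (\<lambda>C. expect (successor (Some C) \<mu> s) \<phi>)"
  using expect_next_dist[OF assms, of "return_pmf s"] by simp

subsection \<open>Moves of a process next to another one\<close>

text \<open>\<open>partner \<Sigma> Q \<mu> s \<nu> u Q'\<close>: when a process makes a move \<open>\<nu>\<close> under \<open>u\<close>, its composition with \<open>Q\<close>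
  makes the move \<open>\<mu>\<close> under \<open>s\<close>, after which \<open>Q\<close> has become \<open>Q'\<close>.\<close>

definition partner :: "qubit set \<Rightarrow> proc \<Rightarrow> act \<Rightarrow> sched \<Rightarrow> act \<Rightarrow> sched \<Rightarrow> proc \<Rightarrow> bool" where
  "partner \<Sigma> Q \<mu> s \<nu> u Q' \<longleftrightarrow> (\<nu> = \<mu> \<and> u = s \<and> Q' = Q) \<or> (\<mu> = Silent \<and> (\<exists>t t' c v. s = TagPair t t' \<and>
     (\<nu> = Output c v \<and> u = Tag t \<and> (\<forall>\<rho>. step (\<Sigma>, \<rho>, Q) (Input c v) (Tag t') (return_pmf (\<Sigma>, \<rho>, Q'))) \<or>
      \<nu> = Input c v \<and> u = Tag t' \<and> (\<forall>\<rho>. step (\<Sigma>, \<rho>, Q) (Output c v) (Tag t) (return_pmf (\<Sigma>, \<rho>, Q'))))))"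

lemma partner_cases:
  assumes "partner \<Sigma> Q \<mu> s \<nu> u Q'"
  obtains (alone) "\<nu> = \<mu>" "u = s" "Q' = Q"
  | (out) t t' c v where "\<mu> = Silent" "s = TagPair t t'" "\<nu> = Output c v" "u = Tag t"
      "\<And>\<rho>. step (\<Sigma>, \<rho>, Q) (Input c v) (Tag t') (return_pmf (\<Sigma>, \<rho>, Q'))"
  | (inp) t t' c v where "\<mu> = Silent" "s = TagPair t t'" "\<nu> = Input c v" "u = Tag t'"
      "\<And>\<rho>. step (\<Sigma>, \<rho>, Q) (Output c v) (Tag t) (return_pmf (\<Sigma>, \<rho>, Q'))"
  using assms unfolding partner_def by metis

lemma partner_sched: "partner \<Sigma> Q \<mu> s \<nu> u Q' \<Longrightarrow> partner \<Sigma> Q \<mu> s \<nu> u' Q'' \<Longrightarrow> u = u'"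
  by (auto simp: partner_def)

definition fresh_input :: "act \<Rightarrow> qubit set \<Rightarrow> bool" where
  "fresh_input \<mu> \<Sigma> \<longleftrightarrow> (\<forall>c q. \<mu> = Input c (QubitV q) \<longrightarrow> q \<notin> \<Sigma>)"

text \<open>In a synchronisation a qubit changes owner inside \<open>U\<close>: what the hole loses,
  \<open>Q'\<close> gains, and conversely. The type of the whole stays fixed while the boundary
  between hole and context shifts.\<close>

lemma partner_typed:
  assumes pl: "placed \<Sigma> \<Sigma>' U Q X" and C: "Some C \<in> set_pmf X" and fr: "fresh_input \<mu> U"
    and pa: "partner \<Sigma> Q \<mu> s \<nu> u Q'" and st: "typed_step C \<nu> u D"
  shows "owned_after \<nu> \<Sigma>' \<subseteq> owned_after \<mu> U" "owned_after \<mu> U \<subseteq> \<Sigma>" "closed_proc Q'"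
    "has_qubits (owned_after \<mu> U - owned_after \<nu> \<Sigma>') Q'"
proof -
  from pl C obtain \<rho> P where P: "C = (\<Sigma>, \<rho>, P)" "conf_typed \<Sigma> \<Sigma>' (\<Sigma>, \<rho>, P)" by (elim placed_conf)
  have Q: "\<Sigma>' \<subseteq> U" "U \<subseteq> \<Sigma>" "closed_proc Q" "has_qubits (U - \<Sigma>') Q" using pl by (auto simp: placed_def)
  note ts = typed_step_typed[OF st[unfolded P(1)] P(2)]
  have step: "step (\<Sigma>, \<rho>, P) \<nu> u D" using st P(1) by (simp add: typed_step_def)
  have "owned_after \<nu> \<Sigma>' \<subseteq> owned_after \<mu> U \<and> owned_after \<mu> U \<subseteq> \<Sigma> \<and> closed_proc Q' \<and>
    has_qubits (owned_after \<mu> U - owned_after \<nu> \<Sigma>') Q'"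
    using pa
  proof (cases rule: partner_cases)
    case alone
    have "owned_after \<mu> U - owned_after \<mu> \<Sigma>' = U - \<Sigma>' \<and> owned_after \<mu> \<Sigma>' \<subseteq> owned_after \<mu> U \<and> owned_after \<mu> U \<subseteq> \<Sigma>"
    proof (cases \<mu>)
      case (Output c v)
      then show ?thesis using ts(3) Q(1,2) alone by (cases v) auto
    next
      case (Input c v)
      show ?thesis
      proof (cases v)
        case (QubitV q)
        then have "q \<in> \<Sigma>" "q \<notin> U" using step step_Input_in fr alone Input by (auto simp: fresh_input_def)
        then show ?thesis using Q(1,2) Input QubitV by auto
      qed (use Q(1,2) Input in auto)
    qed (use Q in auto)
    then show ?thesis using alone Q by simp
  next
    case (out t t' c v)
    have q: "\<forall>q. v = QubitV q \<longrightarrow> q \<in> \<Sigma>'" using ts(3) out by blast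
    have "\<forall>d q. Input c v = Input d (QubitV q) \<longrightarrow> q \<notin> U - \<Sigma>'" using q by auto
    from step_typed[OF out(5) Q(4,3) this]
    have *: "has_qubits (owned_after (Input c v) (U - \<Sigma>')) Q'" "closed_proc Q'" by auto
    have "owned_after (Input c v) (U - \<Sigma>') = U - owned_after (Output c v) \<Sigma>'" "owned_after (Output c v) \<Sigma>' \<subseteq> U"
      using q Q(1) by (cases v; auto)+
    then show ?thesis using * out Q by simp
  next
    case (inp t t' c v)
    have "\<forall>d q. Output c v = Input d (QubitV q) \<longrightarrow> q \<notin> U - \<Sigma>'" by simp
    from step_typed[OF inp(5) Q(4,3) this]
    have *: "has_qubits (owned_after (Output c v) (U - \<Sigma>')) Q'" "closed_proc Q'"
      and q: "\<forall>q. v = QubitV q \<longrightarrow> q \<in> U - \<Sigma>'" by auto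
    have "owned_after (Output c v) (U - \<Sigma>') = U - owned_after (Input c v) \<Sigma>'" "owned_after (Input c v) \<Sigma>' \<subseteq> U"
      using q Q(1) by (cases v; auto)+
    then show ?thesis using * inp Q by simp
  qed
  then show "owned_after \<nu> \<Sigma>' \<subseteq> owned_after \<mu> U" "owned_after \<mu> U \<subseteq> \<Sigma>" "closed_proc Q'"
    "has_qubits (owned_after \<mu> U - owned_after \<nu> \<Sigma>') Q'" by auto
qed

lemma partner_step:
  assumes pl: "placed \<Sigma> \<Sigma>' U Q X" and C: "Some C \<in> set_pmf X" and fr: "fresh_input \<mu> U"
    and pa: "partner \<Sigma> Q \<mu> s \<nu> u Q'" and st: "typed_step C \<nu> u D"
  shows "typed_step (beside Q C) \<mu> s (map_pmf (beside Q') D)"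
proof -
  from pl C obtain \<rho> P where P: "C = (\<Sigma>, \<rho>, P)" "conf_typed \<Sigma> U (\<Sigma>, \<rho>, Par P Q)" by (elim placed_conf)
  have Q: "\<Sigma>' \<subseteq> U" "has_qubits (U - \<Sigma>') Q" using pl by (auto simp: placed_def)
  have step: "step (\<Sigma>, \<rho>, P) \<nu> u D" using st P(1) by (simp add: typed_step_def)
  have "step (\<Sigma>, \<rho>, Par P Q) \<mu> s (map_pmf (beside Q') D)"
    using pa
  proof (cases rule: partner_cases)
    case alone
    have "\<not> takes_from Q \<mu>" using takes_from_Input[OF Q(2)] fr by (auto simp: fresh_input_def)
    then show ?thesis using step alone by (simp add: step_par_left beside_def)
  next
    case (out t t' c v)
    from step_visible[OF step] out obtain P' where "D = return_pmf (\<Sigma>, \<rho>, P')" by auto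
    then show ?thesis using step out by (auto intro: step_sync_left)
  next
    case (inp t t' c v)
    from step_visible[OF step] inp obtain P' where "D = return_pmf (\<Sigma>, \<rho>, P')" by auto
    then show ?thesis using step inp by (auto intro: step_sync_right)
  qed
  moreover have "density_operator S' \<rho>'" if "(S', \<rho>', P') \<in> set_pmf (map_pmf (beside Q') D)" for S' \<rho>' P'
    using that typed_step_density(2)[OF st] by (auto simp: beside_def map_proc_def)
  ultimately show ?thesis
    using fr typed_step_density(1)[OF st] unfolding fresh_input_def P(1) beside_simp
    by (intro typed_stepI[OF _ P(2)]) simp_all
qed

inductive_cases step_ParE [consumes 1, case_names left right sync_left sync_right]: "step (S, \<rho>, Par P Q) \<mu> s D"

text \<open>With moves of \<open>Q\<close> alone excluded, inversion of the parallel rules leaves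
  only moves in which the hole takes part. What needs proof is that its share of the move is a typed
  step.\<close>

lemma partner_complete:
  assumes pl: "placed \<Sigma> \<Sigma>' U Q X" and C: "Some C \<in> set_pmf X" and fr: "fresh_input \<mu> U"
    and not_alone: "\<And>\<rho> D. density_operator \<Sigma> \<rho> \<Longrightarrow> \<not> step (\<Sigma>, \<rho>, Q) \<mu> s D"
    and st: "typed_step (beside Q C) \<mu> s D'"
  shows "\<exists>\<nu> u Q' D. partner \<Sigma> Q \<mu> s \<nu> u Q' \<and> typed_step C \<nu> u D"
proof -
  from pl C obtain \<rho> P where P: "C = (\<Sigma>, \<rho>, P)" "density_operator \<Sigma> \<rho>" "conf_typed \<Sigma> \<Sigma>' (\<Sigma>, \<rho>, P)"
    by (elim placed_conf)
  have Q: "\<Sigma>' \<subseteq> U" "closed_proc Q" "has_qubits (U - \<Sigma>') Q" using pl by (auto simp: placed_def)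
  have "step (\<Sigma>, \<rho>, Par P Q) \<mu> s D'" using st P(1) by (simp add: typed_step_def)
  then show ?thesis
  proof (cases rule: step_ParE)
    case (left D)
    have "typed_step (\<Sigma>, \<rho>, P) \<mu> s D"
    proof (rule typed_stepI[OF left(2) P(3)])
      show "\<forall>c q. \<mu> = Input c (QubitV q) \<longrightarrow> q \<notin> \<Sigma>'" using fr Q(1) by (auto simp: fresh_input_def)
      have inj: "inj (map_proc (\<lambda>P. Par P Q))" by (auto simp: inj_def map_proc_def)
      have "finite (map_proc (\<lambda>P. Par P Q) ` set_pmf D)"
        using typed_step_density(1)[OF st] unfolding left(1) by simp
      then show "finite (set_pmf D)" using inj_on_subset[OF inj subset_UNIV] by (rule finite_imageD)
      fix S' \<rho>' P' assume "(S', \<rho>', P') \<in> set_pmf D"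
      then have "(S', \<rho>', Par P' Q) \<in> set_pmf D'" using left(1) by (force simp: map_proc_def)
      then show "density_operator S' \<rho>'" by (rule typed_step_density(2)[OF st])
    qed
    then show ?thesis using P(1) by (auto simp: partner_def)
  next
    case (right D)
    then show ?thesis using not_alone P(2) by blast
  next
    case (sync_left c v t P' t' Q')
    have "typed_step (\<Sigma>, \<rho>, P) (Output c v) (Tag t) (return_pmf (\<Sigma>, \<rho>, P'))"
      using P(2) by (intro typed_stepI[OF sync_left(4) P(3)]) auto
    moreover have "step (\<Sigma>, \<rho>', Q) (Input c v) (Tag t') (return_pmf (\<Sigma>, \<rho>', Q'))" for \<rho>'
      using step_visible[OF sync_left(5)] by auto
    ultimately show ?thesis using sync_left P(1) unfolding partner_def by blast
  next
    case (sync_right c v t Q' t' P')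
    have "\<forall>d q. Output c v = Input d (QubitV q) \<longrightarrow> q \<notin> U - \<Sigma>'" by simp
    \<comment> \<open>\<open>Q\<close> owns the qubit it sends, so the qubit is not in \<Sigma>' and
      its reception by the hole is typable.\<close>
    from step_typed[OF sync_right(4) Q(3,2) this] have "\<forall>q. v = QubitV q \<longrightarrow> q \<notin> \<Sigma>'" by auto
    then have "typed_step (\<Sigma>, \<rho>, P) (Input c v) (Tag t') (return_pmf (\<Sigma>, \<rho>, P'))"
      using P(2) by (intro typed_stepI[OF sync_right(5) P(3)]) auto
    moreover have "step (\<Sigma>, \<rho>', Q) (Output c v) (Tag t) (return_pmf (\<Sigma>, \<rho>', Q'))" for \<rho>'
      using step_visible[OF sync_right(4)] by auto
    ultimately show ?thesis using sync_right P(1) unfolding partner_def by blast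
  qed
qed

section \<open>Consequences of determinism for compositions\<close>

lemma beside_step_unique:
  assumes pl: "placed \<Sigma> \<Sigma>' U Q X" and C: "Some C \<in> set_pmf X"
    and "typed_step (beside Q C) \<mu> s D" "typed_step (beside Q C) \<mu> s D'"
  shows "D = D'"
proof -
  from pl C obtain \<rho> P where P: "C = (\<Sigma>, \<rho>, P)" "well_tagged (Par P Q)" by (elim placed_conf)
  then have "map_pmf Some D = map_pmf Some D'"
    using successor_move[OF P(2)] assms(3,4) by (metis beside_simp)
  then show ?thesis using pmf.inj_map[OF inj_Some] by (blast dest: injD)
qed

lemma beside_output_unique:
  assumes pl: "placed \<Sigma> \<Sigma>' U Q X" and C: "Some C \<in> set_pmf X"
    and st: "typed_step (beside Q C) (Output c v) s D" "typed_step (beside Q C) (Output c' v') s D'"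
  shows "c = c' \<and> v = v'"
proof -
  from pl C obtain \<rho> P where P: "C = (\<Sigma>, \<rho>, P)" "well_tagged (Par P Q)" by (elim placed_conf)
  have "well_typed (return_pmf (Some (\<Sigma>, \<rho>, Par P Q)))" using st(1) P(1) by (simp add: typed_step_def)
  then have "output_deterministic (return_pmf (Some (\<Sigma>, \<rho>, Par P Q)))"
    using P(2) unfolding well_tagged_def by blast
  then show ?thesis using st P(1) unfolding output_deterministic_def
    by (metis beside_simp set_return_pmf singletonI)
qed

lemma beside_output_right:
  assumes pl: "placed \<Sigma> \<Sigma>' U Q X" and C: "Some (\<Sigma>, \<rho>, P) \<in> set_pmf X"
    and "step (\<Sigma>, \<rho>, Q) (Output c v) s (return_pmf (\<Sigma>, \<rho>, Q'))"
  shows "typed_step (beside Q (\<Sigma>, \<rho>, P)) (Output c v) s (return_pmf (\<Sigma>, \<rho>, Par P Q'))"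
proof -
  from pl C obtain \<rho>' P' where P': "(\<Sigma>, \<rho>, P) = (\<Sigma>, \<rho>', P')" "density_operator \<Sigma> \<rho>'"
    "conf_typed \<Sigma> U (\<Sigma>, \<rho>', Par P' Q)" by (elim placed_conf)
  then have P: "density_operator \<Sigma> \<rho>" "conf_typed \<Sigma> U (\<Sigma>, \<rho>, Par P Q)" by simp_all
  have "step (\<Sigma>, \<rho>, Par P Q) (Output c v) s (map_pmf (map_proc (\<lambda>Q'. Par P Q')) (return_pmf (\<Sigma>, \<rho>, Q')))"
    using assms(3) by (rule step_par_right) (simp add: takes_from_def)
  then have "step (\<Sigma>, \<rho>, Par P Q) (Output c v) s (return_pmf (\<Sigma>, \<rho>, Par P Q'))" by (simp add: map_proc_def)
  from typed_stepI[OF this P(2)] P(1) show ?thesis by simp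
qed

text \<open>Processes shrink along transitions, so a move of one component alone is never confused
  with a move of the other one.\<close>

lemma partner_alone_or_sync:
  assumes pl: "placed \<Sigma> \<Sigma>' U Q X" and C: "Some C \<in> set_pmf X" and fr: "fresh_input \<mu> U"
    and pa: "partner \<Sigma> Q \<mu> s \<nu> u Q'" "typed_step C \<nu> u D"
    and st: "typed_step C \<mu> s D'"
  shows "\<nu> = \<mu>"
proof (rule ccontr)
  assume neq: "\<nu> \<noteq> \<mu>"
  have size: "psize Q' < psize Q"
    using pa(1)
  proof (cases rule: partner_cases)
    case (out t t' c v)
    then show ?thesis using step_psize[OF out(5)] by simp
  next
    case (inp t t' c v)
    then show ?thesis using step_psize[OF inp(5)] by simp
  qed (use neq in simp)
  have "partner \<Sigma> Q \<mu> s \<mu> s Q" by (simp add: partner_def)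
  \<comment> \<open>Both are moves of the composition under the same action and scheduler, so they
    coincide; but one leaves \<open>Q'\<close> on the right and the other leaves
    \<open>Q\<close>.\<close>
  from beside_step_unique[OF pl C partner_step[OF pl C fr pa] partner_step[OF pl C fr this st]]
  have eq: "map_pmf (beside Q') D = map_pmf (beside Q) D'" .
  obtain S \<rho> P where "(S, \<rho>, P) \<in> set_pmf D" using set_pmf_not_empty[of D] by auto
  then have "(S, \<rho>, Par P Q') \<in> set_pmf (map_pmf (beside Q') D)" by force
  then have "Q' = Q" unfolding eq by (auto simp: beside_def map_proc_def)
  then show False using size by simp
qed

text \<open>Synchronisations under one pair of tags share the tag of the sender. Seen as outputs of
  the composition they have the same channel and value by output determinism. Hence a configuration
  contributes to at most one label in the decomposition of a move.\<close>

lemma partner_unique: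
  assumes pl: "placed \<Sigma> \<Sigma>' U Q X" and C: "Some C \<in> set_pmf X" and fr: "fresh_input \<mu> U"
    and pa: "partner \<Sigma> Q \<mu> s \<nu> u Q'" "typed_step C \<nu> u D"
    and pa': "partner \<Sigma> Q \<mu> s \<nu>' u' Q''" "typed_step C \<nu>' u' D'"
  shows "\<nu> = \<nu>'"
proof -
  from pl C obtain \<rho> P where P: "C = (\<Sigma>, \<rho>, P)" by (elim placed_conf)
  have left: "typed_step (beside Q C) (Output c v) (Tag t) (map_pmf (beside Q) E)"
    if "typed_step C (Output c v) (Tag t) E" for c v t E
    using that by (intro partner_step[OF pl C]) (auto simp: fresh_input_def partner_def)
  have right: "typed_step (beside Q C) (Output c v) (Tag t) (return_pmf (\<Sigma>, \<rho>, Par P R))"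
    if "step (\<Sigma>, \<rho>, Q) (Output c v) (Tag t) (return_pmf (\<Sigma>, \<rho>, R))" for c v t R
    using beside_output_right[OF pl C[unfolded P] that] P by simp
  \<comment> \<open>With senders on different sides, the two outputs would moreover be one and the
    same move of the composition, whose target would have both \<open>P\<close> and a smaller
    process in the same place.\<close>
  have mixed: False
    if E: "typed_step C (Output c v) (Tag t) E"
      and R: "step (\<Sigma>, \<rho>, Q) (Output c' v') (Tag t) (return_pmf (\<Sigma>, \<rho>, R))" for c v c' v' t E R
  proof -
    have "c = c' \<and> v = v'" by (rule beside_output_unique[OF pl C left[OF E] right[OF R]])
    then have eq: "map_pmf (beside Q) E = return_pmf (\<Sigma>, \<rho>, Par P R)"
      using beside_step_unique[OF pl C left[OF E]] right[OF R] by blast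
    have st: "step (\<Sigma>, \<rho>, P) (Output c v) (Tag t) E" using E P by (simp add: typed_step_def)
    obtain S' \<rho>' P' where P': "(S', \<rho>', P') \<in> set_pmf E" using set_pmf_not_empty[of E] by auto
    then have "(S', \<rho>', Par P' Q) \<in> set_pmf (map_pmf (beside Q) E)" by force
    then have "P' = P" unfolding eq by simp
    then show False using step_psize[OF st P'] by simp
  qed
  show ?thesis
    using pa(1)
  proof (cases rule: partner_cases)
    case alone
    then show ?thesis using partner_alone_or_sync[OF pl C fr pa'] pa(2) by simp
  next
    case (out t t' c v)
    note o = out
    show ?thesis
      using pa'(1)
    proof (cases rule: partner_cases)
      case alone
      then show ?thesis using partner_alone_or_sync[OF pl C fr pa] pa'(2) by simp
    next
      case (out t2 t2' c2 v2)
      then show ?thesis using beside_output_unique[OF pl C left left, of c v t D c2 v2 D'] o pa(2) pa'(2) by simp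
    next
      case (inp t2 t2' c2 v2)
      then show ?thesis using mixed[of c v t D c2 v2 Q''] o pa(2) by simp
    qed
  next
    case (inp t t' c v)
    note i = inp
    show ?thesis
      using pa'(1)
    proof (cases rule: partner_cases)
      case alone
      then show ?thesis using partner_alone_or_sync[OF pl C fr pa] pa'(2) by simp
    next
      case (out t2 t2' c2 v2)
      then show ?thesis using mixed[of c2 v2 t2 D' c v Q'] i pa'(2) by simp
    next
      case (inp t2 t2' c2 v2)
      then show ?thesis using beside_output_unique[OF pl C right right, of c v t Q' c2 v2 Q''] i by simp
    qed
  qed
qed

section \<open>Combinations of bisimilar distributions in contexts\<close>

text \<open>The linear span of the pairs \<open>(B[\<Delta>], B[\<Theta>])\<close> with \<open>\<Delta> \<sim>\<^sub>l \<Theta>\<close>. Convex combinations would not do: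
  applying an operation renormalises, which may increase the weight of one component beyond 1.\<close>

inductive context_span :: "qubit set \<Rightarrow> qubit set \<Rightarrow> ((conf \<Rightarrow> real) \<Rightarrow> real) \<Rightarrow> ((conf \<Rightarrow> real) \<Rightarrow> real) \<Rightarrow> bool"
  for \<Sigma> U where
  span_zero: "context_span \<Sigma> U (\<lambda>\<phi>. 0) (\<lambda>\<phi>. 0)"
| span_add: "context_span \<Sigma> U F G \<Longrightarrow> context_span \<Sigma> U F' G' \<Longrightarrow>
    context_span \<Sigma> U (\<lambda>\<phi>. F \<phi> + F' \<phi>) (\<lambda>\<phi>. G \<phi> + G' \<phi>)"
| span_scale: "context_span \<Sigma> U F G \<Longrightarrow> context_span \<Sigma> U (\<lambda>\<phi>. a * F \<phi>) (\<lambda>\<phi>. a * G \<phi>)"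
| span_base: "(\<Delta>, \<Theta>) \<in> labelled_bisimilarity \<Longrightarrow> placed \<Sigma> \<Sigma>' U Q \<Delta> \<Longrightarrow> placed \<Sigma> \<Sigma>' U Q \<Theta> \<Longrightarrow>
    context_span \<Sigma> U (\<lambda>\<phi>. expect \<Delta> (\<lambda>C. \<phi> (beside Q C))) (\<lambda>\<phi>. expect \<Theta> (\<lambda>C. \<phi> (beside Q C)))"

lemma span_sum:
  "(\<And>i. i \<in> I \<Longrightarrow> context_span \<Sigma> U (F i) (G i)) \<Longrightarrow>
    context_span \<Sigma> U (\<lambda>\<phi>. \<Sum>i\<in>I. F i \<phi>) (\<lambda>\<phi>. \<Sum>i\<in>I. G i \<phi>)"
  by (induction I rule: infinite_finite_induct) (auto intro: span_zero span_add)

text \<open>For a spanning pair the test traces out \<open>U\<close>, not just the qubits \<Sigma>'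
  of the hole: tracing out the qubits of \<open>Q\<close> as well preserves equality of the reduced
  states.\<close>

lemma span_obs:
  assumes "context_span \<Sigma> U F G"
  shows "F (obs_re U A B) = G (obs_re U A B) \<and> F (obs_im U A B) = G (obs_im U A B)"
  using assms
proof induction
  case (span_base \<Delta> \<Theta> \<Sigma>' Q)
  have typed: "dist_typed \<Sigma> \<Sigma>' \<Delta>" "dist_typed \<Sigma> \<Sigma>' \<Theta>" and fin: "finite U" "\<Sigma>' \<subseteq> U"
    using span_base.hyps(2,3) by (auto simp: placed_def intro: finite_subset)
  have "partial_trace U (quantum_state \<Delta>) = partial_trace U (quantum_state \<Theta>)"
    using bisimilar_typed(1)[OF span_base.hyps(1) typed] by (rule partial_trace_mono_eq[OF fin])
  from expect_obs_eq[OF this, of A B] show ?case by simp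
qed auto

section \<open>Closure of the span under quantum operations\<close>

lemma expect_prob_zero:
  assumes "dist_typed \<Sigma> \<Sigma>' \<Delta>" "T \<subseteq> \<Sigma>" "trace_nonincreasing T E" "expect \<Delta> (conf_prob T E) = 0"
  shows "expect \<Delta> (\<lambda>C. conf_prob T E C * \<psi> C) = 0"
proof -
  have nonneg: "0 \<le> pmf \<Delta> x * case_option 0 (conf_prob T E) x" if "x \<in> set_pmf \<Delta>" for x
    using that conf_prob_nonneg[OF dist_typedD[OF assms(1)] assms(2,3)] by (cases x) auto
  have "conf_prob T E C = 0" if C: "Some C \<in> set_pmf \<Delta>" for C
    using sum_nonneg_0[OF dist_typed_finite[OF assms(1)] nonneg assms(4)[unfolded expect_def] C] C
    by (simp add: set_pmf_iff)
  then have "expect \<Delta> (\<lambda>C. conf_prob T E C * \<psi> C) = expect \<Delta> (\<lambda>C. 0)" by (intro expect_cong) simp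
  then show ?thesis by (simp add: expect_zero)
qed

text \<open>\<open>tag\<close> speaks only of configurations of nonzero probability, since the
  others vanish from the support. For the residual of a context after an outcome, tagging is known
  only for these.\<close>

lemma placed_effect:
  assumes app: "apply_dist (\<Sigma> - \<Sigma>') E X X'" and typed: "dist_typed \<Sigma> \<Sigma>' X"
    and E: "trace_nonincreasing (\<Sigma> - \<Sigma>') E"
    and R: "finite \<Sigma>" "\<Sigma>' \<subseteq> U" "U \<subseteq> \<Sigma>" "closed_proc R" "has_qubits (U - \<Sigma>') R"
    and tag: "\<And>S \<rho> P. Some (S, \<rho>, P) \<in> set_pmf X \<Longrightarrow> conf_prob (\<Sigma> - \<Sigma>') E (S, \<rho>, P) \<noteq> 0 \<Longrightarrow> well_tagged (Par P R)"
  shows "placed \<Sigma> \<Sigma>' U R X'"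
proof -
  note eff = apply_dist_expect[OF app typed Diff_subset E]
  have "dist_typed \<Sigma> \<Sigma>' X'"
    unfolding dist_typed_def
  proof (intro conjI allI impI)
    show "finite (set_pmf X')" by (rule eff(1))
    fix C' assume "Some C' \<in> set_pmf X'"
    from eff(2)[OF this] obtain C where "Some C \<in> set_pmf X" "conf_prob (\<Sigma> - \<Sigma>') E C \<noteq> 0"
      "C' = conf_post (\<Sigma> - \<Sigma>') E C" by blast
    then show "conf_typed \<Sigma> \<Sigma>' C'"
      using conf_post_typed[OF dist_typedD[OF typed] Diff_subset E] by blast
  qed
  moreover have "well_tagged (Par P R)" if "P \<in> procs X'" for P
  proof -
    from that obtain S \<rho> where "Some (S, \<rho>, P) \<in> set_pmf X'" by (auto simp: procs_def)
    from eff(2)[OF this] obtain C where C: "Some C \<in> set_pmf X" "conf_prob (\<Sigma> - \<Sigma>') E C \<noteq> 0"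
      "(S, \<rho>, P) = conf_post (\<Sigma> - \<Sigma>') E C" by blast
    then obtain \<rho>' where "C = (S, \<rho>', P)" by (cases C) (auto simp: conf_post_def)
    then show ?thesis using tag C by blast
  qed
  ultimately show ?thesis using R by (simp add: placed_def)
qed

text \<open>As a functional, the unnormalised image is the normalised one times probability over
  mass. Both quantities agree for \<Delta> and \<Theta>, so the pair is a multiple of a spanning
  pair; if the probability is 0, both functionals vanish. \<open>R\<close> need not be the process
  that was beside \<Delta> before: a measuring context changes along with the state.\<close>

lemma span_effect_base:
  assumes bis: "(\<Delta>, \<Theta>) \<in> labelled_bisimilarity"
    and typed: "dist_typed \<Sigma> \<Sigma>' \<Delta>" "dist_typed \<Sigma> \<Sigma>' \<Theta>" and E: "trace_nonincreasing (\<Sigma> - \<Sigma>') E"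
    and R: "finite \<Sigma>" "\<Sigma>' \<subseteq> U" "U \<subseteq> \<Sigma>" "closed_proc R" "has_qubits (U - \<Sigma>') R"
    and tag: "\<And>S \<rho> P. Some (S, \<rho>, P) \<in> set_pmf \<Delta> \<union> set_pmf \<Theta> \<Longrightarrow>
      conf_prob (\<Sigma> - \<Sigma>') E (S, \<rho>, P) \<noteq> 0 \<Longrightarrow> well_tagged (Par P R)"
  shows "context_span \<Sigma> U
    (\<lambda>\<phi>. expect \<Delta> (\<lambda>C. conf_prob (\<Sigma> - \<Sigma>') E C * \<phi> (beside R (conf_post (\<Sigma> - \<Sigma>') E C))))
    (\<lambda>\<phi>. expect \<Theta> (\<lambda>C. conf_prob (\<Sigma> - \<Sigma>') E C * \<phi> (beside R (conf_post (\<Sigma> - \<Sigma>') E C))))"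
proof -
  let ?T = "\<Sigma> - \<Sigma>'"
  note ptr = bisimilar_typed(1)[OF bis typed]
  have e: "expect \<Delta> (conf_prob ?T E) = expect \<Theta> (conf_prob ?T E)" by (rule expect_conf_prob_eq[OF typed E ptr])
  have m: "mass \<Delta> = mass \<Theta>" by (rule mass_eq[OF typed ptr])
  show ?thesis
  proof (cases "expect \<Delta> (conf_prob ?T E) = 0")
    case True
    then show ?thesis
      using e expect_prob_zero[OF typed(1) Diff_subset E] expect_prob_zero[OF typed(2) Diff_subset E]
      by (simp add: span_zero)
  next
    case False
    then have m0: "mass \<Delta> \<noteq> 0" using mass_zero[of \<Delta>] by auto
    from apply_dist_exists[OF typed(1) False] obtain \<Delta>' where \<Delta>': "apply_dist ?T E \<Delta> \<Delta>'" by blast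
    from apply_dist_exists[OF typed(2)] False e obtain \<Theta>' where \<Theta>': "apply_dist ?T E \<Theta> \<Theta>'" by auto
    have bis': "(\<Delta>', \<Theta>') \<in> labelled_bisimilarity" by (rule bisimilar_typed(2)[OF bis typed E \<Delta>' \<Theta>'])
    have "placed \<Sigma> \<Sigma>' U R \<Delta>'" "placed \<Sigma> \<Sigma>' U R \<Theta>'"
      using tag by (auto intro: placed_effect[OF \<Delta>' typed(1) E R] placed_effect[OF \<Theta>' typed(2) E R])
    from span_scale[OF span_base[OF bis' this], of "expect \<Delta> (conf_prob ?T E) / mass \<Delta>"]
    have span: "context_span \<Sigma> U
        (\<lambda>\<phi>. expect \<Delta> (conf_prob ?T E) / mass \<Delta> * expect \<Delta>' (\<lambda>C. \<phi> (beside R C)))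
        (\<lambda>\<phi>. expect \<Delta> (conf_prob ?T E) / mass \<Delta> * expect \<Theta>' (\<lambda>C. \<phi> (beside R C)))" .
    have "expect \<Delta> (conf_prob ?T E) / mass \<Delta> * expect \<Delta>' (\<lambda>C. \<phi> (beside R C)) =
        expect \<Delta> (\<lambda>C. conf_prob ?T E C * \<phi> (beside R (conf_post ?T E C)))" for \<phi>
      using apply_dist_expect(3)[OF \<Delta>' typed(1) Diff_subset E, of "\<lambda>C. \<phi> (beside R C)"] m0 by (simp add: divide_simps mult.commute)
    moreover have "expect \<Delta> (conf_prob ?T E) / mass \<Delta> * expect \<Theta>' (\<lambda>C. \<phi> (beside R C)) =
        expect \<Theta> (\<lambda>C. conf_prob ?T E C * \<phi> (beside R (conf_post ?T E C)))" for \<phi>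
      using apply_dist_expect(3)[OF \<Theta>' typed(2) Diff_subset E, of "\<lambda>C. \<phi> (beside R C)"] m0 unfolding e m
      by (simp add: divide_simps mult.commute)
    ultimately show ?thesis using span by simp
  qed
qed

lemma superop_sub_embed:
  assumes "finite S" "T \<subseteq> T'" "T' \<subseteq> S" "trace_nonincreasing T E"
  obtains E' where "trace_nonincreasing T' E'" "superop_sub S T E = superop_sub S T' E'"
proof -
  from assms(4) obtain Ks where Ks: "loewner_le T (kraus_gram T Ks) (op_id T)" "E = kraus T Ks"
    unfolding trace_nonincreasing_def by blast
  have fin: "finite T'" using assms(1,3) finite_subset by blast
  have "trace_nonincreasing T' (kraus T' (map (op_lift T' T (\<lambda>q. q)) Ks))"
    using assms(2) fin Ks by (intro trace_nonincreasing_lift) auto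
  moreover have "superop_sub S T E = superop_sub S T' (kraus T' (map (op_lift T' T (\<lambda>q. q)) Ks))"
    unfolding superop_sub_def[of S T] Ks(2) using assms by (intro superop_on_embed) auto
  ultimately show thesis by (rule that)
qed

text \<open>The operation touches no qubit of hole or context, so it commutes with placing
  \<open>Q\<close> beside the hole. It is then read as an operation on the larger set
  \<open>\<Sigma> - \<Sigma>'\<close>, for which bisimilarity of the spanning pair applies.\<close>

lemma span_effect:
  assumes "context_span \<Sigma> U F G" "trace_nonincreasing (\<Sigma> - U) E"
  shows "context_span \<Sigma> U (\<lambda>\<phi>. F (\<lambda>C. conf_prob (\<Sigma> - U) E C * \<phi> (conf_post (\<Sigma> - U) E C)))
    (\<lambda>\<phi>. G (\<lambda>C. conf_prob (\<Sigma> - U) E C * \<phi> (conf_post (\<Sigma> - U) E C)))"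
  using assms(1)
proof induction
  case (span_base \<Delta> \<Theta> \<Sigma>' Q)
  have pl: "finite \<Sigma>" "\<Sigma>' \<subseteq> U" "U \<subseteq> \<Sigma>" "closed_proc Q" "has_qubits (U - \<Sigma>') Q"
    and typed: "dist_typed \<Sigma> \<Sigma>' \<Delta>" "dist_typed \<Sigma> \<Sigma>' \<Theta>"
    using span_base.hyps(2,3) by (auto simp: placed_def)
  obtain E' where E': "trace_nonincreasing (\<Sigma> - \<Sigma>') E'" "superop_sub \<Sigma> (\<Sigma> - U) E = superop_sub \<Sigma> (\<Sigma> - \<Sigma>') E'"
    using superop_sub_embed[OF pl(1) _ _ assms(2), of "\<Sigma> - \<Sigma>'"] pl(2,3) by blast
  have same: "conf_prob (\<Sigma> - U) E C = conf_prob (\<Sigma> - \<Sigma>') E' C"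
    "conf_post (\<Sigma> - U) E C = conf_post (\<Sigma> - \<Sigma>') E' C" if "conf_typed \<Sigma> \<Sigma>' C" for C
    using that E'(2) by (cases C; simp add: conf_prob_def conf_post_def)+
  have eq: "expect X (\<lambda>C. conf_prob (\<Sigma> - U) E (beside Q C) * \<phi> (conf_post (\<Sigma> - U) E (beside Q C))) =
      expect X (\<lambda>C. conf_prob (\<Sigma> - \<Sigma>') E' C * \<phi> (beside Q (conf_post (\<Sigma> - \<Sigma>') E' C)))"
    if "dist_typed \<Sigma> \<Sigma>' X" for X \<phi>
    using same dist_typedD[OF that] by (intro expect_cong) simp
  have "well_tagged (Par P Q)" if "Some (S, \<rho>, P) \<in> set_pmf \<Delta> \<union> set_pmf \<Theta>" for S \<rho> P
    using that span_base.hyps(2,3) unfolding placed_def procs_def by blast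
  then show ?case
    unfolding eq[OF typed(1)] eq[OF typed(2)]
    by (intro span_effect_base[OF span_base.hyps(1) typed E'(1) pl])
qed (simp_all add: span_zero span_add span_scale)

section \<open>Closure of the span under moves\<close>

lemma expect_map_indexed:
  assumes "finite I" "\<And>m. m \<notin> I \<Longrightarrow> pmf W m = 0"
  shows "expect (map_pmf Some (map_pmf g W)) \<phi> = (\<Sum>m\<in>I. pmf W m * \<phi> (g m))"
proof -
  have sub: "set_pmf W \<subseteq> I"
  proof
    fix m assume "m \<in> set_pmf W"
    then have "pmf W m \<noteq> 0" by (simp add: set_pmf_iff)
    then show "m \<in> I" using assms(2) by blast
  qed
  then have fin: "finite (set_pmf W)" using assms(1) finite_subset by blast
  have "expect (map_pmf Some (map_pmf g W)) \<phi> = (\<Sum>m\<in>set_pmf W. pmf W m * \<phi> (g m))"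
    using fin by (simp add: expect_eq_integral map_pmf_comp integral_measure_pmf_real mult.commute)
  also have "\<dots> = (\<Sum>m\<in>I. pmf W m * \<phi> (g m))"
    using sub assms(1) by (intro sum.mono_neutral_left) (auto simp: set_pmf_iff)
  finally show ?thesis .
qed

text \<open>By determinism the move of the context is the only one of the composition for \<mu> and
  \<open>s\<close>, so the successor is the sum over its outcomes. The second claim supposes a
  nonzero probability because only then does the residual occur in a target.\<close>

lemma context_moves:
  assumes pl: "placed \<Sigma> \<Sigma>' U Q X" and fr: "fresh_input \<mu> U"
    and qs: "distinct qs" "set qs \<subseteq> U - \<Sigma>'" and inst: "instrument (length qs) I Ks"
    and re: "realises \<Sigma> Q \<mu> s qs I Ks R"
    and E: "\<And>m. superop_sub \<Sigma> (\<Sigma> - \<Sigma>') (E m) = branch \<Sigma> qs (Ks m)"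
    and C: "Some (S, \<rho>, P) \<in> set_pmf X"
  shows "expect (successor (Some (beside Q (S, \<rho>, P))) \<mu> s) \<phi> =
      (\<Sum>m\<in>I. conf_prob (\<Sigma> - \<Sigma>') (E m) (S, \<rho>, P) * \<phi> (beside (R m) (conf_post (\<Sigma> - \<Sigma>') (E m) (S, \<rho>, P))))"
    and "m \<in> I \<Longrightarrow> conf_prob (\<Sigma> - \<Sigma>') (E m) (S, \<rho>, P) \<noteq> 0 \<Longrightarrow> well_tagged (Par P (R m)) \<and>
      closed_proc (R m) \<and> has_qubits (owned_after \<mu> (U - \<Sigma>')) (R m) \<and>
      \<Sigma>' \<subseteq> owned_after \<mu> U \<and> owned_after \<mu> U \<subseteq> \<Sigma> \<and>
      owned_after \<mu> (U - \<Sigma>') = owned_after \<mu> U - \<Sigma>'"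
proof -
  from pl C obtain \<rho>' P' where C': "(S, \<rho>, P) = (\<Sigma>, \<rho>', P')" and P': "density_operator \<Sigma> \<rho>'" "has_qubits \<Sigma>' P'"
    "conf_typed \<Sigma> U (\<Sigma>, \<rho>', Par P' Q)" "well_tagged (Par P' Q)" by (elim placed_conf)
  have S: "S = \<Sigma>" and P: "density_operator \<Sigma> \<rho>" "has_qubits \<Sigma>' P" "conf_typed \<Sigma> U (\<Sigma>, \<rho>, Par P Q)"
    "well_tagged (Par P Q)" using C' P' by simp_all
  have fin: "finite \<Sigma>" and Q: "\<Sigma>' \<subseteq> U" "U \<subseteq> \<Sigma>" "closed_proc Q" "has_qubits (U - \<Sigma>') Q"
    using pl by (auto simp: placed_def)
  have qsS: "set qs \<subseteq> \<Sigma>" using qs(2) Q(2) by auto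
  from re P(1) obtain W where W: "\<And>m. pmf W m = (if m \<in> I then prob_of \<Sigma> (branch \<Sigma> qs (Ks m) \<rho>) else 0)"
    and st: "step (\<Sigma>, \<rho>, Q) \<mu> s (map_pmf (\<lambda>m. (\<Sigma>, normalised \<Sigma> (branch \<Sigma> qs (Ks m) \<rho>), R m)) W)"
    unfolding realises_def by blast
  define D where "D = map_pmf (\<lambda>m. (\<Sigma>, normalised \<Sigma> (branch \<Sigma> qs (Ks m) \<rho>), Par P (R m))) W"
  have setW: "m \<in> set_pmf W \<longleftrightarrow> m \<in> I \<and> prob_of \<Sigma> (branch \<Sigma> qs (Ks m) \<rho>) \<noteq> 0" for m
    by (simp add: set_pmf_iff W)
  have finI: "finite I" using inst by (simp add: instrument_def)
  have "set_pmf W \<subseteq> I" using setW by blast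
  then have finW: "finite (set_pmf W)" using finI finite_subset by blast
  have "\<not> takes_from P \<mu>" using takes_from_Input[OF P(2)] fr Q(1) by (auto simp: fresh_input_def)
  from step_par_right[OF st this] have stD: "step (\<Sigma>, \<rho>, Par P Q) \<mu> s D"
    by (simp add: D_def map_pmf_comp map_proc_def)
  have "typed_step (\<Sigma>, \<rho>, Par P Q) \<mu> s D"
  proof (rule typed_stepI[OF stD P(3)])
    show "\<forall>c q. \<mu> = Input c (QubitV q) \<longrightarrow> q \<notin> U" using fr by (simp add: fresh_input_def)
    show "finite (set_pmf D)" using finW by (simp add: D_def)
    fix S' \<rho>' P' assume "(S', \<rho>', P') \<in> set_pmf D"
    then obtain m where m: "m \<in> set_pmf W" "S' = \<Sigma>" "\<rho>' = normalised \<Sigma> (branch \<Sigma> qs (Ks m) \<rho>)"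
      by (auto simp: D_def)
    then show "density_operator S' \<rho>'"
      using density_normalised[OF fin branch_pos[OF fin qs(1) qsS P(1)]] setW by simp
  qed
  from successor_move[OF P(4) this]
  have succ: "successor (Some (beside Q (S, \<rho>, P))) \<mu> s = map_pmf Some D" by (simp add: S)
  have prob: "conf_prob (\<Sigma> - \<Sigma>') (E m) (S, \<rho>, P) = prob_of \<Sigma> (branch \<Sigma> qs (Ks m) \<rho>)" for m
    by (simp add: conf_prob_def S E)
  show "expect (successor (Some (beside Q (S, \<rho>, P))) \<mu> s) \<phi> =
      (\<Sum>m\<in>I. conf_prob (\<Sigma> - \<Sigma>') (E m) (S, \<rho>, P) * \<phi> (beside (R m) (conf_post (\<Sigma> - \<Sigma>') (E m) (S, \<rho>, P))))"
    unfolding succ D_def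
    by (subst expect_map_indexed[OF finI]) (simp_all add: W prob, simp add: conf_post_def S E)
  assume m: "m \<in> I" "conf_prob (\<Sigma> - \<Sigma>') (E m) (S, \<rho>, P) \<noteq> 0"
  then have mW: "m \<in> set_pmf W" by (simp add: setW prob)
  then have "(\<Sigma>, normalised \<Sigma> (branch \<Sigma> qs (Ks m) \<rho>), Par P (R m)) \<in> set_pmf D" by (auto simp: D_def)
  then have "Some (\<Sigma>, normalised \<Sigma> (branch \<Sigma> qs (Ks m) \<rho>), Par P (R m)) \<in> set_pmf (successor (Some (\<Sigma>, \<rho>, Par P Q)) \<mu> s)"
    using succ by (simp add: S)
  then have "proc_next (Par P Q) (Par P (R m))" by (rule successor_procs)
  then have 1: "well_tagged (Par P (R m))" using well_tagged_next P(4) by blast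
  have inp: "\<forall>c q. \<mu> = Input c (QubitV q) \<longrightarrow> q \<notin> U - \<Sigma>'" using fr by (auto simp: fresh_input_def)
  note ty = step_typed[OF st Q(4,3) inp]
  have "(\<Sigma>, normalised \<Sigma> (branch \<Sigma> qs (Ks m) \<rho>), R m) \<in>
      set_pmf (map_pmf (\<lambda>m. (\<Sigma>, normalised \<Sigma> (branch \<Sigma> qs (Ks m) \<rho>), R m)) W)" using mW by auto
  then have 2: "closed_proc (R m)" "has_qubits (owned_after \<mu> (U - \<Sigma>')) (R m)" using ty by blast+
  have "\<Sigma>' \<subseteq> owned_after \<mu> U \<and> owned_after \<mu> U \<subseteq> \<Sigma> \<and>
      owned_after \<mu> (U - \<Sigma>') = owned_after \<mu> U - \<Sigma>'"
  proof (cases \<mu>)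
    case (Output c v)
    then have "\<forall>q. v = QubitV q \<longrightarrow> q \<in> U - \<Sigma>'" using ty by blast
    then show ?thesis using Output Q(1,2) by (cases v) auto
  next
    case (Input c v)
    show ?thesis
    proof (cases v)
      case (QubitV q)
      then have "q \<in> \<Sigma>" "q \<notin> U" using st step_Input_in fr Input by (auto simp: fresh_input_def)
      then show ?thesis using Q(1,2) Input QubitV by auto
    qed (use Q(1,2) Input in auto)
  qed (use Q in auto)
  then show "well_tagged (Par P (R m)) \<and> closed_proc (R m) \<and> has_qubits (owned_after \<mu> (U - \<Sigma>')) (R m) \<and>
      \<Sigma>' \<subseteq> owned_after \<mu> U \<and> owned_after \<mu> U \<subseteq> \<Sigma> \<and>
      owned_after \<mu> (U - \<Sigma>') = owned_after \<mu> U - \<Sigma>'" using 1 2 by blast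
qed

text \<open>Each outcome is an operation on qubits outside the hole together with a change of
  context, so the functional is a finite sum of terms covered by
  \<open>span_effect_base\<close>.\<close>

lemma span_step_context_moves:
  assumes bis: "(\<Delta>, \<Theta>) \<in> labelled_bisimilarity"
    and pl: "placed \<Sigma> \<Sigma>' U Q \<Delta>" "placed \<Sigma> \<Sigma>' U Q \<Theta>" and fr: "fresh_input \<mu> U"
    and st: "step (\<Sigma>, \<rho>, Q) \<mu> s D"
  shows "context_span \<Sigma> (owned_after \<mu> U)
    (\<lambda>\<phi>. expect \<Delta> (\<lambda>C. expect (successor (Some (beside Q C)) \<mu> s) \<phi>))
    (\<lambda>\<phi>. expect \<Theta> (\<lambda>C. expect (successor (Some (beside Q C)) \<mu> s) \<phi>))"
proof -
  have fin: "finite \<Sigma>" and Q: "\<Sigma>' \<subseteq> U" "U \<subseteq> \<Sigma>" "has_qubits (U - \<Sigma>') Q"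
    and typed: "dist_typed \<Sigma> \<Sigma>' \<Delta>" "dist_typed \<Sigma> \<Sigma>' \<Theta>" using pl by (auto simp: placed_def)
  have "U - \<Sigma>' \<subseteq> \<Sigma>" using Q by auto
  from step_realises[OF fin st Q(3) this] obtain qs I Ks R where qs: "distinct qs" "set qs \<subseteq> U - \<Sigma>'"
    and inst: "instrument (length qs) I Ks" and re: "realises \<Sigma> Q \<mu> s qs I Ks R" by blast
  let ?T = "\<Sigma> - \<Sigma>'"
  \<comment> \<open>The Kraus operators of \<open>Q\<close>, given on its tuple, extended by the
    identity to all qubits outside the hole.\<close>
  define E where "E = (\<lambda>m. kraus ?T (map (op_lift ?T {..<length qs} (\<lambda>i. qs ! i)) (Ks m)))"
  note inj = nth_inj_image[OF qs(1)]
  have qsT: "(\<lambda>i. qs ! i) ` {..<length qs} \<subseteq> ?T" using inj(2) qs(2) Q(2) by auto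
  have E: "superop_sub \<Sigma> ?T (E m) = branch \<Sigma> qs (Ks m)" for m
    unfolding E_def branch_def superop_tuple_def
    by (rule superop_on_embed[OF fin inj(1) qsT Diff_subset, symmetric])
  have En: "trace_nonincreasing ?T (E m)" if "m \<in> I" for m
    unfolding E_def using fin by (intro trace_nonincreasing_lift[OF _ inj(1) qsT] instrument_nonincreasing[OF inst that]) simp
  have sum: "expect X (\<lambda>C. expect (successor (Some (beside Q C)) \<mu> s) \<phi>) =
      (\<Sum>m\<in>I. expect X (\<lambda>C. conf_prob ?T (E m) C * \<phi> (beside (R m) (conf_post ?T (E m) C))))"
    if X: "placed \<Sigma> \<Sigma>' U Q X" for X \<phi>
  proof -
    have "expect X (\<lambda>C. expect (successor (Some (beside Q C)) \<mu> s) \<phi>) =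
        expect X (\<lambda>C. \<Sum>m\<in>I. conf_prob ?T (E m) C * \<phi> (beside (R m) (conf_post ?T (E m) C)))"
    proof (rule expect_cong)
      fix C assume C: "Some C \<in> set_pmf X"
      obtain S \<rho> P where C': "C = (S, \<rho>, P)" by (cases C)
      show "expect (successor (Some (beside Q C)) \<mu> s) \<phi> =
          (\<Sum>m\<in>I. conf_prob ?T (E m) C * \<phi> (beside (R m) (conf_post ?T (E m) C)))"
        unfolding C' by (rule context_moves(1)[OF X fr qs inst re E C[unfolded C']])
    qed
    then show ?thesis by (simp only: expect_sum)
  qed
  have "context_span \<Sigma> (owned_after \<mu> U)
      (\<lambda>\<phi>. expect \<Delta> (\<lambda>C. conf_prob ?T (E m) C * \<phi> (beside (R m) (conf_post ?T (E m) C))))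
      (\<lambda>\<phi>. expect \<Theta> (\<lambda>C. conf_prob ?T (E m) C * \<phi> (beside (R m) (conf_post ?T (E m) C))))" if m: "m \<in> I" for m
  proof (cases "\<exists>S \<rho> P. Some (S, \<rho>, P) \<in> set_pmf \<Delta> \<union> set_pmf \<Theta> \<and> conf_prob ?T (E m) (S, \<rho>, P) \<noteq> 0")
    case True
    have facts: "well_tagged (Par P (R m)) \<and>
      closed_proc (R m) \<and> has_qubits (owned_after \<mu> (U - \<Sigma>')) (R m) \<and>
      \<Sigma>' \<subseteq> owned_after \<mu> U \<and> owned_after \<mu> U \<subseteq> \<Sigma> \<and>
      owned_after \<mu> (U - \<Sigma>') = owned_after \<mu> U - \<Sigma>'"
      if "Some (S, \<rho>, P) \<in> set_pmf \<Delta> \<union> set_pmf \<Theta>" "conf_prob ?T (E m) (S, \<rho>, P) \<noteq> 0" for S \<rho> P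
      using that(1) context_moves(2)[OF pl(1) fr qs inst re E _ m that(2)]
        context_moves(2)[OF pl(2) fr qs inst re E _ m that(2)] by blast
    from True obtain S \<rho> P where C: "Some (S, \<rho>, P) \<in> set_pmf \<Delta> \<union> set_pmf \<Theta>" "conf_prob ?T (E m) (S, \<rho>, P) \<noteq> 0"
      by blast
    have R: "\<Sigma>' \<subseteq> owned_after \<mu> U" "owned_after \<mu> U \<subseteq> \<Sigma>" "closed_proc (R m)"
      "has_qubits (owned_after \<mu> U - \<Sigma>') (R m)" using facts[OF C] by metis+
    show ?thesis
      by (rule span_effect_base[OF bis typed En[OF m] fin R]) (rule facts[THEN conjunct1])
  next
    case False
    \<comment> \<open>The outcome never occurs; nothing is known about \<open>R m\<close>, but both
      functionals are 0.\<close>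
    have "expect X (\<lambda>C. conf_prob ?T (E m) C * \<phi> (beside (R m) (conf_post ?T (E m) C))) = expect X (\<lambda>C. 0)"
      if "set_pmf X \<subseteq> set_pmf \<Delta> \<union> set_pmf \<Theta>" for X \<phi>
    proof (rule expect_cong)
      fix C assume "Some C \<in> set_pmf X"
      then have "Some C \<in> set_pmf \<Delta> \<union> set_pmf \<Theta>" using that by blast
      then have "conf_prob ?T (E m) C = 0" using False by (cases C) blast
      then show "conf_prob ?T (E m) C * \<phi> (beside (R m) (conf_post ?T (E m) C)) = 0" by simp
    qed
    then show ?thesis by (simp add: expect_zero span_zero)
  qed
  from span_sum[OF this] show ?thesis by (simp add: sum[OF pl(1)] sum[OF pl(2)])
qed

text \<open>Configurations may answer the same scheduler with different labels \<nu>, so the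
  distribution is pushed through each label in turn. A configuration without a move for \<nu> goes
  to \<bottom> and counts 0; by \<open>partner_unique\<close> it survives for at most one \<nu>, and
  there its successor yields that of the composition. Bisimilarity applies to each summand.\<close>

lemma span_step_process_moves:
  assumes bis: "(\<Delta>, \<Theta>) \<in> labelled_bisimilarity"
    and pl: "placed \<Sigma> \<Sigma>' U Q \<Delta>" "placed \<Sigma> \<Sigma>' U Q \<Theta>" and fr: "fresh_input \<mu> U"
    and not_alone: "\<And>\<rho> D. density_operator \<Sigma> \<rho> \<Longrightarrow> \<not> step (\<Sigma>, \<rho>, Q) \<mu> s D"
  shows "context_span \<Sigma> (owned_after \<mu> U)
    (\<lambda>\<phi>. expect \<Delta> (\<lambda>C. expect (successor (Some (beside Q C)) \<mu> s) \<phi>))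
    (\<lambda>\<phi>. expect \<Theta> (\<lambda>C. expect (successor (Some (beside Q C)) \<mu> s) \<phi>))"
proof -
  define live where "live = (\<lambda>C \<nu>. \<exists>u Q' D. partner \<Sigma> Q \<mu> s \<nu> u Q' \<and> typed_step C \<nu> u D)"
  define A where "A = {C. Some C \<in> set_pmf \<Delta> \<union> set_pmf \<Theta>}"
  define N where "N = {\<nu>. \<exists>C\<in>A. live C \<nu>}"
  \<comment> \<open>\<nu> determines the scheduler (\<open>partner_sched\<close>) but not directly
    the residual of \<open>Q\<close>; any choice works, since \<open>partner_step\<close> holds for
    every residual.\<close>
  define choice where "choice = (\<lambda>\<nu>. SOME x. partner \<Sigma> Q \<mu> s \<nu> (fst x) (snd x))"
  define u where "u = (\<lambda>\<nu>. fst (choice \<nu>))"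
  define q where "q = (\<lambda>\<nu>. snd (choice \<nu>))"
  have placedA: "\<exists>X. placed \<Sigma> \<Sigma>' U Q X \<and> Some C \<in> set_pmf X" if "C \<in> A" for C
    using that pl by (auto simp: A_def)
  have live_unique: "\<nu> = \<nu>'" if "C \<in> A" "live C \<nu>" "live C \<nu>'" for C \<nu> \<nu>'
    using placedA[OF that(1)] that(2,3) partner_unique[OF _ _ fr] unfolding live_def by blast
  have chosen: "partner \<Sigma> Q \<mu> s \<nu> (u \<nu>) (q \<nu>)" if "partner \<Sigma> Q \<mu> s \<nu> u' Q'" for \<nu> u' Q'
  proof -
    have "\<exists>x. partner \<Sigma> Q \<mu> s \<nu> (fst x) (snd x)" using that by auto
    from someI_ex[OF this] show ?thesis by (simp add: choice_def u_def q_def)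
  qed
  have live_iff: "live C \<nu> \<longleftrightarrow> partner \<Sigma> Q \<mu> s \<nu> (u \<nu>) (q \<nu>) \<and> (\<exists>D. typed_step C \<nu> (u \<nu>) D)" for C \<nu>
  proof
    assume "live C \<nu>"
    then obtain u' Q' D where pa: "partner \<Sigma> Q \<mu> s \<nu> u' Q'" and D: "typed_step C \<nu> u' D"
      unfolding live_def by blast
    note c = chosen[OF pa]
    show "partner \<Sigma> Q \<mu> s \<nu> (u \<nu>) (q \<nu>) \<and> (\<exists>D. typed_step C \<nu> (u \<nu>) D)"
      using c D partner_sched[OF pa c] by blast
  next
    assume "partner \<Sigma> Q \<mu> s \<nu> (u \<nu>) (q \<nu>) \<and> (\<exists>D. typed_step C \<nu> (u \<nu>) D)"
    then show "live C \<nu>" unfolding live_def by (elim conjE exE) (intro exI conjI)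
  qed
  have finA: "finite A"
  proof -
    have "Some ` A \<subseteq> set_pmf \<Delta> \<union> set_pmf \<Theta>" by (auto simp: A_def)
    moreover have "finite (set_pmf \<Delta> \<union> set_pmf \<Theta>)" using bisimilar_tagged(1,2)[OF bis] by simp
    ultimately have "finite (Some ` A)" by (rule finite_subset)
    then show ?thesis by (rule finite_imageD) simp
  qed
  \<comment> \<open>There is at most one live label for each of finitely many configurations, so the
    sum over labels is finite.\<close>
  have "finite {\<nu>. live C \<nu>}" if "C \<in> A" for C
  proof (cases "\<exists>\<nu>. live C \<nu>")
    case True
    then obtain \<nu> where "live C \<nu>" by blast
    then have "{\<nu>. live C \<nu>} \<subseteq> {\<nu>}" using live_unique[OF that] by blast
    then show ?thesis by (rule finite_subset) simp
  qed simp
  then have "finite (\<Union>C\<in>A. {\<nu>. live C \<nu>})" using finA by blast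
  moreover have "N = (\<Union>C\<in>A. {\<nu>. live C \<nu>})" by (auto simp: N_def)
  ultimately have finN: "finite N" by simp
  have split: "expect (successor (Some (beside Q C)) \<mu> s) \<phi> =
      (\<Sum>\<nu>\<in>N. expect (successor (Some C) \<nu> (u \<nu>)) (\<lambda>C. \<phi> (beside (q \<nu>) C)))" if CA: "C \<in> A" for C \<phi>
  proof -
    from placedA[OF CA] obtain X where X: "placed \<Sigma> \<Sigma>' U Q X" "Some C \<in> set_pmf X" by blast
    have dead: "expect (successor (Some C) \<nu> (u \<nu>)) \<psi> = 0" if "\<nu> \<in> N" "\<not> live C \<nu>" for \<nu> \<psi>
    proof -
      from that(1) obtain C' where "live C' \<nu>" by (auto simp: N_def)
      then have "\<nexists>D. typed_step C \<nu> (u \<nu>) D" using that(2) live_iff by blast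
      then show ?thesis by (simp add: successor_stuck)
    qed
    show ?thesis
    proof (cases "\<exists>\<nu>. live C \<nu>")
      case True
      then obtain \<nu> where \<nu>: "live C \<nu>" by blast
      then obtain D where pa: "partner \<Sigma> Q \<mu> s \<nu> (u \<nu>) (q \<nu>)" and D: "typed_step C \<nu> (u \<nu>) D" using live_iff by blast
      from X obtain \<rho> P where P: "C = (\<Sigma>, \<rho>, P)" "well_tagged (Par P Q)" by (elim placed_conf)
      have "P \<in> procs \<Delta> \<union> procs \<Theta>" using CA P(1) by (auto simp: A_def procs_def)
      then have "well_tagged P" using bisimilar_tagged(5,6)[OF bis] by blast
      from successor_move[OF this D[unfolded P(1)]] have s1: "successor (Some C) \<nu> (u \<nu>) = map_pmf Some D" by (simp add: P(1))
      have s2: "successor (Some (beside Q C)) \<mu> s = map_pmf Some (map_pmf (beside (q \<nu>)) D)"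
        using successor_move[OF P(2)] partner_step[OF X fr pa D] by (simp add: P(1))
      have "map_pmf Some (map_pmf (beside (q \<nu>)) D) = map_pmf (map_option (beside (q \<nu>))) (map_pmf Some D)"
        by (simp add: map_pmf_comp)
      then have "expect (successor (Some (beside Q C)) \<mu> s) \<phi> = expect (successor (Some C) \<nu> (u \<nu>)) (\<lambda>C. \<phi> (beside (q \<nu>) C))"
        unfolding s1 s2 using typed_step_density(1)[OF D] by (simp add: expect_map)
      moreover have "\<nu> \<in> N" using \<nu> CA by (auto simp: N_def)
      moreover have "(\<Sum>\<nu>'\<in>N - {\<nu>}. expect (successor (Some C) \<nu>' (u \<nu>')) (\<lambda>C. \<phi> (beside (q \<nu>') C))) = 0"
        using dead live_unique[OF CA \<nu>] by (intro sum.neutral) blast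
      ultimately show ?thesis using finN by (simp add: sum.remove)
    next
      case False
      then have "\<nexists>D'. typed_step (beside Q C) \<mu> s D'"
        using partner_complete[OF X fr not_alone] unfolding live_def by blast
      then have "expect (successor (Some (beside Q C)) \<mu> s) \<phi> = 0" by (simp add: successor_stuck)
      then show ?thesis using dead False by simp
    qed
  qed
  have sum: "expect X (\<lambda>C. expect (successor (Some (beside Q C)) \<mu> s) \<phi>) =
      (\<Sum>\<nu>\<in>N. expect (next_dist X \<nu> (return_pmf (u \<nu>))) (\<lambda>C. \<phi> (beside (q \<nu>) C)))"
    if X: "set_pmf X \<subseteq> set_pmf \<Delta> \<union> set_pmf \<Theta>" "finite (set_pmf X)" for X \<phi>
  proof -
    have "expect X (\<lambda>C. expect (successor (Some (beside Q C)) \<mu> s) \<phi>) =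
        expect X (\<lambda>C. \<Sum>\<nu>\<in>N. expect (successor (Some C) \<nu> (u \<nu>)) (\<lambda>C. \<phi> (beside (q \<nu>) C)))"
      using X split by (intro expect_cong) (auto simp: A_def)
    then show ?thesis using X(2) by (simp only: expect_sum next_dist_return)
  qed
  have "context_span \<Sigma> (owned_after \<mu> U)
      (\<lambda>\<phi>. expect (next_dist \<Delta> \<nu> (return_pmf (u \<nu>))) (\<lambda>C. \<phi> (beside (q \<nu>) C)))
      (\<lambda>\<phi>. expect (next_dist \<Theta> \<nu> (return_pmf (u \<nu>))) (\<lambda>C. \<phi> (beside (q \<nu>) C)))" if "\<nu> \<in> N" for \<nu>
  proof -
    from that obtain C0 where C0: "C0 \<in> A" "live C0 \<nu>" by (auto simp: N_def)
    then obtain D0 where pa: "partner \<Sigma> Q \<mu> s \<nu> (u \<nu>) (q \<nu>)" and D0: "typed_step C0 \<nu> (u \<nu>) D0" using live_iff by blast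
    from placedA[OF C0(1)] obtain X0 where X0: "placed \<Sigma> \<Sigma>' U Q X0" "Some C0 \<in> set_pmf X0" by blast
    note ty = partner_typed[OF X0 fr pa D0]
    have "placed \<Sigma> (owned_after \<nu> \<Sigma>') (owned_after \<mu> U) (q \<nu>) (next_dist X \<nu> (return_pmf (u \<nu>)))"
      if X: "placed \<Sigma> \<Sigma>' U Q X" for X
    proof -
      have "dist_typed \<Sigma> (owned_after \<nu> \<Sigma>') (next_dist X \<nu> (return_pmf (u \<nu>)))"
        using X by (intro next_dist_typed) (auto simp: placed_def)
      moreover have "well_tagged (Par P' (q \<nu>))" if "P' \<in> procs (next_dist X \<nu> (return_pmf (u \<nu>)))" for P'
      proof -
        from that obtain S' \<rho>' x where x: "x \<in> set_pmf X" "Some (S', \<rho>', P') \<in> set_pmf (successor x \<nu> (u \<nu>))"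
          by (auto simp: procs_def set_next_dist)
        then obtain C where C: "x = Some C" by (cases x) auto
        with x(2) obtain D where D: "typed_step C \<nu> (u \<nu>) D" "(S', \<rho>', P') \<in> set_pmf D"
          by (cases rule: successor_cases[of C \<nu> "u \<nu>"]) auto
        have CX: "Some C \<in> set_pmf X" using x C by simp
        from X CX obtain \<rho> P where P: "C = (\<Sigma>, \<rho>, P)" "well_tagged (Par P Q)" by (elim placed_conf)
        \<comment> \<open>The tagging of the new composition is inherited along the corresponding
          move of the whole.\<close>
        have st: "typed_step (\<Sigma>, \<rho>, Par P Q) \<mu> s (map_pmf (beside (q \<nu>)) D)"
          using partner_step[OF X CX fr pa D(1)] by (simp add: P(1))
        have "(S', \<rho>', Par P' (q \<nu>)) \<in> set_pmf (map_pmf (beside (q \<nu>)) D)" using D(2) by force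
        with st have "proc_next (Par P Q) (Par P' (q \<nu>))" unfolding proc_next_def by blast
        then show ?thesis using well_tagged_next P(2) by blast
      qed
      ultimately show ?thesis using X ty by (simp add: placed_def)
    qed
    then show ?thesis using pl by (intro span_base[OF bisimilar_next[OF bis]]) auto
  qed
  from span_sum[OF this] show ?thesis
    using bisimilar_tagged(1,2)[OF bis] by (simp add: sum)
qed

lemma span_step:
  assumes "context_span \<Sigma> U F G"
  shows "context_span \<Sigma> (owned_after \<mu> U)
    (\<lambda>\<phi>. F (\<lambda>C. expect (successor (Some C) \<mu> s) \<phi>)) (\<lambda>\<phi>. G (\<lambda>C. expect (successor (Some C) \<mu> s) \<phi>))"
  using assms
proof induction
  case (span_base \<Delta> \<Theta> \<Sigma>' Q)
  show ?case
  proof (cases "fresh_input \<mu> U")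
    case True
    show ?thesis
    \<comment> \<open>The split needs no reference to the configurations: by
      \<open>step_realises\<close>, one state in which \<open>Q\<close> moves alone gives the move
      in all of them.\<close>
    proof (cases "\<exists>\<rho> D. step (\<Sigma>, \<rho>, Q) \<mu> s D")
      case True
      then show ?thesis using span_step_context_moves[OF span_base.hyps \<open>fresh_input \<mu> U\<close>] by blast
    next
      case False
      then show ?thesis using span_step_process_moves[OF span_base.hyps \<open>fresh_input \<mu> U\<close>] by blast
    qed
  next
    case False
    then obtain c q where mu: "\<mu> = Input c (QubitV q)" "q \<in> U" by (auto simp: fresh_input_def)
    \<comment> \<open>Reception of a qubit already owned by hole or context has no typed target, so
      both functionals vanish.\<close>
    have "expect X (\<lambda>C. expect (successor (Some (beside Q C)) \<mu> s) \<phi>) = expect X (\<lambda>C. 0)"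
      if X: "placed \<Sigma> \<Sigma>' U Q X" for X \<phi>
    proof (rule expect_cong)
      fix C assume "Some C \<in> set_pmf X"
      with X obtain \<rho> P where P: "C = (\<Sigma>, \<rho>, P)" "conf_typed \<Sigma> U (\<Sigma>, \<rho>, Par P Q)" by (elim placed_conf)
      then have "\<nexists>D. typed_step (beside Q C) \<mu> s D" using typed_step_typed(2)[OF _ P(2)] mu by (metis beside_simp)
      then show "expect (successor (Some (beside Q C)) \<mu> s) \<phi> = 0" by (simp add: successor_stuck)
    qed
    then show ?thesis using span_base.hyps by (simp add: expect_zero span_zero)
  qed
qed (simp_all add: span_zero span_add span_scale)

section \<open>Bisimilarity in contexts\<close>

text \<open>The span contains functionals that are not distributions, so typing and tagging are
  required of the two ends as well. The type \<open>U\<close> of the whole is shared, while the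
  boundary between hole and context may differ among the summands.\<close>

definition context_related :: "dist rel" where
  "context_related = {(X, Y). \<exists>\<Sigma> U. dist_typed \<Sigma> U X \<and> dist_typed \<Sigma> U Y \<and>
     deterministically_tagged X \<and> deterministically_tagged Y \<and> context_span \<Sigma> U (expect X) (expect Y)}"

lemma related_next:
  assumes "(X, Y) \<in> context_related" "finite (set_pmf \<delta>)"
  shows "(next_dist X \<mu> \<delta>, next_dist Y \<mu> \<delta>) \<in> context_related"
proof -
  from assms(1) obtain \<Sigma> U where typed: "dist_typed \<Sigma> U X" "dist_typed \<Sigma> U Y"
    and dt: "deterministically_tagged X" "deterministically_tagged Y"
    and span: "context_span \<Sigma> U (expect X) (expect Y)" unfolding context_related_def by blast
  have "deterministically_tagged (next_dist Z \<mu> \<delta>)" if "deterministically_tagged Z" for Z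
    using that next_dist_procs well_tagged_next unfolding deterministically_tagged_iff by blast
  moreover have "context_span \<Sigma> (owned_after \<mu> U) (expect (next_dist X \<mu> \<delta>)) (expect (next_dist Y \<mu> \<delta>))"
  proof -
    have "expect (next_dist Z \<mu> \<delta>) = (\<lambda>\<phi>. \<Sum>s\<in>set_pmf \<delta>. pmf \<delta> s * expect Z (\<lambda>C. expect (successor (Some C) \<mu> s) \<phi>))"
      if "dist_typed \<Sigma> U Z" for Z
      using expect_next_dist[OF dist_typed_finite[OF that] assms(2)] by blast
    then show ?thesis using typed span by (simp add: span_sum span_scale span_step)
  qed
  ultimately show ?thesis
    unfolding context_related_def using dt typed next_dist_typed assms(2) by blast
qed

text \<open>Renormalisation multiplies both ends by the same factor, mass over probability, since
  both quantities are determined by the reduced state. The factor may exceed 1, which a linear span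
  absorbs.\<close>

lemma related_effect:
  assumes typed: "dist_typed \<Sigma> U X" "dist_typed \<Sigma> U Y"
    and dt: "deterministically_tagged X" "deterministically_tagged Y"
    and span: "context_span \<Sigma> U (expect X) (expect Y)"
    and ptr: "partial_trace U (quantum_state X) = partial_trace U (quantum_state Y)"
    and E: "trace_nonincreasing (\<Sigma> - U) E"
    and app: "apply_dist (\<Sigma> - U) E X X'" "apply_dist (\<Sigma> - U) E Y Y'"
  shows "(X', Y') \<in> context_related"
proof -
  let ?T = "\<Sigma> - U"
  have m: "mass X = mass Y" by (rule mass_eq[OF typed ptr])
  have e: "expect X (conf_prob ?T E) = expect Y (conf_prob ?T E)" by (rule expect_conf_prob_eq[OF typed E ptr])
  have post: "dist_typed \<Sigma> U Z' \<and> deterministically_tagged Z'"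
    if Z: "dist_typed \<Sigma> U Z" "deterministically_tagged Z" "apply_dist ?T E Z Z'" for Z Z'
  proof -
    note eff = apply_dist_expect[OF Z(3,1) Diff_subset E]
    have "dist_typed \<Sigma> U Z'"
      unfolding dist_typed_def
      using eff(1) eff(2) conf_post_typed[OF dist_typedD[OF Z(1)] Diff_subset E] by blast
    moreover have "procs Z' \<subseteq> procs Z"
    proof
      fix P assume "P \<in> procs Z'"
      then obtain S \<rho> where "Some (S, \<rho>, P) \<in> set_pmf Z'" by (auto simp: procs_def)
      from eff(2)[OF this] obtain C where "Some C \<in> set_pmf Z" "(S, \<rho>, P) = conf_post ?T E C" by blast
      then show "P \<in> procs Z" by (cases C) (auto simp: conf_post_def procs_def)
    qed
    ultimately show ?thesis using Z(2) by (auto simp: deterministically_tagged_iff)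
  qed
  have "context_span \<Sigma> U (expect X') (expect Y')"
  proof (cases "mass X = 0")
    case True
    \<comment> \<open>Here the success probability is 0 and \<open>apply_dist_expect\<close> gives
      no formula; but both ends are \<bottom>.\<close>
    then have "X = return_pmf None" "Y = return_pmf None" using m mass_zero by auto
    then have "X' = return_pmf None" "Y' = return_pmf None" using app apply_dist_bot by auto
    moreover have "expect (return_pmf None) = (\<lambda>\<phi>. 0)" by (simp add: fun_eq_iff)
    ultimately show ?thesis by (simp add: span_zero)
  next
    case False
    have e0: "expect X (conf_prob ?T E) \<noteq> 0" using apply_dist_expect(4)[OF app(1) typed(1) Diff_subset E False] .
    have "expect Z' = (\<lambda>\<phi>. mass X / expect X (conf_prob ?T E) * expect Z (\<lambda>C. conf_prob ?T E C * \<phi> (conf_post ?T E C)))"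
      if "apply_dist ?T E Z Z'" "dist_typed \<Sigma> U Z" "mass Z = mass X" "expect Z (conf_prob ?T E) = expect X (conf_prob ?T E)" for Z Z'
    proof
      fix \<phi>
      show "expect Z' \<phi> = mass X / expect X (conf_prob ?T E) * expect Z (\<lambda>C. conf_prob ?T E C * \<phi> (conf_post ?T E C))"
        using apply_dist_expect(3)[OF that(1,2) Diff_subset E, of \<phi>] that(3,4) e0 by (simp add: divide_simps mult.commute)
    qed
    note eq = this[OF app(1) typed(1) refl refl] this[OF app(2) typed(2) m[symmetric] e[symmetric]]
    show ?thesis unfolding eq by (rule span_scale[OF span_effect[OF span E]])
  qed
  then show ?thesis
    unfolding context_related_def using post typed dt app by blast
qed

lemma labelled_bisimulation_context_related: "labelled_bisimulation context_related"
  unfolding labelled_bisimulation_def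
proof (intro ballI, clarify, intro conjI allI impI)
  fix X Y assume rel: "(X, Y) \<in> context_related"
  then obtain \<Sigma> U where typed: "dist_typed \<Sigma> U X" "dist_typed \<Sigma> U Y"
    and dt: "deterministically_tagged X" "deterministically_tagged Y"
    and span: "context_span \<Sigma> U (expect X) (expect Y)" unfolding context_related_def by blast
  have ptr: "partial_trace U (quantum_state X) = partial_trace U (quantum_state Y)"
    by (intro ext) (simp add: partial_trace_quantum_state span_obs[OF span])
  have trans: "dist_trans Z \<mu> \<delta> Z' \<longleftrightarrow> finite (set_pmf \<delta>) \<and> Z' = next_dist Z \<mu> \<delta>"
    if "dist_typed \<Sigma> U Z" "deterministically_tagged Z" for Z Z' \<mu> \<delta>
  proof -
    have "well_typed Z" using that(1) unfolding well_typed_def by blast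
    then show ?thesis
      using that by (intro dist_trans_iff dist_typed_finite unique_successorsI) (simp_all add: deterministically_tagged_iff)
  qed
  show "deterministically_tagged X" "deterministically_tagged Y" by (rule dt)+
  show "\<exists>\<Sigma> \<Sigma>'. dist_typed \<Sigma> \<Sigma>' X \<and> dist_typed \<Sigma> \<Sigma>' Y \<and>
       partial_trace \<Sigma>' (quantum_state X) = partial_trace \<Sigma>' (quantum_state Y) \<and>
       (\<forall>E X' Y'. trace_nonincreasing (\<Sigma> - \<Sigma>') E \<and>
          apply_dist (\<Sigma> - \<Sigma>') E X X' \<and> apply_dist (\<Sigma> - \<Sigma>') E Y Y' \<longrightarrow> (X', Y') \<in> context_related)"
    using typed ptr related_effect[OF typed dt span ptr] by blast
  fix \<mu> \<delta>
  show "\<exists>Y'. dist_trans Y \<mu> \<delta> Y' \<and> (X', Y') \<in> context_related" if "dist_trans X \<mu> \<delta> X'" for X'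
    using that related_next[OF rel] unfolding trans[OF typed(1) dt(1)] trans[OF typed(2) dt(2)] by blast
  show "\<exists>X'. dist_trans X \<mu> \<delta> X' \<and> (X', Y') \<in> context_related" if "dist_trans Y \<mu> \<delta> Y'" for Y'
    using that related_next[OF rel] unfolding trans[OF typed(1) dt(1)] trans[OF typed(2) dt(2)] by blast
qed

text \<open>The two distributions in context form a single spanning pair, so congruence follows by
  coinduction from the bisimulation on the span.\<close>

lemma bisimilar_in_context:
  assumes bis: "(\<Delta>, \<Theta>) \<in> labelled_bisimilarity"
    and typed: "dist_typed \<Sigma> \<Sigma>' \<Delta>" "dist_typed \<Sigma> \<Sigma>' \<Theta>"
    and Q: "context_typed U Q \<Sigma>'" "U \<subseteq> \<Sigma>"
    and dt: "deterministically_tagged (in_context Q \<Delta>)" "deterministically_tagged (in_context Q \<Theta>)"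
  shows "(in_context Q \<Delta>, in_context Q \<Theta>) \<in> labelled_bisimilarity"
proof -
  have ic: "in_context Q = map_pmf (map_option (beside Q))" by (simp add: in_context_def beside_def fun_eq_iff)
  have typed': "dist_typed \<Sigma> U (in_context Q X)" if "dist_typed \<Sigma> \<Sigma>' X" for X
    unfolding dist_typed_def
  proof (intro conjI allI impI)
    show "finite (set_pmf (in_context Q X))" using dist_typed_finite[OF that] by (simp add: ic)
    fix C assume "Some C \<in> set_pmf (in_context Q X)"
    then obtain C' where "Some C' \<in> set_pmf X" "C = beside Q C'" by (auto simp: ic)
    then show "conf_typed \<Sigma> U C"
      using beside_typed[OF dist_typedD[OF that]] Q unfolding context_typed_def by blast
  qed
  have ex: "expect (in_context Q X) = (\<lambda>\<phi>. expect X (\<lambda>C. \<phi> (beside Q C)))" if "dist_typed \<Sigma> \<Sigma>' X" for X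
    using expect_map[OF dist_typed_finite[OF that]] by (simp add: ic fun_eq_iff)
  have "context_span \<Sigma> U (expect (in_context Q \<Delta>)) (expect (in_context Q \<Theta>))"
  proof (cases "finite \<Sigma>")
    case True
    have "placed \<Sigma> \<Sigma>' U Q X" if "dist_typed \<Sigma> \<Sigma>' X" "deterministically_tagged (in_context Q X)" for X
    proof -
      have "Par P Q \<in> procs (in_context Q X)" if "P \<in> procs X" for P
        using that unfolding procs_def ic by (force simp: image_iff)
      then show ?thesis
        using that True Q by (auto simp: placed_def context_typed_def deterministically_tagged_iff)
    qed
    then show ?thesis unfolding ex[OF typed(1)] ex[OF typed(2)] using typed dt by (intro span_base[OF bis]) auto
  next
    case False
    \<comment> \<open>Density operators live on finite registers, so over an infinite \<Sigma> only
      \<bottom> is typed.\<close>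
    have "expect X \<psi> = expect X (\<lambda>C. 0)" if X: "dist_typed \<Sigma> \<Sigma>' X" for X \<psi>
    proof (rule expect_cong)
      fix C assume "Some C \<in> set_pmf X"
      from dist_typedD[OF X this] False show "\<psi> C = 0" by (cases C) (auto simp: density_operator_def)
    qed
    then show ?thesis unfolding ex[OF typed(1)] ex[OF typed(2)] using typed by (simp add: expect_zero span_zero)
  qed
  then have "(in_context Q \<Delta>, in_context Q \<Theta>) \<in> context_related"
    unfolding context_related_def using typed' typed dt by blast
  then show ?thesis
    unfolding labelled_bisimilarity_def using labelled_bisimulation_context_related by blast
qed

theorem theorem8:
  shows "labelled_bisimilarity \<subseteq> saturated_bisimilarity"
proof -
  have "saturated_bisimulation labelled_bisimilarity"
    unfolding saturated_bisimulation_def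
  proof (intro ballI, clarify, intro conjI)
    fix \<Delta> \<Theta> assume bis: "(\<Delta>, \<Theta>) \<in> labelled_bisimilarity"
    then obtain \<Sigma> \<Sigma>' where dt: "deterministically_tagged \<Delta>" "deterministically_tagged \<Theta>"
      and typed: "dist_typed \<Sigma> \<Sigma>' \<Delta>" "dist_typed \<Sigma> \<Sigma>' \<Theta>"
      and ptr: "partial_trace \<Sigma>' (quantum_state \<Delta>) = partial_trace \<Sigma>' (quantum_state \<Theta>)"
      by (elim bisimilar_cases) blast
    show "deterministically_tagged \<Delta>" "deterministically_tagged \<Theta>" by (rule dt)+
    show "\<exists>\<Sigma> \<Sigma>'. dist_typed \<Sigma> \<Sigma>' \<Delta> \<and> dist_typed \<Sigma> \<Sigma>' \<Theta> \<and>
       mass \<Delta> = mass \<Theta> \<and>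
       (\<forall>Q \<Sigma>'' \<delta>. context_typed \<Sigma>'' Q \<Sigma>' \<and> \<Sigma>'' \<subseteq> \<Sigma> \<and>
          deterministically_tagged (in_context Q \<Delta>) \<and> deterministically_tagged (in_context Q \<Theta>) \<longrightarrow>
          (\<forall>\<Delta>'. dist_trans (in_context Q \<Delta>) Silent \<delta> \<Delta>' \<longrightarrow>
             (\<exists>\<Theta>'. dist_trans (in_context Q \<Theta>) Silent \<delta> \<Theta>' \<and> (\<Delta>', \<Theta>') \<in> labelled_bisimilarity)) \<and>
          (\<forall>\<Theta>'. dist_trans (in_context Q \<Theta>) Silent \<delta> \<Theta>' \<longrightarrow>
             (\<exists>\<Delta>'. dist_trans (in_context Q \<Delta>) Silent \<delta> \<Delta>' \<and> (\<Delta>', \<Theta>') \<in> labelled_bisimilarity)))"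
    proof (rule exI[of _ \<Sigma>], rule exI[of _ \<Sigma>'], intro conjI[OF typed(1)] conjI[OF typed(2)]
        conjI[OF mass_eq[OF typed ptr]] allI impI, elim conjE)
      fix Q \<Sigma>'' \<delta>
      assume "context_typed \<Sigma>'' Q \<Sigma>'" "\<Sigma>'' \<subseteq> \<Sigma>"
        "deterministically_tagged (in_context Q \<Delta>)" "deterministically_tagged (in_context Q \<Theta>)"
      from bisimilar_in_context[OF bis typed this]
      show "(\<forall>\<Delta>'. dist_trans (in_context Q \<Delta>) Silent \<delta> \<Delta>' \<longrightarrow>
             (\<exists>\<Theta>'. dist_trans (in_context Q \<Theta>) Silent \<delta> \<Theta>' \<and> (\<Delta>', \<Theta>') \<in> labelled_bisimilarity)) \<and>
          (\<forall>\<Theta>'. dist_trans (in_context Q \<Theta>) Silent \<delta> \<Theta>' \<longrightarrow>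
             (\<exists>\<Delta>'. dist_trans (in_context Q \<Delta>) Silent \<delta> \<Delta>' \<and> (\<Delta>', \<Theta>') \<in> labelled_bisimilarity))"
        by (elim bisimilar_cases) blast
    qed
  qed
  then show ?thesis unfolding saturated_bisimilarity_def by blast
qed

end
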